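(* Let $p : \mathbf{R}^d \to \mathbf{R}$ be a polynomial with real coefficients of degree $m \geq 2$, and consider the solution operator $e^{-itp(D_x)}$ to the Cauchy problem $$\partial_t u(t,x) + i p(D_x) u(t,x) = 0, \quad x \in \mathbf{R}^d,\ t \in \mathbf{R}, \qquad u(0,\cdot) = u_0 .$$ Let $s, \theta > 0$ and let $t \in \mathbf{R}$. (i) If $\theta \geq (m-1)s \geq 1$ then $e^{-itp(D_x)}$ is continuous on $\mathcal{S}_\theta^s(\mathbf{R}^d)$. (ii) If $\theta \geq (m-1)s \geq 1$ and $(s,\theta) \neq \left(\frac{1}{m-1}, 1\right)$ then $e^{-itp(D_x)}$ is continuous on $\Sigma_\theta^s(\mathbf{R}^d)$. (iii) If $d = 1$, $1 \leq \theta < sm - \max(s,1)$, $s \geq 1$ if $m = 3$, and $t \neq 0$, then $e^{-itp(D_x)} \mathcal{S}_\theta^s(\mathbf{R}) \nsubseteq \mathcal{S}_\theta^s(\mathbf{R})$. (iv) If $d = 1$, $1 < \theta < sm - \max(s,1)$, $s > 1$ if $m = 3$, and $t \neq 0$, then $e^{-itp(D_x)} \Sigma_\theta^s(\mathbf{R}) \nsubseteq \Sigma_\theta^s(\mathbf{R})$.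
   Context: Notation: $\mathbf{N} = \{0,1,2,\dots\}$, $|\alpha| = \sum_j \alpha_j$ for $\alpha \in \mathbf{N}^d$, $D^\beta = i^{-|\beta|}\partial^\beta$. The Fourier transform of $f$ in the Schwartz space $\mathscr{S}(\mathbf{R}^d)$ is $\widehat f(\xi) = (2\pi)^{-d/2}\int_{\mathbf{R}^d} f(x) e^{-i\langle x,\xi\rangle}\,dx$. The solution operator (propagator) is $$e^{-itp(D_x)}u_0(x) = (2\pi)^{-d/2}\int_{\mathbf{R}^d} e^{i\langle x,\xi\rangle - itp(\xi)}\,\widehat{u_0}(\xi)\,d\xi, \quad u_0 \in \mathscr{S}(\mathbf{R}^d).$$ Gelfand--Shilov spaces: for $\theta, s, h > 0$, $\mathcal{S}_{\theta,h}^s(\mathbf{R}^d)$ is the Banach space of all $f \in C^\infty(\mathbf{R}^d)$ such that $$\|f\|_{\mathcal{S}_{\theta,h}^s} = \sup_{\alpha,\beta \in \mathbf{N}^d,\ x \in \mathbf{R}^d} \frac{|x^\alpha D^\beta f(x)|}{h^{|\alpha+\beta|}\, \alpha!^\theta\, \beta!^s} < \infty.$$ The Roumieu space is $\mathcal{S}_\theta^s(\mathbf{R}^d) = \bigcup_{h>0} \mathcal{S}_{\theta,h}^s(\mathbf{R}^d)$ with the (locally convex) inductive limit topology. The Beurling space is $\Sigma_\theta^s(\mathbf{R}^d) = \bigcap_{h>0} \mathcal{S}_{\theta,h}^s(\mathbf{R}^d)$ with the Fréchet space topology defined by the seminorms $\|\cdot\|_{\mathcal{S}_{\theta,h}^s}$,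 $h>0$. Both are contained in $\mathscr{S}(\mathbf{R}^d)$. An operator is continuous on $X$ if it maps $X$ into $X$ continuously. *)

theory Defs
  imports "HOL-Analysis.Analysis"
begin

text \<open>Multi-indices are functions from the (finite) coordinate type to the naturals.\<close>

definition mi_abs :: "('d::finite \<Rightarrow> nat) \<Rightarrow> nat" where
  "mi_abs \<alpha> = (\<Sum>j\<in>UNIV. \<alpha> j)"

definition mi_fact :: "('d::finite \<Rightarrow> nat) \<Rightarrow> real" where
  "mi_fact \<alpha> = (\<Prod>j\<in>UNIV. fact (\<alpha> j))"

definition mi_pow :: "real ^ 'd::finite \<Rightarrow> ('d \<Rightarrow> nat) \<Rightarrow> real" where
  "mi_pow x \<alpha> = (\<Prod>j\<in>UNIV. (x $ j) ^ \<alpha> j)"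

definition polynomial_of_degree :: "nat \<Rightarrow> (real ^ 'd::finite \<Rightarrow> real) \<Rightarrow> bool" where
  "polynomial_of_degree m p \<longleftrightarrow>
    (\<exists>c :: ('d \<Rightarrow> nat) \<Rightarrow> real.
       finite {\<alpha>. c \<alpha> \<noteq> 0} \<and>
       (\<forall>x. p x = (\<Sum>\<alpha> | c \<alpha> \<noteq> 0. c \<alpha> * mi_pow x \<alpha>)) \<and>
       (\<exists>\<alpha>. c \<alpha> \<noteq> 0 \<and> mi_abs \<alpha> = m) \<and>
       (\<forall>\<alpha>. c \<alpha> \<noteq> 0 \<longrightarrow> mi_abs \<alpha> \<le> m))"

definition partial_deriv :: "'d::finite \<Rightarrow> (real ^ 'd \<Rightarrow> complex) \<Rightarrow> real ^ 'd \<Rightarrow> complex" where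
  "partial_deriv j f x = frechet_derivative f (at x) (axis j 1)"

text \<open>\<open>C\<^sup>\<infinity>\<close>: every iterated partial derivative is (Frechet) differentiable everywhere. As
  differentiability implies continuity, this says that the partial derivatives of all orders
  exist and are continuous.\<close>

definition smooth :: "(real ^ 'd::finite \<Rightarrow> complex) \<Rightarrow> bool" where
  "smooth f \<longleftrightarrow> (\<forall>js x. foldr partial_deriv js f differentiable (at x))"

text \<open>The list chosen below contains each coordinate \<open>j\<close> exactly \<open>\<beta> j\<close> times. For smooth functions
  partial derivatives commute, so the order in which they are taken does not matter.\<close>

definition mi_partial :: "('d::finite \<Rightarrow> nat) \<Rightarrow> (real ^ 'd \<Rightarrow> complex) \<Rightarrow> real ^ 'd \<Rightarrow> complex" where
  "mi_partial \<beta> f = foldr partial_deriv (SOME js. \<forall>j. count_list js j = \<beta> j) f"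

definition mi_D :: "('d::finite \<Rightarrow> nat) \<Rightarrow> (real ^ 'd \<Rightarrow> complex) \<Rightarrow> real ^ 'd \<Rightarrow> complex" where
  "mi_D \<beta> f x = (1 / \<i>) ^ mi_abs \<beta> * mi_partial \<beta> f x"

definition fourier :: "(real ^ 'd::finite \<Rightarrow> complex) \<Rightarrow> real ^ 'd \<Rightarrow> complex" where
  "fourier f \<xi> = of_real ((2 * pi) powr (- real CARD('d) / 2)) *
     (LINT x|lborel. f x * exp (- \<i> * of_real (x \<bullet> \<xi>)))"

text \<open>The operator \<open>e\<^bsup>-itp(D)\<^esup>\<close>. It is only meaningful on Schwartz functions (in particular on the
  spaces below), for which both integrals converge absolutely.\<close>

definition propagator ::
  "(real ^ 'd::finite \<Rightarrow> real) \<Rightarrow> real \<Rightarrow> (real ^ 'd \<Rightarrow> complex) \<Rightarrow> real ^ 'd \<Rightarrow> complex" where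
  "propagator p t u x = of_real ((2 * pi) powr (- real CARD('d) / 2)) *
     (LINT \<xi>|lborel. exp (\<i> * of_real (x \<bullet> \<xi>) - \<i> * of_real (t * p \<xi>)) * fourier u \<xi>)"


subsection \<open>Locally convex topologies on spaces of functions\<close>

definition seminorm_on :: "('a \<Rightarrow> complex) set \<Rightarrow> (('a \<Rightarrow> complex) \<Rightarrow> real) \<Rightarrow> bool" where
  "seminorm_on E q \<longleftrightarrow>
     (\<forall>f\<in>E. 0 \<le> q f) \<and>
     (\<forall>f\<in>E. \<forall>g\<in>E. q (\<lambda>x. f x + g x) \<le> q f + q g) \<and>
     (\<forall>f\<in>E. \<forall>c. q (\<lambda>x. c * f x) = cmod c * q f)"

text \<open>The topology on the linear space \<open>E\<close> generated by a family \<open>Q\<close> of seminorms: the open balls form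
  a subbasis. The set \<open>E\<close> itself only matters when \<open>Q\<close> is empty.\<close>

definition seminorm_topology ::
  "('a \<Rightarrow> complex) set \<Rightarrow> (('a \<Rightarrow> complex) \<Rightarrow> real) set \<Rightarrow> ('a \<Rightarrow> complex) topology" where
  "seminorm_topology E Q = topology_generated_by
     (insert E {{g\<in>E. q (\<lambda>x. g x - f x) < r} | f q r. f \<in> E \<and> q \<in> Q \<and> 0 < r})"

definition locally_convex_on :: "('a \<Rightarrow> complex) set \<Rightarrow> ('a \<Rightarrow> complex) topology \<Rightarrow> bool" where
  "locally_convex_on E T \<longleftrightarrow> (\<exists>Q. (\<forall>q\<in>Q. seminorm_on E q) \<and> T = seminorm_topology E Q)"

text \<open>The locally convex inductive limit of the spaces \<open>T i\<close>: the finest locally convex topology on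
  their union for which all inclusion maps are continuous. It is obtained as the join of all locally
  convex topologies with that property (the join is again locally convex, being generated by the union
  of the families of seminorms).\<close>

definition lc_inductive_limit ::
  "'i set \<Rightarrow> ('i \<Rightarrow> ('a \<Rightarrow> complex) topology) \<Rightarrow> ('a \<Rightarrow> complex) topology" where
  "lc_inductive_limit I T = topology_generated_by
     {U. \<exists>L. locally_convex_on (\<Union>i\<in>I. topspace (T i)) L \<and>
              (\<forall>i\<in>I. continuous_map (T i) L (\<lambda>f. f)) \<and> openin L U}"

lemma topspace_seminorm_topology [simp]: "topspace (seminorm_topology E Q) = E"
  unfolding seminorm_topology_def topology_generated_by_topspace by auto

lemma topspace_lc_inductive_limit [simp]:
  "topspace (lc_inductive_limit I T) = (\<Union>i\<in>I. topspace (T i))"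
proof -
  let ?E = "\<Union>i\<in>I. topspace (T i)"
  let ?L = "seminorm_topology ?E {}"
  have "locally_convex_on ?E ?L"
    unfolding locally_convex_on_def by blast
  moreover have "continuous_map (T i) ?L (\<lambda>f. f)" if "i \<in> I" for i
  proof -
    have "topspace (T i) \<inter> ?E = topspace (T i)"
      using that by auto
    then show ?thesis
      using that unfolding seminorm_topology_def
      by (intro continuous_on_generated_topo) (auto simp: Int_commute vimage_def)
  qed
  moreover have "openin ?L ?E"
    using openin_topspace[of ?L] by simp
  ultimately have "?E \<in> {U. \<exists>L. locally_convex_on ?E L \<and>
              (\<forall>i\<in>I. continuous_map (T i) L (\<lambda>f. f)) \<and> openin L U}"
    by blast
  moreover have "U \<subseteq> ?E" if "locally_convex_on ?E L" "openin L U" for L U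
    using that openin_subset unfolding locally_convex_on_def by fastforce
  ultimately show ?thesis
    unfolding lc_inductive_limit_def topology_generated_by_topspace by blast
qed


subsection \<open>Gelfand--Shilov spaces\<close>

text \<open>\<open>GS_step \<theta> s h\<close> with the norm \<open>GS_norm \<theta> s h\<close> is the Banach space \<open>S\<^sup>s\<^bsub>\<theta>,h\<^esub>\<close>; \<open>\<theta>\<close> governs decay and
  \<open>s\<close> regularity. The value of \<open>GS_norm\<close> is junk outside \<open>GS_step\<close>.\<close>

definition GS_quot ::
  "real \<Rightarrow> real \<Rightarrow> real \<Rightarrow> (real ^ 'd::finite \<Rightarrow> complex) \<Rightarrow>
    ('d \<Rightarrow> nat) \<times> ('d \<Rightarrow> nat) \<times> (real ^ 'd) \<Rightarrow> real" where
  "GS_quot \<theta> s h f = (\<lambda>(\<alpha>, \<beta>, x).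
     cmod (of_real (mi_pow x \<alpha>) * mi_D \<beta> f x) /
       (h ^ mi_abs (\<lambda>j. \<alpha> j + \<beta> j) * mi_fact \<alpha> powr \<theta> * mi_fact \<beta> powr s))"

definition GS_step :: "real \<Rightarrow> real \<Rightarrow> real \<Rightarrow> (real ^ 'd::finite \<Rightarrow> complex) set" where
  "GS_step \<theta> s h = {f. smooth f \<and> bdd_above (range (GS_quot \<theta> s h f))}"

definition GS_norm :: "real \<Rightarrow> real \<Rightarrow> real \<Rightarrow> (real ^ 'd::finite \<Rightarrow> complex) \<Rightarrow> real" where
  "GS_norm \<theta> s h f = (SUP z. GS_quot \<theta> s h f z)"

definition Roumieu :: "real \<Rightarrow> real \<Rightarrow> (real ^ 'd::finite \<Rightarrow> complex) set" where
  "Roumieu \<theta> s = (\<Union>h\<in>{0<..}. GS_step \<theta> s h)"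

definition Roumieu_topology :: "real \<Rightarrow> real \<Rightarrow> (real ^ 'd::finite \<Rightarrow> complex) topology" where
  "Roumieu_topology \<theta> s =
     lc_inductive_limit {0<..} (\<lambda>h. seminorm_topology (GS_step \<theta> s h) {GS_norm \<theta> s h})"

definition Beurling :: "real \<Rightarrow> real \<Rightarrow> (real ^ 'd::finite \<Rightarrow> complex) set" where
  "Beurling \<theta> s = (\<Inter>h\<in>{0<..}. GS_step \<theta> s h)"

definition Beurling_topology :: "real \<Rightarrow> real \<Rightarrow> (real ^ 'd::finite \<Rightarrow> complex) topology" where
  "Beurling_topology \<theta> s = seminorm_topology (Beurling \<theta> s) (GS_norm \<theta> s ` {0<..})"

lemma topspace_Roumieu_topology [simp]: "topspace (Roumieu_topology \<theta> s) = Roumieu \<theta> s"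
  by (simp add: Roumieu_topology_def Roumieu_def)

lemma topspace_Beurling_topology [simp]: "topspace (Beurling_topology \<theta> s) = Beurling \<theta> s"
  by (simp add: Beurling_topology_def)

end

theory Submission
  imports Defs "HOL-Complex_Analysis.Complex_Analysis" "HOL-Probability.Probability"
begin

text \<open>
  Let \<open>P = e\<^bsup>-itp(D)\<^esup>\<close>. On the Fourier side \<open>P\<close> is multiplication by a function of modulus one whose
  derivatives grow quickly. Both halves of the proof turn on how these derivatives compare with the
  weights of the spaces.

  \<^emph>\<open>Continuity.\<close> The derivatives of \<open>e\<^bsup>-itp\<^esup>\<close> need not be computed, because \<open>P\<close> commutes with the
  partial derivatives and satisfies \<open>x\<^sub>j P = P A\<^sub>j\<close> with \<open>A\<^sub>j = x\<^sub>j + t (\<partial>\<^sub>jp)(D)\<close>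
  (\<open>coord_mult_propagator\<close>). Hence \<open>x\<^sup>\<alpha> \<partial>\<^sup>\<beta> P u = P (A\<^sup>\<alpha> \<partial>\<^sup>\<beta> u)\<close>, and the supremum of \<open>\<bar>P w\<bar>\<close> is bounded by
  finitely many Schwartz seminorms of \<open>w\<close>, for the Fourier multiplier has modulus one
  (\<open>cmod_propagator_le\<close>). It remains to follow the weights through a word in the \<open>A\<^sub>j\<close>. Up to
  geometric factors \<open>\<alpha>!\<^sup>\<theta> \<beta>!\<^sup>s\<close> is \<open>X\<^sup>X\<close> with \<open>X = K + \<theta>\<bar>\<alpha>\<bar> + s\<bar>\<beta>\<bar>\<close>, where \<open>K\<close> is any fixed shift. One
  operator \<open>A\<^sub>j\<close> raises \<open>X\<close> by at most \<open>\<theta>\<close>: the coordinate by exactly \<open>\<theta>\<close>, the derivatives in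
  \<open>(\<partial>\<^sub>jp)(D)\<close> by at most \<open>(m-1)s \<le> \<theta>\<close>; and the commutator of a derivative with \<open>x\<^sub>j\<close> lowers \<open>X\<close> by \<open>s\<close> at
  the price of a factor \<open>X\<close>, which is affordable since \<open>\<theta> + s \<ge> 1\<close>. So \<open>A\<^sub>j\<close> costs one factor \<open>H\<close>
  (\<open>growth_bound_evolved_coord\<close>). Any finite \<open>H\<close> gives the Roumieu case. In the Beurling case \<open>H\<close> must be
  small: the coordinate and the derivatives of positive order carry a factor \<open>h\<close>, and a large shift
  \<open>K\<close> makes the commutator and the terms of order zero small because \<open>\<theta> + s > 1\<close>. The passage to the
  topologies is formal (\<open>continuous_map_lc_inductive_limit\<close>).

  \<^emph>\<open>Failure in dimension one.\<close> The witness \<open>u\<close> is the inverse Fourier transform of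
  \<open>f(\<xi>) = exp (-(1 + \<xi>\<^sup>2)\<^bsup>1/(2r)\<^esup>)\<close>, with \<open>r = s\<close> for Roumieu spaces and \<open>r\<close> slightly smaller than \<open>s\<close> for
  Beurling spaces. As \<open>f\<close> is analytic in a strip, Cauchy's inequality bounds \<open>x\<^sup>a \<partial>\<^sup>b u\<close> by a constant times
  \<open>k\<^bsup>a+b\<^esup> a! b!\<^sup>r\<close> (\<open>inverse_profile_estimate\<close>), so \<open>u\<close> lies in the space. If \<open>P u\<close> belonged to it too, Fourier
  inversion would bound the derivatives of \<open>e\<^bsup>-itp\<^esup> f\<close> of order \<open>n\<close> by \<open>C h\<^sup>n n!\<^sup>\<theta>\<close>, uniformly on the
  line. But at \<open>\<xi> = n\<^sup>r\<close> the factor \<open>f\<close> is no smaller than \<open>e\<^bsup>-cn\<^esup>\<close>, while \<open>e\<^bsup>-itp\<^esup>\<close> oscillates with a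
  frequency of size \<open>\<xi>\<^bsup>m-1\<^esup>\<close>, so that derivative is at least \<open>(c n\<^bsup>r(m-1)\<^esup>)\<^sup>n\<close>
  (\<open>higher_deriv_exp_lower_bound\<close>); since \<open>\<theta> < r(m-1)\<close> this is absurd for large \<open>n\<close>. Reading off the
  leading oscillation requires \<open>n\<close> to be small compared with \<open>\<xi>\<^bsup>m/2\<^esup>\<close>, that is \<open>rm > 2\<close>, and this is
  what \<open>1 \<le> \<theta> < sm - max(s, 1)\<close> provides.
\<close>

section \<open>Continuity of linear maps between seminormed spaces and inductive limits\<close>

definition fun_subspace :: "('a \<Rightarrow> complex) set \<Rightarrow> bool" where
  "fun_subspace E \<longleftrightarrow>
     (\<forall>f\<in>E. \<forall>g\<in>E. (\<lambda>x. f x + g x) \<in> E) \<and> (\<forall>f\<in>E. \<forall>c. (\<lambda>x. c * f x) \<in> E)"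

definition fun_linear_on ::
  "('a \<Rightarrow> complex) set \<Rightarrow> (('a \<Rightarrow> complex) \<Rightarrow> ('b \<Rightarrow> complex)) \<Rightarrow> bool" where
  "fun_linear_on E T \<longleftrightarrow>
     (\<forall>f\<in>E. \<forall>g\<in>E. T (\<lambda>x. f x + g x) = (\<lambda>x. T f x + T g x)) \<and>
     (\<forall>f\<in>E. \<forall>c. T (\<lambda>x. c * f x) = (\<lambda>x. c * T f x))"

lemma fun_subspaceD:
  assumes "fun_subspace E" "f \<in> E"
  shows "g \<in> E \<Longrightarrow> (\<lambda>x. f x + g x) \<in> E" and "(\<lambda>x. c * f x) \<in> E"
  using assms unfolding fun_subspace_def by simp_all

lemma fun_linear_onD:
  assumes "fun_linear_on E T" "f \<in> E"
  shows "g \<in> E \<Longrightarrow> T (\<lambda>x. f x + g x) = (\<lambda>x. T f x + T g x)"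
    and "T (\<lambda>x. c * f x) = (\<lambda>x. c * T f x)"
  using assms unfolding fun_linear_on_def by simp_all

lemma seminorm_onD:
  assumes "seminorm_on E q" "f \<in> E"
  shows "0 \<le> q f" and "g \<in> E \<Longrightarrow> q (\<lambda>x. f x + g x) \<le> q f + q g"
    and "q (\<lambda>x. c * f x) = cmod c * q f"
  using assms unfolding seminorm_on_def by simp_all

lemma fun_subspace_diff:
  assumes "fun_subspace E" "f \<in> E" "g \<in> E"
  shows "(\<lambda>x. f x - g x) \<in> E"
  using fun_subspaceD(1)[OF assms(1,2) fun_subspaceD(2)[OF assms(1,3), of "-1"]] by simp

lemma fun_linear_on_diff:
  assumes "fun_linear_on E T" "fun_subspace E" "f \<in> E" "g \<in> E"
  shows "T (\<lambda>x. f x - g x) = (\<lambda>x. T f x - T g x)"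
  using fun_linear_onD(1)[OF assms(1,3) fun_subspaceD(2)[OF assms(2,4), of "-1"]]
    fun_linear_onD(2)[OF assms(1,4), of "-1"] by simp

lemma fun_linear_on_subset: "fun_linear_on E T \<Longrightarrow> F \<subseteq> E \<Longrightarrow> fun_linear_on F T"
  unfolding fun_linear_on_def by blast

lemma seminorm_on_compose:
  assumes "seminorm_on F q" "fun_linear_on E T" and "\<And>f. f \<in> E \<Longrightarrow> T f \<in> F"
  shows "seminorm_on E (\<lambda>f. q (T f))"
  unfolding seminorm_on_def
  by (intro conjI ballI allI; simp add: fun_linear_onD[OF assms(2)] seminorm_onD[OF assms(1)] assms(3))

lemma openin_seminorm_ball:
  assumes "f \<in> E" "q \<in> Q" "0 < r"
  shows "openin (seminorm_topology E Q) {g\<in>E. q (\<lambda>x. g x - f x) < r}"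
  unfolding seminorm_topology_def using assms
  by (intro topology_generated_by_Basis) blast

lemma seminorm_zero:
  assumes "seminorm_on E q" "fun_subspace E" "u \<in> E"
  shows "q (\<lambda>x. u x - u x) = 0"
using seminorm_onD(3)[OF assms(1,3), of 0] by simp

lemma continuous_map_seminorm_topology:
  assumes E: "fun_subspace E" and F: "fun_subspace F"
    and lin: "fun_linear_on E T" and maps: "\<And>f. f \<in> E \<Longrightarrow> T f \<in> F"
    and Q: "\<And>q. q \<in> Q \<Longrightarrow> seminorm_on E q" and R: "\<And>q. q \<in> R \<Longrightarrow> seminorm_on F q"
    and bound: "\<And>q. q \<in> R \<Longrightarrow> \<exists>p\<in>Q. \<exists>C. \<forall>f\<in>E. q (T f) \<le> C * p f"
  shows "continuous_map (seminorm_topology E Q) (seminorm_topology F R) T"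
proof -
  let ?S = "insert F {{g\<in>F. q (\<lambda>x. g x - f x) < r} | f q r. f \<in> F \<and> q \<in> R \<and> 0 < r}"
  have "openin (seminorm_topology E Q) (T -` U \<inter> topspace (seminorm_topology E Q))" if U: "U \<in> ?S" for U
  proof -
    consider "U = F" | f q r where "f \<in> F" "q \<in> R" "0 < r" "U = {g\<in>F. q (\<lambda>x. g x - f x) < r}"
      using U by blast
    then show ?thesis
    proof cases
      case 1
      then have "T -` U \<inter> topspace (seminorm_topology E Q) = topspace (seminorm_topology E Q)"
        using maps by auto
      then show ?thesis by (metis openin_topspace)
    next
      case 2
      obtain p C where p: "p \<in> Q" and C: "\<And>f. f \<in> E \<Longrightarrow> q (T f) \<le> C * p f"
        using bound[OF 2(2)] by blast
      have snq: "seminorm_on F q" and snp: "seminorm_on E p" using R Q 2(2) p by auto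
      have "\<exists>B. openin (seminorm_topology E Q) B \<and> u \<in> B \<and> B \<subseteq> T -` U \<inter> E"
        if u: "u \<in> T -` U \<inter> E" for u
      proof -
        define \<delta> where "\<delta> = (r - q (\<lambda>x. T u x - f x)) / (\<bar>C\<bar> + 1)"
        have \<delta>: "\<delta> > 0" unfolding \<delta>_def using u 2 by auto
        let ?B = "{v\<in>E. p (\<lambda>x. v x - u x) < \<delta>}"
        have "v \<in> T -` U \<inter> E" if v: "v \<in> ?B" for v
        proof -
          have vE: "v \<in> E" and uE: "u \<in> E" using u v by auto
          have d: "(\<lambda>x. v x - u x) \<in> E" using fun_subspace_diff[OF E vE uE] .
          have "q (\<lambda>x. (T v x - T u x) + (T u x - f x))
             \<le> q (\<lambda>x. T v x - T u x) + q (\<lambda>x. T u x - f x)"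
            by (rule seminorm_onD(2)[OF snq fun_subspace_diff[OF F maps[OF vE] maps[OF uE]]
                  fun_subspace_diff[OF F maps[OF uE] 2(1)]])
          moreover have "q (\<lambda>x. T v x - T u x) \<le> C * p (\<lambda>x. v x - u x)"
            using C[OF d] fun_linear_on_diff[OF lin E vE uE] by simp
          moreover have "0 \<le> p (\<lambda>x. v x - u x)"
            by (rule seminorm_onD(1)[OF snp d])
          then have "C * p (\<lambda>x. v x - u x) \<le> (\<bar>C\<bar> + 1) * p (\<lambda>x. v x - u x)"
            by (intro mult_right_mono) auto
          moreover have "(\<bar>C\<bar> + 1) * p (\<lambda>x. v x - u x) < (\<bar>C\<bar> + 1) * \<delta>"
            using v by (intro mult_strict_left_mono) auto
          moreover have "(\<bar>C\<bar> + 1) * \<delta> = r - q (\<lambda>x. T u x - f x)"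
            unfolding \<delta>_def by (simp add: field_simps add_pos_nonneg)
          ultimately have "q (\<lambda>x. T v x - f x) < r" by simp
          then show ?thesis using 2 maps vE by auto
        qed
        moreover have "u \<in> ?B" using u \<delta> seminorm_zero[OF snp E, of u] by auto
        moreover have "openin (seminorm_topology E Q) ?B"
          using u p \<delta> by (intro openin_seminorm_ball) auto
        ultimately show ?thesis by blast
      qed
      then have "openin (seminorm_topology E Q) (T -` U \<inter> E)"
        by (subst openin_subopen) blast
      then show ?thesis by simp
    qed
  qed
  moreover have "T ` topspace (seminorm_topology E Q) \<subseteq> \<Union> ?S"
    using maps by auto
  ultimately show ?thesis
    unfolding seminorm_topology_def[of F R] by (intro continuous_on_generated_topo)
qed

text \<open>The inductive limit topology is the finest one of its kind, so the topology that a linear map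
  pulls back from a competitor on the target is again a competitor on the source.\<close>

lemma continuous_map_lc_inductive_limit:
  fixes E :: "'i \<Rightarrow> ('a \<Rightarrow> complex) set" and n :: "'i \<Rightarrow> ('a \<Rightarrow> complex) \<Rightarrow> real"
  assumes sub: "\<And>i. i \<in> I \<Longrightarrow> fun_subspace (E i)"
    and sn: "\<And>i. i \<in> I \<Longrightarrow> seminorm_on (E i) (n i)"
    and lin: "fun_linear_on (\<Union>i\<in>I. E i) T"
    and bound: "\<And>i. i \<in> I \<Longrightarrow> \<exists>k\<in>I. \<exists>C. \<forall>f\<in>E i. T f \<in> E k \<and> n k (T f) \<le> C * n i f"
    and subU: "fun_subspace (\<Union>i\<in>I. E i)"
  shows "continuous_map (lc_inductive_limit I (\<lambda>i. seminorm_topology (E i) {n i}))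
           (lc_inductive_limit I (\<lambda>i. seminorm_topology (E i) {n i})) T"
proof -
  let ?t = "\<lambda>i. seminorm_topology (E i) {n i}" 
  define W where "W = (\<Union>i\<in>I. E i)"
  let ?good = "\<lambda>L. locally_convex_on W L \<and> (\<forall>i\<in>I. continuous_map (?t i) L (\<lambda>f. f))"
  let ?S = "{U. \<exists>L. locally_convex_on (\<Union>i\<in>I. topspace (?t i)) L \<and>
              (\<forall>i\<in>I. continuous_map (?t i) L (\<lambda>f. f)) \<and> openin L U}"
  have EW: "f \<in> W" if "i \<in> I" "f \<in> E i" for i f using that unfolding W_def by blast
  have subW: "fun_subspace W" and lin: "fun_linear_on W T" using subU lin unfolding W_def .
  have S: "?S = {U. \<exists>L. ?good L \<and> openin L U}" by (simp add: W_def)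
  have maps: "T f \<in> W" if "f \<in> W" for f using that bound unfolding W_def by blast
  have "openin (lc_inductive_limit I ?t) (T -` U \<inter> topspace (lc_inductive_limit I ?t))"
    if U: "U \<in> ?S" for U
  proof -
    obtain L where L: "?good L" "openin L U" using U unfolding S by blast
    then obtain Q where Q: "\<And>q. q \<in> Q \<Longrightarrow> seminorm_on W q" and LQ: "L = seminorm_topology W Q"
      unfolding locally_convex_on_def by blast
    \<comment> \<open>The pullback of \<open>L\<close> along \<open>T\<close>.\<close>
    define L' where "L' = seminorm_topology W ((\<lambda>q f. q (T f)) ` Q)"
    have sn': "seminorm_on W (\<lambda>f. q (T f))" if "q \<in> Q" for q
      by (rule seminorm_on_compose[where T = T, OF Q[OF that] lin maps])
    have "locally_convex_on W L'"
      unfolding locally_convex_on_def L'_def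
      by (rule exI[of _ "(\<lambda>q f. q (T f)) ` Q"]) (simp add: sn')
    moreover have TL: "continuous_map (?t i) L T" if i: "i \<in> I" for i
    proof -
      obtain k C where k: "k \<in> I" and C: "\<And>f. f \<in> E i \<Longrightarrow> T f \<in> E k \<and> n k (T f) \<le> C * n i f"
        using bound[OF i] by blast
      have "continuous_map (?t i) (?t k) T"
      proof (rule continuous_map_seminorm_topology[OF sub[OF i] sub[OF k]])
        show "fun_linear_on (E i) T" using fun_linear_on_subset[OF lin] EW i by blast
        show "\<exists>p\<in>{n i}. \<exists>C. \<forall>f\<in>E i. q (T f) \<le> C * p f" if "q \<in> {n k}" for q
          using that C by blast
      qed (use C sn[OF i] sn[OF k] in auto)
      moreover have "continuous_map (?t k) L (\<lambda>f. f)" using L k by blast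
      ultimately have "continuous_map (?t i) L ((\<lambda>f. f) \<circ> T)" by (rule continuous_map_compose)
      then show ?thesis by (simp add: o_def)
    qed
    moreover have "continuous_map (?t i) L' (\<lambda>f. f)" if i: "i \<in> I" for i
      unfolding L'_def seminorm_topology_def[of W]
    proof (rule continuous_on_generated_topo)
      fix V assume "V \<in> insert W {{g \<in> W. q (\<lambda>x. g x - f x) < r} |f q r.
          f \<in> W \<and> q \<in> (\<lambda>q f. q (T f)) ` Q \<and> 0 < r}"
      then consider "V = W" | f q r where "f \<in> W" "q \<in> Q" "0 < r"
          "V = {g \<in> W. q (T (\<lambda>x. g x - f x)) < r}"
        by blast
      then show "openin (?t i) ((\<lambda>f. f) -` V \<inter> topspace (?t i))"
      proof cases
        case 1
        then have "(\<lambda>f. f) -` V \<inter> topspace (?t i) = topspace (?t i)" using i EW by auto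
        then show ?thesis by (metis openin_topspace)
      next
        case 2
        have "(\<lambda>f. f) -` V \<inter> topspace (?t i)
            = {g \<in> topspace (?t i). T g \<in> {h \<in> W. q (\<lambda>x. h x - T f x) < r}}"
        proof (rule set_eqI)
          fix g
          show "g \<in> (\<lambda>f. f) -` V \<inter> topspace (?t i) \<longleftrightarrow>
            g \<in> {g \<in> topspace (?t i). T g \<in> {h \<in> W. q (\<lambda>x. h x - T f x) < r}}"
            using 2 EW[OF i, of g] maps[of g] fun_linear_on_diff[OF lin subW, of g f] by auto
        qed
        also have "openin (?t i) \<dots>"
          using TL[OF i] by (rule openin_continuous_map_preimage)
            (use 2 maps in \<open>simp add: LQ openin_seminorm_ball\<close>)
        finally show ?thesis .
      qed
    qed (use i EW in auto)
    moreover have "openin L' (T -` U \<inter> W)"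
    proof -
      have "continuous_map L' L T"
        unfolding LQ L'_def
      proof (rule continuous_map_seminorm_topology[OF subW subW lin maps])
        show "seminorm_on W q" if "q \<in> (\<lambda>q f. q (T f)) ` Q" for q
          using that sn' by auto
        show "\<exists>p\<in>(\<lambda>q f. q (T f)) ` Q. \<exists>C. \<forall>f\<in>W. q (T f) \<le> C * p f" if "q \<in> Q" for q
          using that by (intro bexI[of _ "\<lambda>f. q (T f)"] exI[of _ 1]) auto
      qed (simp_all add: Q)
      then have "openin L' {x \<in> topspace L'. T x \<in> U}"
        using L(2) by (rule openin_continuous_map_preimage)
      moreover have "{x \<in> topspace L'. T x \<in> U} = T -` U \<inter> W" unfolding L'_def by auto
      ultimately show ?thesis by simp
    qed
    ultimately have "T -` U \<inter> W \<in> ?S" unfolding S by blast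
    then have "openin (lc_inductive_limit I ?t) (T -` U \<inter> W)"
      unfolding lc_inductive_limit_def by (rule topology_generated_by_Basis)
    moreover have "topspace (lc_inductive_limit I ?t) = W" unfolding W_def by simp
    ultimately show ?thesis by metis
  qed
  moreover have "T ` topspace (lc_inductive_limit I ?t) \<subseteq> \<Union> ?S"
  proof -
    have "\<Union> ?S = topspace (lc_inductive_limit I ?t)"
      unfolding lc_inductive_limit_def topology_generated_by_topspace by simp
    moreover have "topspace (lc_inductive_limit I ?t) = W" unfolding W_def by simp
    ultimately show ?thesis using maps by blast
  qed
  ultimately show ?thesis
    unfolding lc_inductive_limit_def[of I ?t] by (intro continuous_on_generated_topo) assumption+
qed

section \<open>Iterated partial derivatives\<close>

abbreviation partial_derivs :: "'d::finite list \<Rightarrow> (real ^ 'd \<Rightarrow> complex) \<Rightarrow> real ^ 'd \<Rightarrow> complex" where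
  "partial_derivs js f \<equiv> foldr partial_deriv js f"

lemma partial_deriv_eqI:
  assumes "\<And>x. (f has_derivative F x) (at x)"
  shows "partial_deriv j f = (\<lambda>x. F x (axis j 1))"
  unfolding partial_deriv_def using frechet_derivative_at[OF assms] by (intro ext) simp

lemma smooth_differentiable: "smooth f \<Longrightarrow> f differentiable (at x)"
  unfolding smooth_def by (metis foldr.simps(1) id_apply)

lemma smooth_partial_derivs: "smooth f \<Longrightarrow> smooth (partial_derivs js f)"
  unfolding smooth_def by (metis foldr_append)

lemma smooth_partial_deriv: "smooth f \<Longrightarrow> smooth (partial_deriv j f)"
  using smooth_partial_derivs[of f "[j]"] by simp

lemma smooth_has_derivative:
  "smooth f \<Longrightarrow> (f has_derivative frechet_derivative f (at x)) (at x)"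
  using smooth_differentiable frechet_derivative_works by blast

lemma smooth_continuous: "smooth f \<Longrightarrow> continuous_on UNIV f"
  by (meson continuous_at_imp_continuous_on differentiable_imp_continuous_within smooth_differentiable)

lemma partial_deriv_add:
  assumes "\<And>x. f differentiable (at x)" "\<And>x. g differentiable (at x)"
  shows "partial_deriv j (\<lambda>x. f x + g x) = (\<lambda>x. partial_deriv j f x + partial_deriv j g x)"
  unfolding partial_deriv_def[of _ f] partial_deriv_def[of _ g]
  by (rule partial_deriv_eqI)
    (intro has_derivative_add frechet_derivative_works[THEN iffD1] assms)

lemma partial_derivs_add:
  assumes "smooth f" "smooth g"
  shows "partial_derivs js (\<lambda>x. f x + g x) = (\<lambda>x. partial_derivs js f x + partial_derivs js g x)"
  by (induction js) (simp_all add: partial_deriv_add smooth_differentiable smooth_partial_derivs assms)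

lemma partial_deriv_cmult:
  assumes "smooth f"
  shows "partial_deriv j (\<lambda>x. c * f x) = (\<lambda>x. c * partial_deriv j f x)"
  unfolding partial_deriv_def[of _ f]
  by (rule partial_deriv_eqI) (intro has_derivative_mult_right smooth_has_derivative assms)

lemma partial_derivs_cmult:
  assumes "smooth f"
  shows "partial_derivs js (\<lambda>x. c * f x) = (\<lambda>x. c * partial_derivs js f x)"
  by (induction js) (simp_all add: partial_deriv_cmult smooth_partial_derivs assms)

lemma smooth_add: "smooth f \<Longrightarrow> smooth g \<Longrightarrow> smooth (\<lambda>x. f x + g x)"
  by (subst smooth_def) (auto simp: partial_derivs_add smooth_differentiable smooth_partial_derivs)

lemma smooth_cmult: "smooth f \<Longrightarrow> smooth (\<lambda>x. c * f x)"
  by (subst smooth_def)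
    (auto simp: partial_derivs_cmult smooth_differentiable smooth_partial_derivs intro!: differentiable_mult)

lemma partial_deriv_zero: "partial_deriv j (\<lambda>x. 0) = (\<lambda>x. 0)"
  by (subst partial_deriv_eqI[where F = "\<lambda>_ _. 0"]) auto

lemma partial_derivs_zero: "partial_derivs js (\<lambda>x. 0) = (\<lambda>x. 0)"
  by (induction js) (simp_all add: partial_deriv_zero)

lemma smooth_zero: "smooth (\<lambda>x. 0)"
  unfolding smooth_def by (simp add: partial_derivs_zero)

lemma smooth_sum_list:
  "(\<And>k. k \<in> set ks \<Longrightarrow> smooth (F k)) \<Longrightarrow> smooth (\<lambda>x. \<Sum>k\<leftarrow>ks. F k x)"
  by (induction ks) (auto simp: smooth_zero intro: smooth_add)

lemma partial_derivs_sum_list: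
  "(\<And>k. k \<in> set ks \<Longrightarrow> smooth (F k)) \<Longrightarrow>
    partial_derivs js (\<lambda>x. \<Sum>k\<leftarrow>ks. F k x) = (\<lambda>x. \<Sum>k\<leftarrow>ks. partial_derivs js (F k) x)"
  by (induction ks) (auto simp: partial_derivs_zero partial_derivs_add smooth_sum_list)

lemma partial_deriv_sum_list:
  assumes "\<And>k. k \<in> set ks \<Longrightarrow> smooth (F k)"
  shows "partial_deriv j (\<lambda>x. \<Sum>k\<leftarrow>ks. F k x) = (\<lambda>x. \<Sum>k\<leftarrow>ks. partial_deriv j (F k) x)"
  using partial_derivs_sum_list[of ks F "[j]"] assms by simp

text \<open>The Leibniz rule for multiplication by one coordinate involves, besides the product with the
  full derivative, one derivative for each occurrence of that coordinate among the differentiations.\<close>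

fun removals :: "'a \<Rightarrow> 'a list \<Rightarrow> 'a list list" where
  "removals j [] = []"
| "removals j (l # ls) = (if l = j then [ls] else []) @ map (Cons l) (removals j ls)"

lemma length_removals: "length (removals j ls) \<le> length ls"
  by (induction ls) auto

lemma length_in_removals: "k \<in> set (removals j ls) \<Longrightarrow> Suc (length k) = length ls"
  by (induction ls arbitrary: k) (auto split: if_splits)

lemma partial_deriv_coord_mult:
  assumes "smooth f"
  shows "partial_deriv l (\<lambda>x. of_real (x $ j) * f x)
    = (\<lambda>x. of_real (x $ j) * partial_deriv l f x + (if l = j then f x else 0))"
proof -
  have "((\<lambda>x. of_real (x $ j) * f x) has_derivative
     (\<lambda>v. of_real (x $ j) * frechet_derivative f (at x) v + of_real (v $ j) * f x)) (at x)" for x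
    by (intro has_derivative_mult smooth_has_derivative assms has_derivative_of_real
        bounded_linear.has_derivative[OF bounded_linear_vec_nth] has_derivative_ident)
  from partial_deriv_eqI[OF this] show ?thesis
    unfolding partial_deriv_def[of _ f] by (auto simp: axis_def fun_eq_iff)
qed

lemma differentiable_coord_mult:
  "smooth f \<Longrightarrow> (\<lambda>x. of_real (x $ j) * f x) differentiable (at x)"
  for f :: "real ^ 'd::finite \<Rightarrow> complex"
  using smooth_differentiable[of f]
  by (intro differentiable_mult)
    (auto simp: differentiable_def intro!: exI has_derivative_of_real
        bounded_linear.has_derivative[OF bounded_linear_vec_nth] has_derivative_ident)

lemma partial_derivs_coord_mult:
  assumes "smooth f"
  shows "partial_derivs ls (\<lambda>x. of_real (x $ j) * f x)
    = (\<lambda>x. of_real (x $ j) * partial_derivs ls f x + (\<Sum>k\<leftarrow>removals j ls. partial_derivs k f x))"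
proof (induction ls)
  case (Cons l ls)
  have "partial_derivs (l # ls) (\<lambda>x. of_real (x $ j) * f x)
    = (\<lambda>x. of_real (x $ j) * partial_derivs (l # ls) f x + (if l = j then partial_derivs ls f x else 0)
        + (\<Sum>k\<leftarrow>removals j ls. partial_derivs (l # k) f x))"
    by (simp add: Cons.IH partial_deriv_add differentiable_coord_mult smooth_differentiable
        smooth_sum_list smooth_partial_derivs assms partial_deriv_coord_mult partial_deriv_sum_list)
  then show ?case by (auto simp: o_def algebra_simps)
qed simp

lemma smooth_coord_mult:
  assumes "smooth f"
  shows "smooth (\<lambda>x. of_real (x $ j) * f x)"
  unfolding smooth_def partial_derivs_coord_mult[OF assms]
  by (intro allI differentiable_add differentiable_coord_mult smooth_differentiable
      smooth_sum_list smooth_partial_derivs assms)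

subsection \<open>Symmetry of mixed derivatives\<close>

text \<open>The mean value inequality along the direction \<open>i\<close> shows that the second difference of \<open>f\<close>,
  which is symmetric in \<open>i\<close> and \<open>j\<close>, is approximated to second order by one of the two mixed
  derivatives. Exchanging \<open>i\<close> and \<open>j\<close> then identifies them.\<close>

lemma second_difference_bound:
  fixes f :: "real ^ 'd::finite \<Rightarrow> complex"
  assumes f: "\<And>x. f differentiable (at x)" and fi: "partial_deriv i f differentiable (at x)"
    and "e > 0"
  shows "\<exists>\<delta>>0. \<forall>h. 0 < h \<and> h < \<delta> \<longrightarrow>
    cmod (f (x + h *\<^sub>R axis i 1 + h *\<^sub>R axis j 1) - f (x + h *\<^sub>R axis i 1) - f (x + h *\<^sub>R axis j 1) + f x
      - of_real (h\<^sup>2) * partial_deriv j (partial_deriv i f) x) \<le> e * h\<^sup>2"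
proof -
  define L where "L = frechet_derivative (partial_deriv i f) (at x)"
  have "(partial_deriv i f has_derivative L) (at x)"
    unfolding L_def using fi frechet_derivative_works by blast
  then have lin: "linear L" and
    "\<forall>e>0. \<exists>d>0. \<forall>y. norm (y - x) < d \<longrightarrow>
       norm (partial_deriv i f y - partial_deriv i f x - L (y - x)) \<le> e * norm (y - x)"
    using has_derivative_at_alt has_derivative_linear by blast+
  moreover have "e / 3 > 0" using \<open>e > 0\<close> by simp
  ultimately obtain d where d: "d > 0"
    "\<And>y. norm (y - x) < d \<Longrightarrow>
       norm (partial_deriv i f y - partial_deriv i f x - L (y - x)) \<le> e / 3 * norm (y - x)"
    by blast
  show ?thesis
  proof (intro exI[of _ "d / 2"] conjI allI impI)
    show "d / 2 > 0" using d by simp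
  next
    fix h assume h: "0 < h \<and> h < d / 2"
    let ?a = "axis i 1 :: real ^ 'd" and ?b = "axis j 1 :: real ^ 'd"
    define F where "F = (\<lambda>s. f (x + s *\<^sub>R ?a + h *\<^sub>R ?b) - f (x + s *\<^sub>R ?a) - of_real (s * h) * L ?b)"
    define F' where "F' = (\<lambda>s. partial_deriv i f (x + s *\<^sub>R ?a + h *\<^sub>R ?b) - partial_deriv i f (x + s *\<^sub>R ?a)
        - of_real h * L ?b)"
    have line: "((\<lambda>s. f (z + s *\<^sub>R ?a)) has_vector_derivative partial_deriv i f (z + s *\<^sub>R ?a)) (at s within T)" for z s T
    proof -
      have "((\<lambda>s. f (z + s *\<^sub>R ?a)) has_derivative (\<lambda>u. frechet_derivative f (at (z + s *\<^sub>R ?a)) (u *\<^sub>R ?a))) (at s within T)"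
        by (rule has_derivative_compose[where g = f, OF _ frechet_derivative_works[THEN iffD1, OF f]])
          (auto intro!: derivative_eq_intros)
      moreover have "frechet_derivative f (at (z + s *\<^sub>R ?a)) (u *\<^sub>R ?a) = u *\<^sub>R partial_deriv i f (z + s *\<^sub>R ?a)" for u
        unfolding partial_deriv_def
        using linear_frechet_derivative[OF f] by (simp add: linear_scale)
      ultimately show ?thesis unfolding has_vector_derivative_def by simp
    qed
    have "(F has_derivative (\<lambda>u. u *\<^sub>R F' s)) (at s within {0..h})" for s
    proof -
      have "(F has_vector_derivative F' s) (at s within {0..h})"
        unfolding F_def F'_def
        using line[of "x + h *\<^sub>R ?b" s "{0..h}"] line[of x s "{0..h}"]
        by (auto intro!: derivative_eq_intros simp: algebra_simps)
      then show ?thesis unfolding has_vector_derivative_def .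
    qed
    moreover have "norm (F' s) \<le> e * h" if s: "s \<in> {0..h}" for s
    proof -
      have n1: "norm (x + s *\<^sub>R ?a + h *\<^sub>R ?b - x) \<le> 2 * h"
        using norm_triangle_ineq[of "s *\<^sub>R ?a" "h *\<^sub>R ?b"] s h by simp
      have n2: "norm (x + s *\<^sub>R ?a - x) \<le> h" using s by simp
      have e: "F' s = (partial_deriv i f (x + s *\<^sub>R ?a + h *\<^sub>R ?b) - partial_deriv i f x - L (x + s *\<^sub>R ?a + h *\<^sub>R ?b - x))
          - (partial_deriv i f (x + s *\<^sub>R ?a) - partial_deriv i f x - L (x + s *\<^sub>R ?a - x))"
        unfolding F'_def using lin by (simp add: linear_add linear_scale scaleR_conv_of_real[of _ "L _"])
      have "norm (F' s) \<le> e / 3 * norm (x + s *\<^sub>R ?a + h *\<^sub>R ?b - x) + e / 3 * norm (x + s *\<^sub>R ?a - x)"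
        unfolding e using n1 n2 h by (intro order_trans[OF norm_triangle_ineq4 add_mono] d(2)) auto
      also have "\<dots> \<le> e / 3 * (2 * h) + e / 3 * h"
        using n1 n2 \<open>e > 0\<close> by (intro add_mono mult_left_mono) auto
      finally show ?thesis by simp
    qed
    then have "onorm (\<lambda>u. u *\<^sub>R F' s) \<le> e * h" if "s \<in> {0..h}" for s
      using that by (simp add: onorm_scaleR_left_lemma[of "\<lambda>u. u"] onorm_scaleR_left[of "\<lambda>u::real. u"] onorm_id)
    ultimately have "norm (F h - F 0) \<le> e * h * norm (h - 0)"
      using h by (intro differentiable_bound[of "{0..h}" F "\<lambda>s u. u *\<^sub>R F' s"]) auto
    moreover have "F h - F 0 = f (x + h *\<^sub>R ?a + h *\<^sub>R ?b) - f (x + h *\<^sub>R ?a) - f (x + h *\<^sub>R ?b) + f x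
      - of_real (h\<^sup>2) * partial_deriv j (partial_deriv i f) x"
      unfolding F_def partial_deriv_def[of j] L_def by (simp add: power2_eq_square algebra_simps)
    ultimately show "cmod (f (x + h *\<^sub>R ?a + h *\<^sub>R ?b) - f (x + h *\<^sub>R ?a) - f (x + h *\<^sub>R ?b) + f x
      - of_real (h\<^sup>2) * partial_deriv j (partial_deriv i f) x) \<le> e * h\<^sup>2"
      using h by (simp add: power2_eq_square)
  qed
qed

lemma partial_deriv_commute:
  fixes f :: "real ^ 'd::finite \<Rightarrow> complex"
  assumes "smooth f"
  shows "partial_deriv i (partial_deriv j f) = partial_deriv j (partial_deriv i f)"
proof
  fix x
  let ?u = "partial_deriv i (partial_deriv j f) x" and ?v = "partial_deriv j (partial_deriv i f) x"
  have "norm (?u - ?v) \<le> e" if e: "e > 0" for e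
  proof -
    let ?D = "\<lambda>h. f (x + h *\<^sub>R axis i 1 + h *\<^sub>R axis j 1) - f (x + h *\<^sub>R axis i 1) - f (x + h *\<^sub>R axis j 1) + f x"
    have df: "\<And>x. f differentiable (at x)" "\<And>k. partial_deriv k f differentiable (at x)"
      using assms smooth_differentiable smooth_partial_deriv by blast+
    obtain \<delta> where \<delta>: "\<delta> > 0" "\<And>h. 0 < h \<and> h < \<delta> \<Longrightarrow> cmod (?D h - of_real (h\<^sup>2) * ?v) \<le> e / 2 * h\<^sup>2"
      using second_difference_bound[OF df, of "e / 2" i j] e half_gt_zero by blast
    obtain \<epsilon> where \<epsilon>: "\<epsilon> > 0" "\<And>h. 0 < h \<and> h < \<epsilon> \<Longrightarrow>
      cmod (f (x + h *\<^sub>R axis j 1 + h *\<^sub>R axis i 1) - f (x + h *\<^sub>R axis j 1) - f (x + h *\<^sub>R axis i 1) + f x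
       - of_real (h\<^sup>2) * ?u) \<le> e / 2 * h\<^sup>2"
      using second_difference_bound[OF df, of "e / 2" j i] e half_gt_zero by blast
    define h where "h = min \<delta> \<epsilon> / 2"
    have h: "0 < h" "h < \<delta>" "h < \<epsilon>" unfolding h_def using \<delta> \<epsilon> by auto
    have "cmod (?D h - of_real (h\<^sup>2) * ?u) \<le> e / 2 * h\<^sup>2"
      using \<epsilon>(2)[of h] h by (simp add: algebra_simps)
    then have "cmod ((?D h - of_real (h\<^sup>2) * ?v) - (?D h - of_real (h\<^sup>2) * ?u)) \<le> e / 2 * h\<^sup>2 + e / 2 * h\<^sup>2"
      using \<delta>(2)[of h] h by (intro order_trans[OF norm_triangle_ineq4 add_mono]) simp_all
    moreover have "(?D h - of_real (h\<^sup>2) * ?v) - (?D h - of_real (h\<^sup>2) * ?u) = of_real (h\<^sup>2) * (?u - ?v)"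
      by (simp add: algebra_simps)
    ultimately have "h\<^sup>2 * norm (?u - ?v) \<le> h\<^sup>2 * e"
      by (simp add: norm_mult norm_power mult.commute)
    then show ?thesis using h by simp
  qed
  then have "norm (?u - ?v) \<le> 0" by (rule field_le_epsilon[where y = 0, simplified]) 
  then show "?u = ?v" by simp
qed

lemma partial_derivs_move:
  assumes "smooth f"
  shows "partial_derivs (a # xs @ ys) f = partial_derivs (xs @ a # ys) f"
proof (induction xs)
  case (Cons x xs)
  then show ?case
    using partial_deriv_commute[OF smooth_partial_derivs[OF assms, of "xs @ ys"], of a x] by simp
qed simp

lemma partial_derivs_permute:
  assumes "smooth f" "mset js = mset ks"
  shows "partial_derivs js f = partial_derivs ks f"
  using assms(2)
proof (induction js arbitrary: ks)
  case (Cons a js)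
  then have "a \<in> set ks" by (metis list.set_intros(1) set_mset_mset)
  then obtain xs ys where ks: "ks = xs @ a # ys" by (meson split_list)
  then have "partial_derivs js f = partial_derivs (xs @ ys) f" using Cons.prems by (intro Cons.IH) simp
  then show ?case unfolding ks using partial_derivs_move[OF assms(1), of a xs ys] by simp
qed simp

lemma ex_list_count: "\<exists>js. \<forall>j. count_list js j = \<beta> j"
  for \<beta> :: "'d::finite \<Rightarrow> nat"
proof -
  obtain js where js: "mset js = (\<Sum>j\<in>UNIV. replicate_mset (\<beta> j) j)" using ex_mset by blast
  have "count_list js j = \<beta> j" for j
    by (simp add: count_mset[symmetric] js count_sum)
  then show ?thesis by blast
qed

lemma mi_partial_obtains_list:
  obtains js where "count_list js = \<beta>" "length js = mi_abs \<beta>" "mi_partial \<beta> f = partial_derivs js f"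
proof -
  define js where "js = (SOME js. \<forall>j. count_list js j = \<beta> j)"
  have js: "count_list js = \<beta>"
    using someI_ex[OF ex_list_count[of \<beta>]] unfolding js_def by auto
  moreover have "length js = mi_abs \<beta>"
    unfolding mi_abs_def js[symmetric] by (simp add: sum_count_set)
  ultimately show ?thesis using that unfolding mi_partial_def js_def by blast
qed

text \<open>The Gelfand--Shilov norms refer to one chosen order of differentiation; by symmetry their bounds
  hold for differentiations in any order.\<close>

lemma mi_partial_count_list:
  assumes "smooth f"
  shows "mi_partial (count_list js) f = partial_derivs js f"
proof -
  obtain ks where ks: "count_list ks = count_list js" "mi_partial (count_list js) f = partial_derivs ks f"
    by (rule mi_partial_obtains_list)
  have "mset ks = mset js"
    by (rule multiset_eqI) (simp add: count_mset ks)
  then show ?thesis using ks partial_derivs_permute[OF assms] by metis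
qed

section \<open>The growth function \<open>X\<^sup>X\<close>\<close>

text \<open>A single weight replaces the product \<open>\<alpha>!\<^sup>\<theta> \<beta>!\<^sup>s\<close>: up to geometric factors that product is
  \<open>X\<^sup>X\<close> with \<open>X = \<theta>\<bar>\<alpha>\<bar> + s\<bar>\<beta>\<bar>\<close>, and only \<open>X\<close> matters when a power of \<open>x\<close> is traded for derivatives.\<close>

definition growth :: "real \<Rightarrow> real" where
  "growth X = X powr X"

lemma growth_pos: "X \<ge> 1 \<Longrightarrow> growth X > 0"
  unfolding growth_def by simp

lemma growth_mono: "1 \<le> X \<Longrightarrow> X \<le> Y \<Longrightarrow> growth X \<le> growth Y"
  unfolding growth_def by (rule order_trans[OF powr_mono powr_mono2]) auto

lemma growth_add:
  assumes "1 \<le> X" "0 \<le> c"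
  shows "X powr c * growth X \<le> growth (X + c)"
proof -
  have "X powr c * growth X = X powr (X + c)"
    unfolding growth_def by (simp add: powr_add mult.commute)
  also have "\<dots> \<le> (X + c) powr (X + c)" using assms by (intro powr_mono2) auto
  finally show ?thesis unfolding growth_def .
qed

text \<open>Lowering \<open>X\<close> by \<open>s\<close> and then allowing \<open>X + c\<close> leaves room for a factor \<open>X\<^bsup>c+s\<^esup>\<close>. This pays for
  the number of terms that commuting derivatives with a coordinate produces.\<close>

lemma growth_diff_add:
  assumes "0 < s" "1 \<le> X - s" "0 \<le> c"
  shows "X powr (c + s) * growth (X - s) \<le> growth (X + c)"
proof -
  have "X powr (c + s) * growth (X - s) \<le> X powr (c + s) * X powr (X - s)"
    unfolding growth_def using assms by (intro mult_left_mono powr_mono2) auto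
  also have "\<dots> = X powr (X + c)" by (simp add: powr_add[symmetric] add.commute)
  also have "\<dots> \<le> (X + c) powr (X + c)" using assms by (intro powr_mono2) auto
  finally show ?thesis unfolding growth_def .
qed

text \<open>From \<open>(1 + W/Y)\<^sup>Y \<le> e\<^sup>W\<close>: enlarging the base additively costs only an exponential factor.\<close>

lemma powr_add_le_exp:
  fixes Y W :: real
  assumes "Y > 0" "W \<ge> 0"
  shows "(Y + W) powr Y \<le> exp W * Y powr Y"
proof -
  have "Y + W = Y * (1 + W / Y)" using assms by (simp add: field_simps)
  also have "\<dots> \<le> Y * exp (W / Y)" using assms by (intro mult_left_mono exp_ge_add_one_self) auto
  finally have "(Y + W) powr Y \<le> (Y * exp (W / Y)) powr Y" using assms by (intro powr_mono2) auto
  also have "\<dots> = exp W * Y powr Y"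
    using assms by (simp add: powr_mult powr_def[of "exp _"])
  finally show ?thesis .
qed

lemma power_le_exp_fact: "x ^ n \<le> exp x * fact n" if "x \<ge> 0" for x :: real
proof -
  have "x ^ n /\<^sub>R fact n \<le> exp x"
    unfolding exp_def
    using sum_le_suminf[OF summable_exp_generic[of x], of "{n}"] that by simp
  then show ?thesis by (simp add: field_simps)
qed

lemma powr_multiple_le_fact:
  fixes X W c :: real
  assumes "c > 0" "X = c * real a + W" "W \<ge> 0"
  shows "X powr (c * real a) \<le> exp W * (c powr c * exp c) ^ a * fact a powr c"
proof (cases "a = 0")
  case True
  have "X powr 0 \<le> 1" by simp
  also have "1 \<le> exp W" using assms by simp
  finally show ?thesis using True by simp
next
  case False
  let ?Y = "c * real a"
  have Y: "?Y > 0" using False assms by simp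
  have "exp (real a) powr c = exp c ^ a"
    using exp_of_nat_mult[of a c] by (simp add: powr_def mult.commute)
  moreover have "(real a ^ a) powr c \<le> (exp (real a) * fact a) powr c"
    using assms power_le_exp_fact[of "real a" a] by (intro powr_mono2) auto
  ultimately have le: "(real a ^ a) powr c \<le> exp c ^ a * fact a powr c"
    by (simp add: powr_mult)
  have "(c powr c) ^ a = c powr ?Y"
    using assms powr_realpow[of "c powr c" a] by (simp add: powr_powr)
  moreover have "(real a ^ a) powr c = real a powr ?Y"
    using False powr_realpow[of "real a" a] powr_powr[of "real a" "real a" c] by (simp add: mult.commute)
  ultimately have eq: "?Y powr ?Y = (c powr c) ^ a * (real a ^ a) powr c"
    using assms by (simp add: powr_mult)
  have "X powr ?Y \<le> exp W * ?Y powr ?Y" unfolding assms(2) by (rule powr_add_le_exp[OF Y assms(3)])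
  also have "\<dots> \<le> exp W * ((c powr c) ^ a * (exp c ^ a * fact a powr c))"
    unfolding eq using le by (intro mult_left_mono) auto
  finally show ?thesis by (simp only: power_mult_distrib mult.assoc)
qed

text \<open>The geometric rate \<open>c\<close> does not depend on the shift \<open>K\<close>, which only enters the constant. The
  Beurling case needs this, because there \<open>K\<close> has to be large depending on the desired rate.\<close>

lemma growth_le_fact:
  assumes "\<theta> > 0" "s > 0"
  obtains c where "c \<ge> 1" and "\<And>K. K \<ge> 1 \<Longrightarrow>
    \<exists>C>0. \<forall>a b. growth (K + \<theta> * real a + s * real b) \<le> C * c ^ (a + b) * fact a powr \<theta> * fact b powr s"
proof -
  define c where "c = max 1 (max (exp (2 * \<theta>) * (\<theta> powr \<theta> * exp \<theta>)) (exp (2 * s) * (s powr s * exp s)))"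
  have c: "c \<ge> 1" "exp (2 * \<theta>) * (\<theta> powr \<theta> * exp \<theta>) \<le> c" "exp (2 * s) * (s powr s * exp s) \<le> c"
    unfolding c_def by auto
  have "growth (K + \<theta> * real a + s * real b)
      \<le> (K powr K * exp (2 * K)) * c ^ (a + b) * fact a powr \<theta> * fact b powr s"
    if K: "K \<ge> 1" for K a b
  proof -
    let ?Y = "\<theta> * real a" and ?Z = "s * real b"
    define X where "X = K + ?Y + ?Z"
    have YZ: "?Y \<ge> 0" "?Z \<ge> 0" using assms by auto
    have "growth X = X powr K * X powr ?Y * X powr ?Z"
      unfolding growth_def X_def[symmetric] by (subst (2) X_def) (simp add: powr_add)
    also have "\<dots> \<le> (exp (?Y + ?Z) * K powr K) * (exp (K + ?Z) * (\<theta> powr \<theta> * exp \<theta>) ^ a * fact a powr \<theta>)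
       * (exp (K + ?Y) * (s powr s * exp s) ^ b * fact b powr s)"
    proof (intro mult_mono)
      show "X powr K \<le> exp (?Y + ?Z) * K powr K"
        using powr_add_le_exp[of K "?Y + ?Z"] YZ K by (simp add: X_def add.assoc)
      show "X powr ?Y \<le> exp (K + ?Z) * (\<theta> powr \<theta> * exp \<theta>) ^ a * fact a powr \<theta>"
        using YZ K assms by (intro powr_multiple_le_fact) (auto simp: X_def)
      show "X powr ?Z \<le> exp (K + ?Y) * (s powr s * exp s) ^ b * fact b powr s"
        using YZ K assms by (intro powr_multiple_le_fact) (auto simp: X_def)
    qed auto
    also have "\<dots> = (K powr K * exp (2 * K)) * (exp (2 * \<theta>) * (\<theta> powr \<theta> * exp \<theta>)) ^ a
       * (exp (2 * s) * (s powr s * exp s)) ^ b * fact a powr \<theta> * fact b powr s"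
    proof -
      have "exp (?Y + ?Z) * exp (K + ?Z) * exp (K + ?Y) = exp (2 * K) * exp (2 * \<theta>) ^ a * exp (2 * s) ^ b"
        unfolding exp_of_nat_mult[symmetric] exp_add[symmetric] by (simp add: algebra_simps)
      then show ?thesis unfolding power_mult_distrib by (simp only: mult_ac)
    qed
    also have "\<dots> \<le> (K powr K * exp (2 * K)) * c ^ a * c ^ b * fact a powr \<theta> * fact b powr s"
      using c by (intro mult_right_mono mult_mono power_mono) auto
    finally show ?thesis unfolding X_def by (simp add: power_add mult_ac)
  qed
  then have "\<exists>C>0. \<forall>a b. growth (K + \<theta> * real a + s * real b) \<le> C * c ^ (a + b) * fact a powr \<theta> * fact b powr s"
    if "K \<ge> 1" for K
    using that by (intro exI[of _ "K powr K * exp (2 * K)"] conjI allI) simp_all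
  from that[OF c(1) this] show ?thesis .
qed

lemma fact_powr_le:
  fixes X c :: real
  assumes "c > 0" "c * real a \<le> X" "X \<ge> 1"
  shows "fact a powr c \<le> (c powr (- c)) ^ a * X powr (c * real a)"
proof (cases "a = 0")
  case False
  have "(fact a :: real) \<le> real a ^ a" using fact_le_power[of a] by simp
  then have "(fact a :: real) powr c \<le> (real a ^ a) powr c"
    using assms by (intro powr_mono2) auto
  also have "\<dots> = (c powr (- c)) ^ a * (c * real a) powr (c * real a)"
  proof -
    have "(real a ^ a) powr c = real a powr (c * real a)"
      using False powr_realpow[of "real a" a] powr_powr[of "real a" "real a" c] by (simp add: mult.commute)
    moreover have "(c powr (- c)) ^ a = c powr (- (c * real a))"
      using assms powr_realpow[of "c powr (- c)" a] by (simp add: powr_powr)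
    moreover have "c powr (- (c * real a)) * c powr (c * real a) = 1"
      using assms by (simp add: powr_add[symmetric])
    ultimately show ?thesis using assms by (simp add: powr_mult)
  qed
  also have "\<dots> \<le> (c powr (- c)) ^ a * X powr (c * real a)"
    using assms by (intro mult_left_mono powr_mono2) auto
  finally show ?thesis .
qed (use assms in auto)

lemma fact_le_growth:
  assumes "\<theta> > 0" "s > 0"
  obtains c where "c \<ge> 1" and "\<And>K a b. K \<ge> 1 \<Longrightarrow>
    fact a powr \<theta> * fact b powr s \<le> c ^ (a + b) * growth (K + \<theta> * real a + s * real b)"
proof -
  define c where "c = max 1 (max (\<theta> powr (- \<theta>)) (s powr (- s)))"
  have c: "c \<ge> 1" "\<theta> powr (- \<theta>) \<le> c" "s powr (- s) \<le> c" unfolding c_def by auto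
  have "fact a powr \<theta> * fact b powr s \<le> c ^ (a + b) * growth (K + \<theta> * real a + s * real b)"
    if K: "K \<ge> 1" for K a b
  proof -
    define X where "X = K + \<theta> * real a + s * real b"
    have YZ: "\<theta> * real a \<ge> 0" "s * real b \<ge> 0" using assms by auto
    then have "X \<ge> 1" using K unfolding X_def by linarith
    have "fact a powr \<theta> * fact b powr s
      \<le> ((\<theta> powr (- \<theta>)) ^ a * X powr (\<theta> * real a)) * ((s powr (- s)) ^ b * X powr (s * real b))"
      using assms YZ K \<open>X \<ge> 1\<close> by (intro mult_mono fact_powr_le) (auto simp: X_def)
    also have "\<dots> \<le> (c ^ a * X powr (\<theta> * real a)) * (c ^ b * X powr (s * real b))"
      using c by (intro mult_mono mult_right_mono power_mono) auto
    also have "\<dots> = c ^ (a + b) * X powr (\<theta> * real a + s * real b)"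
      by (simp add: power_add powr_add mult_ac)
    also have "\<dots> \<le> c ^ (a + b) * X powr X"
      using c K YZ by (intro mult_left_mono powr_mono) (auto simp: X_def)
    finally show ?thesis unfolding X_def growth_def .
  qed
  from that[OF c(1) this] show ?thesis .
qed

subsection \<open>Factorials of multi-indices\<close>

lemma fact_add_eq_binomial: "fact (k + n) = real ((k + n) choose k) * (fact k * fact n)"
  using binomial_fact[of k "k + n", where 'a = real] by simp

text \<open>Adding one index at a time costs a binomial coefficient, hence a power of two.\<close>

lemma fact_sum_le_prod_fact:
  fixes \<alpha> :: "'a \<Rightarrow> nat"
  assumes "finite A"
  shows "fact (\<Sum>j\<in>A. \<alpha> j) \<le> (2 ^ card A) ^ (\<Sum>j\<in>A. \<alpha> j) * (\<Prod>j\<in>A. fact (\<alpha> j) :: real)"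
  using assms
proof (induction A)
  case (insert a A)
  let ?n = "\<Sum>j\<in>A. \<alpha> j" and ?p = "\<Prod>j\<in>A. fact (\<alpha> j) :: real"
  have "fact (\<alpha> a + ?n) = real ((\<alpha> a + ?n) choose \<alpha> a) * (fact (\<alpha> a) * fact ?n)"
    by (rule fact_add_eq_binomial)
  also have "\<dots> \<le> 2 ^ (\<alpha> a + ?n) * (fact (\<alpha> a) * ((2 ^ card A) ^ ?n * ?p))"
  proof (intro mult_mono)
    show "real ((\<alpha> a + ?n) choose \<alpha> a) \<le> 2 ^ (\<alpha> a + ?n)"
      using of_nat_mono[OF binomial_le_pow2[of "\<alpha> a + ?n" "\<alpha> a"], where 'a = real] by simp
  qed (use insert.IH in auto)
  also have "\<dots> \<le> 2 ^ (\<alpha> a + ?n) * (fact (\<alpha> a) * ((2 ^ card A) ^ (\<alpha> a + ?n) * ?p))"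
    by (intro mult_left_mono mult_right_mono power_increasing) (auto intro: prod_nonneg)
  finally show ?case using insert.hyps by (simp add: power_mult_distrib mult_ac)
qed simp

lemma fact_mi_abs_le: "fact (mi_abs \<alpha>) \<le> (2 ^ CARD('d)) ^ mi_abs \<alpha> * mi_fact \<alpha>"
  for \<alpha> :: "'d::finite \<Rightarrow> nat"
  unfolding mi_abs_def mi_fact_def using fact_sum_le_prod_fact[of UNIV \<alpha>] by simp

lemma mi_fact_le: "mi_fact \<alpha> \<le> fact (mi_abs \<alpha>)"
proof -
  have "(\<Prod>j\<in>A. fact (\<alpha> j) :: real) \<le> fact (\<Sum>j\<in>A. \<alpha> j)" if "finite A" for A
    using that
  proof (induction A)
    case (insert a A)
    have "fact (\<alpha> a) * (\<Prod>j\<in>A. fact (\<alpha> j) :: real) \<le> fact (\<alpha> a) * fact (\<Sum>j\<in>A. \<alpha> j)"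
      using insert.IH by (intro mult_left_mono) auto
    also have "\<dots> \<le> fact (\<alpha> a + (\<Sum>j\<in>A. \<alpha> j))"
      unfolding fact_add_eq_binomial[of "\<alpha> a"]
      using mult_right_mono[of 1 "real ((\<alpha> a + (\<Sum>j\<in>A. \<alpha> j)) choose \<alpha> a)" "fact (\<alpha> a) * fact (\<Sum>j\<in>A. \<alpha> j)"]
      by (simp add: Suc_le_eq)
    finally show ?case using insert.hyps by simp
  qed simp
  then show ?thesis unfolding mi_fact_def mi_abs_def by simp
qed

lemma mi_fact_ge_1: "mi_fact \<alpha> \<ge> 1"
  unfolding mi_fact_def by (rule prod_ge_1) simp

section \<open>Rapidly decreasing functions\<close>

lemma integrable_inverse_1_plus_square_line: "integrable lborel (\<lambda>y::real. 1 / (1 + y\<^sup>2))"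
  using integrable_inverse_1_plus_square by (simp add: set_integrable_def inverse_eq_divide)

text \<open>The square of \<open>1 + \<bar>x\<bar>\<close> dominates \<open>1 + x\<^sub>b\<^sup>2\<close> for each of the \<open>d\<close> coordinates, so the exponent \<open>2d\<close> makes
  the weight smaller than a product of integrable functions of one variable.\<close>

lemma integrable_weight:
  "integrable lborel (\<lambda>x :: real ^ 'd::finite. 1 / (1 + norm x) ^ (2 * CARD('d)))"
proof -
  let ?w = "\<lambda>x :: real ^ 'd. 1 / (1 + norm x) ^ (2 * CARD('d))"
  let ?P = "\<lambda>x :: real ^ 'd. \<Prod>b\<in>Basis. 1 / (1 + (x \<bullet> b)\<^sup>2)"
  have le: "?w x \<le> ?P x" for x :: "real ^ 'd"
  proof -
    have "(\<Prod>b\<in>Basis. 1 + (x \<bullet> b)\<^sup>2) \<le> (\<Prod>b\<in>(Basis :: (real ^ 'd) set). (1 + norm x)\<^sup>2)"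
    proof (intro prod_mono conjI)
      fix b :: "real ^ 'd" assume "b \<in> Basis"
      then have "\<bar>x \<bullet> b\<bar> \<le> norm x" by (rule Basis_le_norm)
      then have "(x \<bullet> b)\<^sup>2 \<le> (norm x)\<^sup>2" by (metis abs_le_square_iff abs_norm_cancel)
      then show "1 + (x \<bullet> b)\<^sup>2 \<le> (1 + norm x)\<^sup>2"
        by (simp add: power2_sum) (use norm_ge_zero[of x] in linarith)
    qed auto
    also have "\<dots> = (1 + norm x) ^ (2 * CARD('d))"
      by (simp add: power_mult[symmetric])
    finally show ?thesis
      by (simp add: prod_dividef prod_pos add_pos_nonneg frac_le)
  qed
  have "(\<integral>\<^sup>+x. ennreal (?w x) \<partial>lborel) \<le> (\<integral>\<^sup>+(x :: real ^ 'd). (\<Prod>b\<in>Basis. ennreal (1 / (1 + (x \<bullet> b)\<^sup>2))) \<partial>lborel)"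
    by (intro nn_integral_mono) (simp add: prod_ennreal ennreal_leI le)
  also have "\<dots> = (\<Prod>b\<in>(Basis :: (real ^ 'd) set). \<integral>\<^sup>+y. ennreal (1 / (1 + y\<^sup>2)) \<partial>lborel)"
    by (rule nn_integral_lborel_prod) auto
  also have "\<dots> < \<infinity>"
  proof -
    have "(\<integral>\<^sup>+y. ennreal (1 / (1 + y\<^sup>2)) \<partial>lborel) < \<infinity>"
      using integrable_inverse_1_plus_square_line by (simp add: nn_integral_eq_integral)
    then show ?thesis by (simp add: power_less_top_ennreal)
  qed
  finally show ?thesis
    by (intro integrableI_nonneg) auto
qed

definition weight_integral :: "'d::finite itself \<Rightarrow> real" where
  "weight_integral _ = (LINT x :: real ^ 'd|lborel. 1 / (1 + norm x) ^ (2 * CARD('d)))"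

lemma weight_integral_nonneg: "weight_integral TYPE('d::finite) \<ge> 0"
  unfolding weight_integral_def by (rule Bochner_Integration.integral_nonneg) simp

lemma weighted_bound_integral:
  fixes f :: "real ^ 'd::finite \<Rightarrow> complex"
  assumes "continuous_on UNIV f" and B: "\<And>x. (1 + norm x) ^ (2 * CARD('d)) * cmod (f x) \<le> B"
  shows "integrable lborel f"
    and "(LINT x|lborel. cmod (f x)) \<le> B * weight_integral TYPE('d)"
proof -
  let ?w = "\<lambda>x :: real ^ 'd. 1 / (1 + norm x) ^ (2 * CARD('d))"
  have le: "cmod (f x) \<le> B * ?w x" for x
    using B[of x] by (simp add: field_simps add_pos_nonneg)
  have i: "integrable lborel (\<lambda>x. B * ?w x)" using integrable_mult_right[OF integrable_weight[where 'd = 'd]] .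
  then show f: "integrable lborel f"
    by (rule Bochner_Integration.integrable_bound)
      (use assms(1) in \<open>auto intro!: borel_measurable_continuous_onI AE_I2 order_trans[OF le] divide_right_mono\<close>)
  have "(LINT x|lborel. cmod (f x)) \<le> (LINT x|lborel. B * ?w x)"
    using f i le by (intro integral_mono) auto
  also have "\<dots> = B * weight_integral TYPE('d)"
    unfolding weight_integral_def by (rule integral_mult_right_zero)
  finally show "(LINT x|lborel. cmod (f x)) \<le> B * weight_integral TYPE('d)" .
qed

definition rapid :: "(real ^ 'd::finite \<Rightarrow> complex) \<Rightarrow> bool" where
  "rapid f \<longleftrightarrow> continuous_on UNIV f \<and> (\<forall>n. \<exists>B. \<forall>x. (1 + norm x) ^ n * cmod (f x) \<le> B)"

lemma rapid_continuous: "rapid f \<Longrightarrow> continuous_on UNIV f"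
  unfolding rapid_def by blast

lemma rapid_bound:
  assumes "rapid f" obtains B where "\<And>x. (1 + norm x) ^ n * cmod (f x) \<le> B"
  using assms unfolding rapid_def by blast

lemma rapid_integrable: "rapid f \<Longrightarrow> integrable lborel f"
  unfolding rapid_def using weighted_bound_integral(1) by blast

lemma rapid_add:
  assumes "rapid f" "rapid g"
  shows "rapid (\<lambda>x. f x + g x)"
  unfolding rapid_def
proof (intro conjI allI)
  show "continuous_on UNIV (\<lambda>x. f x + g x)"
    using assms by (intro continuous_intros rapid_continuous)
  fix n
  obtain A where A: "\<And>x. (1 + norm x) ^ n * cmod (f x) \<le> A" using rapid_bound[OF assms(1)] by blast
  obtain B where B: "\<And>x. (1 + norm x) ^ n * cmod (g x) \<le> B" using rapid_bound[OF assms(2)] by blast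
  have "(1 + norm x) ^ n * cmod (f x + g x) \<le> A + B" for x
  proof -
    have "(1 + norm x) ^ n * cmod (f x + g x) \<le> (1 + norm x) ^ n * (cmod (f x) + cmod (g x))"
      by (intro mult_left_mono norm_triangle_ineq) simp
    then show ?thesis using A[of x] B[of x] by (simp add: distrib_left)
  qed
  then show "\<exists>B. \<forall>x. (1 + norm x) ^ n * cmod (f x + g x) \<le> B" by blast
qed

lemma rapid_temperate_mult:
  assumes "rapid f" "continuous_on UNIV q" "\<And>x. cmod (q x) \<le> C * (1 + norm x) ^ k"
  shows "rapid (\<lambda>x. q x * f x)"
  unfolding rapid_def
proof (intro conjI allI)
  show "continuous_on UNIV (\<lambda>x. q x * f x)"
    by (intro continuous_on_mult assms(2) rapid_continuous assms(1))
  fix n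
  obtain B where B: "\<And>x. (1 + norm x) ^ (n + k) * cmod (f x) \<le> B" using rapid_bound[OF assms(1)] by blast
  have C: "C \<ge> 0" using order_trans[OF norm_ge_zero assms(3)[of 0]] by simp
  have "(1 + norm x) ^ n * cmod (q x * f x) \<le> C * B" for x
  proof -
    have "(1 + norm x) ^ n * cmod (q x * f x) \<le> (1 + norm x) ^ n * ((C * (1 + norm x) ^ k) * cmod (f x))"
      unfolding norm_mult by (intro mult_left_mono mult_right_mono assms(3)) auto
    also have "\<dots> = C * ((1 + norm x) ^ (n + k) * cmod (f x))" by (simp add: power_add mult_ac)
    also have "\<dots> \<le> C * B" by (intro mult_left_mono B C)
    finally show ?thesis .
  qed
  then show "\<exists>B. \<forall>x. (1 + norm x) ^ n * cmod (q x * f x) \<le> B" by blast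
qed

lemma rapid_cmult: "rapid f \<Longrightarrow> rapid (\<lambda>x. c * f x)"
  using rapid_temperate_mult[where q = "\<lambda>_. c" and C = "cmod c" and k = 0] by simp

lemma rapid_coord_mult: "rapid f \<Longrightarrow> rapid (\<lambda>x. of_real (x $ j) * f x)"
  by (rule rapid_temperate_mult[where C = 1 and k = 1])
    (auto intro!: continuous_intros order_trans[OF component_le_norm_cart])

lemma rapid_zero: "rapid (\<lambda>x. 0)"
  unfolding rapid_def by (auto intro: exI[of _ 0])

lemma rapid_sum_list:
  "(\<And>k. k \<in> set ks \<Longrightarrow> rapid (F k)) \<Longrightarrow> rapid (\<lambda>x. \<Sum>k\<leftarrow>ks. F k x)"
  by (induction ks) (auto simp: rapid_zero intro: rapid_add)

lemma
  fixes f :: "'a::euclidean_space \<Rightarrow> complex"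
  assumes "integrable lborel f"
  shows integrable_translate: "integrable lborel (\<lambda>x. f (x + a))"
    and integral_translate: "(LINT x|lborel. f (x + a)) = (LINT x|lborel. f x)"
proof -
  have f: "f \<in> borel_measurable borel" using assms by (auto dest: borel_measurable_integrable)
  show "integrable lborel (\<lambda>x. f (x + a))"
    using assms f integrable_distr_eq[of "(+) a" lborel borel f] by (simp add: lborel_distr_plus add.commute)
  show "(LINT x|lborel. f (x + a)) = (LINT x|lborel. f x)"
    using f integral_distr[of "(+) a" lborel borel f] by (simp add: lborel_distr_plus add.commute)
qed

text \<open>The integral of a directional derivative vanishes: the difference quotients integrate to zero by
  translation invariance, and the decay of the derivative dominates them.\<close>

lemma integral_directional_derivative_eq_0:
  fixes H :: "real ^ 'd::finite \<Rightarrow> complex"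
  assumes "rapid H" "rapid H'" "norm e = 1"
    and deriv: "\<And>x. ((\<lambda>u. H (x + u *\<^sub>R e)) has_vector_derivative H' x) (at 0)"
  shows "(LINT x|lborel. H' x) = 0"
proof -
  let ?N = "2 * CARD('d)"
  obtain B where B: "\<And>x. (1 + norm x) ^ ?N * cmod (H' x) \<le> B" using rapid_bound[OF assms(2)] by blast
  define D where "D = (\<lambda>n x. (H (x + (1 / real (Suc n)) *\<^sub>R e) - H x) /\<^sub>R (1 / real (Suc n)))"
  have meas: "continuous_on UNIV H" "continuous_on UNIV H'" using assms rapid_continuous by auto
  have dline: "((\<lambda>u. H (x + u *\<^sub>R e)) has_vector_derivative H' (x + u *\<^sub>R e)) (at u within T)" for x u T
  proof -
    have "((\<lambda>v. H ((x + u *\<^sub>R e) + v *\<^sub>R e)) has_vector_derivative H' (x + u *\<^sub>R e)) (at (u - u))"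
      using deriv[of "x + u *\<^sub>R e"] by simp
    then have "((\<lambda>v. H ((x + u *\<^sub>R e) + v *\<^sub>R e)) \<circ> (\<lambda>w. w - u) has_vector_derivative 1 *\<^sub>R H' (x + u *\<^sub>R e)) (at u)"
      by (intro vector_diff_chain_at) (auto intro!: derivative_eq_intros)
    then have "((\<lambda>u. H (x + u *\<^sub>R e)) has_vector_derivative H' (x + u *\<^sub>R e)) (at u)"
      by (simp add: o_def algebra_simps)
    then show ?thesis by (rule has_vector_derivative_at_within)
  qed
  have near: "cmod (H' (x + u *\<^sub>R e)) \<le> 2 ^ ?N * B * (1 / (1 + norm x) ^ ?N)" if "\<bar>u\<bar> \<le> 1" for x u
  proof -
    have "norm x \<le> norm (x + u *\<^sub>R e) + norm (u *\<^sub>R e)"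
      using norm_triangle_ineq4[of "x + u *\<^sub>R e" "u *\<^sub>R e"] by simp
    moreover have "norm (u *\<^sub>R e) \<le> 1" using that assms(3) by simp
    moreover have "1 + a \<le> 2 * (1 + n)" if "a \<le> n + b" "b \<le> 1" "0 \<le> n" for a b n :: real
      using that by (smt (verit))
    ultimately have "1 + norm x \<le> 2 * (1 + norm (x + u *\<^sub>R e))"
      using norm_ge_zero[of "x + u *\<^sub>R e"] by blast
    then have "(1 + norm x) ^ ?N \<le> (2 * (1 + norm (x + u *\<^sub>R e))) ^ ?N"
      by (intro power_mono) auto
    then have "(1 + norm x) ^ ?N * cmod (H' (x + u *\<^sub>R e))
      \<le> 2 ^ ?N * (1 + norm (x + u *\<^sub>R e)) ^ ?N * cmod (H' (x + u *\<^sub>R e))"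
      unfolding power_mult_distrib by (intro mult_right_mono) auto
    also have "\<dots> \<le> 2 ^ ?N * B"
      unfolding mult.assoc by (intro mult_left_mono B) auto
    finally show ?thesis by (simp add: field_simps add_pos_nonneg)
  qed
  have bound: "cmod (D n x) \<le> 2 ^ ?N * B * (1 / (1 + norm x) ^ ?N)" for n x
  proof -
    let ?h = "1 / real (Suc n)" and ?C = "2 ^ ?N * B * (1 / (1 + norm x) ^ ?N)"
    have "norm (H (x + ?h *\<^sub>R e) - H (x + 0 *\<^sub>R e)) \<le> ?C * norm (?h - 0)"
    proof (rule differentiable_bound[of "{0..?h}" "\<lambda>u. H (x + u *\<^sub>R e)" "\<lambda>u v. v *\<^sub>R H' (x + u *\<^sub>R e)"])
      fix u assume u: "u \<in> {0..?h}"
      show "((\<lambda>u. H (x + u *\<^sub>R e)) has_derivative (\<lambda>v. v *\<^sub>R H' (x + u *\<^sub>R e))) (at u within {0..?h})"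
        using dline[of x u "{0..?h}"] unfolding has_vector_derivative_def .
      have "?h \<le> 1" by simp
      moreover have "0 \<le> u" "u \<le> ?h" using u by auto
      ultimately have "\<bar>u\<bar> \<le> 1" by linarith
      then have "cmod (H' (x + u *\<^sub>R e)) \<le> ?C" by (rule near)
      then show "onorm (\<lambda>v. v *\<^sub>R H' (x + u *\<^sub>R e)) \<le> ?C"
        by (simp add: onorm_scaleR_left[of "\<lambda>u::real. u"] onorm_id)
    qed auto
    then have "norm (H (x + ?h *\<^sub>R e) - H x) \<le> ?C * ?h" by simp
    then have "norm (H (x + ?h *\<^sub>R e) - H x) * real (Suc n) \<le> (?C * ?h) * real (Suc n)"
      by (intro mult_right_mono) auto
    moreover have "cmod (D n x) = norm (H (x + ?h *\<^sub>R e) - H x) * real (Suc n)"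
      unfolding D_def norm_scaleR by (simp del: of_nat_Suc)
    moreover have "(?C * ?h) * real (Suc n) = ?C" by (simp del: of_nat_Suc)
    ultimately show ?thesis by linarith
  qed
  have "(\<lambda>n. LINT x|lborel. D n x) \<longlonglongrightarrow> (LINT x|lborel. H' x)"
  proof (rule integral_dominated_convergence)
    show "integrable lborel (\<lambda>x :: real ^ 'd. 2 ^ ?N * B * (1 / (1 + norm x) ^ ?N))"
      by (intro integrable_mult_right integrable_weight)
    show "AE x in lborel. (\<lambda>n. D n x) \<longlonglongrightarrow> H' x"
    proof (rule AE_I2)
      fix x
      have "((\<lambda>u. (H (x + u *\<^sub>R e) - H x) /\<^sub>R u) \<longlongrightarrow> H' x) (at 0)"
      proof -
        have "((\<lambda>u. norm ((H (x + u *\<^sub>R e) - H x - u *\<^sub>R H' x) /\<^sub>R \<bar>u\<bar>)) \<longlongrightarrow> 0) (at 0)"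
          using deriv[of x] unfolding has_vector_derivative_def has_derivative_def
          by (intro tendsto_norm_zero) simp
        moreover have "norm ((H (x + u *\<^sub>R e) - H x - u *\<^sub>R H' x) /\<^sub>R \<bar>u\<bar>)
            = norm ((H (x + u *\<^sub>R e) - H x) /\<^sub>R u - H' x)" if "u \<noteq> 0" for u
        proof -
          have "(H (x + u *\<^sub>R e) - H x) /\<^sub>R u - H' x = (H (x + u *\<^sub>R e) - H x - u *\<^sub>R H' x) /\<^sub>R u"
            using that by (simp add: scaleR_diff_right)
          then show ?thesis by simp
        qed
        ultimately have "((\<lambda>u. norm ((H (x + u *\<^sub>R e) - H x) /\<^sub>R u - H' x)) \<longlongrightarrow> 0) (at 0)"
          by (elim Lim_transform_eventually) (simp add: eventually_at_filter)
        then show ?thesis using Lim_null tendsto_norm_zero_iff by blast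
      qed
      moreover have "filterlim (\<lambda>n. 1 / real (Suc n)) (at 0) sequentially"
        using LIMSEQ_inverse_real_of_nat by (intro filterlim_atI) (auto simp: inverse_eq_divide)
      ultimately show "(\<lambda>n. D n x) \<longlonglongrightarrow> H' x"
        unfolding D_def by (rule filterlim_compose)
    qed
    show "AE x in lborel. norm (D n x) \<le> 2 ^ ?N * B * (1 / (1 + norm x) ^ ?N)" for n
      using bound by (intro AE_I2)
    have "continuous_on UNIV (D n)" for n
      unfolding D_def by (intro continuous_intros meas continuous_on_compose2[OF meas(1)]) auto
    then show "D n \<in> borel_measurable lborel" for n
      using borel_measurable_continuous_onI by auto
    show "H' \<in> borel_measurable lborel"
      using borel_measurable_continuous_onI[OF meas(2)] by simp
  qed
  moreover have "(LINT x|lborel. D n x) = 0" for n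
    unfolding D_def using integrable_translate[OF rapid_integrable[OF assms(1)]]
      integral_translate[OF rapid_integrable[OF assms(1)]] rapid_integrable[OF assms(1)]
    by simp
  ultimately show ?thesis by (simp add: LIMSEQ_const_iff)
qed

section \<open>Oscillatory integrals\<close>

text \<open>The parameter \<open>\<sigma>\<close> is \<open>-1\<close> for the Fourier transform and \<open>1\<close> for its inverse and the propagator.\<close>

definition osc :: "real \<Rightarrow> (real ^ 'd::finite \<Rightarrow> complex) \<Rightarrow> real ^ 'd \<Rightarrow> complex" where
  "osc \<sigma> \<phi> x = (LINT \<xi>|lborel. exp (\<i> * of_real (\<sigma> * (x \<bullet> \<xi>))) * \<phi> \<xi>)"

definition freq_mult :: "real \<Rightarrow> 'd::finite \<Rightarrow> (real ^ 'd \<Rightarrow> complex) \<Rightarrow> real ^ 'd \<Rightarrow> complex" where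
  "freq_mult \<sigma> j \<phi> = (\<lambda>\<xi>. \<i> * of_real (\<sigma> * \<xi> $ j) * \<phi> \<xi>)"

lemma rapid_osc_integrand: "rapid \<phi> \<Longrightarrow> rapid (\<lambda>\<xi>. exp (\<i> * of_real (\<sigma> * (x \<bullet> \<xi>))) * \<phi> \<xi>)"
  by (rule rapid_temperate_mult[where C = 1 and k = 0]) (auto intro!: continuous_intros)

lemma rapid_freq_mult: "rapid \<phi> \<Longrightarrow> rapid (freq_mult \<sigma> j \<phi>)"
  using rapid_cmult[OF rapid_coord_mult, of \<phi> "\<i> * of_real \<sigma>" j]
  unfolding freq_mult_def by (simp add: mult_ac)

lemma cmod_osc_le: "cmod (osc \<sigma> \<phi> x) \<le> (LINT \<xi>|lborel. cmod (\<phi> \<xi>))"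
proof -
  have "cmod (osc \<sigma> \<phi> x) \<le> (LINT \<xi>|lborel. cmod (exp (\<i> * of_real (\<sigma> * (x \<bullet> \<xi>))) * \<phi> \<xi>))"
    unfolding osc_def by (rule integral_norm_bound)
  then show ?thesis by (simp add: norm_mult)
qed

text \<open>The first order Taylor remainder of \<open>e\<^bsup>ia\<^esup>\<close> is at most \<open>a\<^sup>2\<close>, so that the remainder of the integral is
  quadratic, with constant \<open>\<integral>\<sigma>\<^sup>2\<bar>\<xi>\<bar>\<^sup>2\<bar>\<phi>(\<xi>)\<bar>d\<xi>\<close>.\<close>

lemma osc_has_derivative:
  fixes \<phi> :: "real ^ 'd::finite \<Rightarrow> complex"
  assumes \<phi>: "rapid \<phi>"
  shows "(osc \<sigma> \<phi> has_derivative
    (\<lambda>v. LINT \<xi>|lborel. exp (\<i> * of_real (\<sigma> * (x \<bullet> \<xi>))) * (\<i> * of_real (\<sigma> * (v \<bullet> \<xi>)) * \<phi> \<xi>))) (at x)"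
proof -
  let ?e = "\<lambda>x \<xi>. exp (\<i> * of_real (\<sigma> * (x \<bullet> \<xi>)))"
  define I where "I = (\<lambda>v \<xi>. ?e x \<xi> * (\<i> * of_real (\<sigma> * (v \<bullet> \<xi>)) * \<phi> \<xi>))"
  define L where "L = (\<lambda>v. LINT \<xi>|lborel. I v \<xi>)"
  define K where "K = (LINT \<xi>|lborel. cmod (of_real (\<sigma>\<^sup>2 * (norm \<xi>)\<^sup>2) * \<phi> \<xi>))"
  have K: "K \<ge> 0" unfolding K_def by (rule Bochner_Integration.integral_nonneg) simp
  have rK: "rapid (\<lambda>\<xi>. of_real (\<sigma>\<^sup>2 * (norm \<xi>)\<^sup>2) * \<phi> \<xi>)"
    by (rule rapid_temperate_mult[where C = "\<sigma>\<^sup>2" and k = 2])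
      (auto intro!: \<phi> continuous_intros mult_left_mono power_mono simp: norm_mult norm_power abs_mult)
  have "rapid (\<lambda>\<xi>. (\<i> * of_real (\<sigma> * (v \<bullet> \<xi>))) * \<phi> \<xi>)" for v
  proof (rule rapid_temperate_mult[where C = "\<bar>\<sigma>\<bar> * norm v" and k = 1])
    fix \<xi> :: "real ^ 'd"
    have "\<bar>v \<bullet> \<xi>\<bar> \<le> norm v * (1 + norm \<xi>)"
      by (rule order_trans[OF Cauchy_Schwarz_ineq2]) (intro mult_left_mono; simp)
    then have "\<bar>\<sigma>\<bar> * \<bar>v \<bullet> \<xi>\<bar> \<le> \<bar>\<sigma>\<bar> * (norm v * (1 + norm \<xi>))" by (intro mult_left_mono) auto
    then show "cmod (\<i> * of_real (\<sigma> * (v \<bullet> \<xi>))) \<le> \<bar>\<sigma>\<bar> * norm v * (1 + norm \<xi>) ^ 1"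
      by (simp add: norm_mult abs_mult mult.assoc)
  qed (auto intro!: \<phi> continuous_intros)
  then have iI: "integrable lborel (I v)" for v
    unfolding I_def by (intro rapid_integrable rapid_osc_integrand) (simp add: mult_ac)
  have ie: "integrable lborel (\<lambda>\<xi>. ?e y \<xi> * \<phi> \<xi>)" for y
    by (intro rapid_integrable rapid_osc_integrand \<phi>)
  have "linear L"
  proof (rule linearI)
    show "L (v + w) = L v + L w" for v w
      unfolding L_def by (subst Bochner_Integration.integral_add[OF iI iI, symmetric])
        (simp add: I_def inner_add_left algebra_simps)
    show "L (r *\<^sub>R v) = r *\<^sub>R L v" for r v
    proof -
      have "I (r *\<^sub>R v) = (\<lambda>\<xi>. r *\<^sub>R I v \<xi>)"
        by (simp add: I_def fun_eq_iff scaleR_conv_of_real[where 'a = complex] mult_ac)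
      then show ?thesis unfolding L_def by simp
    qed
  qed
  have est: "norm (osc \<sigma> \<phi> y - osc \<sigma> \<phi> x - L (y - x)) \<le> K * (norm (y - x))\<^sup>2" for y
  proof -
    have "osc \<sigma> \<phi> y - osc \<sigma> \<phi> x - L (y - x) = (LINT \<xi>|lborel. ?e y \<xi> * \<phi> \<xi> - ?e x \<xi> * \<phi> \<xi> - I (y - x) \<xi>)"
      unfolding osc_def L_def using ie iI by simp
    also have "norm \<dots> \<le> (LINT \<xi>|lborel. (norm (y - x))\<^sup>2 * cmod (of_real (\<sigma>\<^sup>2 * (norm \<xi>)\<^sup>2) * \<phi> \<xi>))"
    proof (rule Bochner_Integration.integral_norm_bound_integral)
      show "integrable lborel (\<lambda>\<xi>. ?e y \<xi> * \<phi> \<xi> - ?e x \<xi> * \<phi> \<xi> - I (y - x) \<xi>)"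
        using ie iI by simp
      show "integrable lborel (\<lambda>\<xi>. (norm (y - x))\<^sup>2 * cmod (of_real (\<sigma>\<^sup>2 * (norm \<xi>)\<^sup>2) * \<phi> \<xi>))"
        by (intro integrable_mult_right integrable_norm rapid_integrable rK)
      fix \<xi> :: "real ^ 'd"
      define a where "a = \<sigma> * ((y - x) \<bullet> \<xi>)"
      have ya: "\<sigma> * (y \<bullet> \<xi>) = \<sigma> * (x \<bullet> \<xi>) + a"
        unfolding a_def by (simp add: inner_diff_left algebra_simps)
      have "?e y \<xi> = ?e x \<xi> * exp (\<i> * of_real a)"
        unfolding ya of_real_add distrib_left exp_add ..
      then have "?e y \<xi> * \<phi> \<xi> - ?e x \<xi> * \<phi> \<xi> - I (y - x) \<xi> = ?e x \<xi> * ((exp (\<i> * of_real a) - (1 + \<i> * of_real a)) * \<phi> \<xi>)"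
        unfolding I_def a_def[symmetric] by (simp add: algebra_simps)
      then have "cmod (?e y \<xi> * \<phi> \<xi> - ?e x \<xi> * \<phi> \<xi> - I (y - x) \<xi>) = cmod (exp (\<i> * of_real a) - (1 + \<i> * of_real a)) * cmod (\<phi> \<xi>)"
        by (simp add: norm_mult)
      also have "\<dots> \<le> a\<^sup>2 * cmod (\<phi> \<xi>)"
      proof (rule mult_right_mono)
        have "cmod (exp (\<i> * of_real a) - (1 + \<i> * of_real a)) \<le> a\<^sup>2 / 2"
          using iexp_approx1[of a 1] by (simp add: power2_eq_square)
        then show "cmod (exp (\<i> * of_real a) - (1 + \<i> * of_real a)) \<le> a\<^sup>2"
          using zero_le_power2[of a] by linarith
      qed simp
      also have "\<dots> \<le> (\<sigma>\<^sup>2 * ((norm (y - x))\<^sup>2 * (norm \<xi>)\<^sup>2)) * cmod (\<phi> \<xi>)"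
      proof (rule mult_right_mono)
        have "((y - x) \<bullet> \<xi>)\<^sup>2 \<le> (norm (y - x) * norm \<xi>)\<^sup>2"
          using Cauchy_Schwarz_ineq2[of "y - x" \<xi>] by (simp add: abs_le_square_iff[symmetric] abs_mult)
        then show "a\<^sup>2 \<le> \<sigma>\<^sup>2 * ((norm (y - x))\<^sup>2 * (norm \<xi>)\<^sup>2)"
          unfolding a_def power_mult_distrib by (intro mult_left_mono) auto
      qed simp
      finally show "cmod (?e y \<xi> * \<phi> \<xi> - ?e x \<xi> * \<phi> \<xi> - I (y - x) \<xi>) \<le> (norm (y - x))\<^sup>2 * cmod (of_real (\<sigma>\<^sup>2 * (norm \<xi>)\<^sup>2) * \<phi> \<xi>)"
        by (simp add: norm_mult norm_power mult_ac)
    qed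
    also have "\<dots> = K * (norm (y - x))\<^sup>2" unfolding K_def by simp
    finally show ?thesis .
  qed
  have "(osc \<sigma> \<phi> has_derivative L) (at x)"
    unfolding has_derivative_at_alt
  proof (intro conjI allI impI)
    show "bounded_linear L" using \<open>linear L\<close> linear_conv_bounded_linear by blast
    fix e :: real assume e: "e > 0"
    show "\<exists>d>0. \<forall>y. norm (y - x) < d \<longrightarrow> norm (osc \<sigma> \<phi> y - osc \<sigma> \<phi> x - L (y - x)) \<le> e * norm (y - x)"
    proof (intro exI[of _ "e / (K + 1)"] conjI allI impI)
      show "e / (K + 1) > 0" using e K by simp
      fix y assume "norm (y - x) < e / (K + 1)"
      then have "norm (y - x) * (K + 1) \<le> e" using K by (simp add: pos_less_divide_eq)
      moreover have "K * norm (y - x) \<le> norm (y - x) * (K + 1)" unfolding distrib_left by (simp add: mult.commute)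
      ultimately have "K * norm (y - x) \<le> e" by (rule order_trans[rotated])
      then have "(K * norm (y - x)) * norm (y - x) \<le> e * norm (y - x)" by (rule mult_right_mono) simp
      then show "norm (osc \<sigma> \<phi> y - osc \<sigma> \<phi> x - L (y - x)) \<le> e * norm (y - x)"
        using est[of y] by (simp add: power2_eq_square mult.assoc)
    qed
  qed
  then show ?thesis unfolding L_def I_def .
qed

lemma partial_deriv_osc:
  assumes "rapid \<phi>"
  shows "partial_deriv j (osc \<sigma> \<phi>) = osc \<sigma> (freq_mult \<sigma> j \<phi>)"
  by (subst partial_deriv_eqI[OF osc_has_derivative[OF assms]])
    (simp add: osc_def freq_mult_def inner_axis' fun_eq_iff)

lemma rapid_freq_mults: "rapid \<phi> \<Longrightarrow> rapid (foldr (freq_mult \<sigma>) js \<phi>)"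
  by (induction js) (auto intro: rapid_freq_mult)

lemma partial_derivs_osc:
  assumes "rapid \<phi>"
  shows "partial_derivs js (osc \<sigma> \<phi>) = osc \<sigma> (foldr (freq_mult \<sigma>) js \<phi>)"
  by (induction js) (simp_all add: partial_deriv_osc rapid_freq_mults assms)

lemma smooth_osc: "rapid \<phi> \<Longrightarrow> smooth (osc \<sigma> \<phi>)"
  unfolding smooth_def differentiable_def
  by (auto simp: partial_derivs_osc intro!: exI osc_has_derivative rapid_freq_mults)

lemma osc_by_parts:
  fixes \<phi> :: "real ^ 'd::finite \<Rightarrow> complex"
  assumes "rapid \<phi>" "rapid \<phi>'"
    and deriv: "\<And>\<xi>. ((\<lambda>u. \<phi> (\<xi> + u *\<^sub>R axis j 1)) has_vector_derivative \<phi>' \<xi>) (at 0)"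
  shows "osc \<sigma> \<phi>' x = - \<i> * of_real (\<sigma> * x $ j) * osc \<sigma> \<phi> x"
proof -
  let ?e = "\<lambda>\<xi>. exp (\<i> * of_real (\<sigma> * (x \<bullet> \<xi>)))" and ?c = "\<i> * of_real (\<sigma> * x $ j)"
  let ?H' = "\<lambda>\<xi>. ?c * (?e \<xi> * \<phi> \<xi>) + ?e \<xi> * \<phi>' \<xi>"
  have r: "rapid (\<lambda>\<xi>. ?e \<xi> * \<phi> \<xi>)" "rapid (\<lambda>\<xi>. ?e \<xi> * \<phi>' \<xi>)" using assms rapid_osc_integrand by blast+
  have "(LINT \<xi>|lborel. ?H' \<xi>) = 0"
  proof (rule integral_directional_derivative_eq_0[where e = "axis j 1" and H = "\<lambda>\<xi>. ?e \<xi> * \<phi> \<xi>"])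
    show "rapid ?H'" using r by (intro rapid_add rapid_cmult)
    fix \<xi>
    have "((\<lambda>u. \<i> * of_real (\<sigma> * (x \<bullet> (\<xi> + u *\<^sub>R axis j 1)))) has_vector_derivative ?c) (at 0)"
      by (auto intro!: derivative_eq_intros simp: inner_axis inner_add_right)
    then have "((\<lambda>u. exp (\<i> * of_real (\<sigma> * (x \<bullet> (\<xi> + u *\<^sub>R axis j 1))))) has_vector_derivative (?c * ?e \<xi>)) (at 0)"
      using field_vector_diff_chain_at[of "\<lambda>u. \<i> * of_real (\<sigma> * (x \<bullet> (\<xi> + u *\<^sub>R axis j 1)))" ?c 0 exp "?e \<xi>"]
      by (auto simp: o_def intro!: derivative_eq_intros)
    from has_vector_derivative_mult[OF this deriv[of \<xi>]]
    show "((\<lambda>u. ?e (\<xi> + u *\<^sub>R axis j 1) * \<phi> (\<xi> + u *\<^sub>R axis j 1)) has_vector_derivative ?H' \<xi>) (at 0)"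
      by (simp add: algebra_simps)
  qed (use r in auto)
  moreover have "(LINT \<xi>|lborel. ?H' \<xi>) = ?c * osc \<sigma> \<phi> x + osc \<sigma> \<phi>' x"
    unfolding osc_def using r rapid_integrable by (subst Bochner_Integration.integral_add) auto
  ultimately show ?thesis by (simp add: add_eq_0_iff)
qed

section \<open>The Fourier transform and the propagator on Schwartz functions\<close>

definition schwartz :: "(real ^ 'd::finite \<Rightarrow> complex) \<Rightarrow> bool" where
  "schwartz f \<longleftrightarrow> smooth f \<and> (\<forall>js. rapid (partial_derivs js f))"

lemma schwartz_smooth: "schwartz f \<Longrightarrow> smooth f"
  and schwartz_rapid_derivs: "schwartz f \<Longrightarrow> rapid (partial_derivs js f)"
  unfolding schwartz_def by auto

lemma schwartz_rapid: "schwartz f \<Longrightarrow> rapid f"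
  using schwartz_rapid_derivs[of f "[]"] by simp

lemma schwartz_partial_derivs: "schwartz f \<Longrightarrow> schwartz (partial_derivs js f)"
  unfolding schwartz_def using smooth_partial_derivs by (metis foldr_append)

lemma schwartz_partial_deriv: "schwartz f \<Longrightarrow> schwartz (partial_deriv j f)"
  using schwartz_partial_derivs[of f "[j]"] by simp

lemma schwartz_add: "schwartz f \<Longrightarrow> schwartz g \<Longrightarrow> schwartz (\<lambda>x. f x + g x)"
  unfolding schwartz_def by (auto simp: smooth_add partial_derivs_add rapid_add)

lemma schwartz_cmult: "schwartz f \<Longrightarrow> schwartz (\<lambda>x. c * f x)"
  unfolding schwartz_def by (auto simp: smooth_cmult partial_derivs_cmult rapid_cmult)

lemma schwartz_zero: "schwartz (\<lambda>x. 0)"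
  unfolding schwartz_def by (auto simp: smooth_zero partial_derivs_zero rapid_zero)

lemma schwartz_coord_mult: "schwartz f \<Longrightarrow> schwartz (\<lambda>x. of_real (x $ j) * f x)"
  unfolding schwartz_def
  by (auto simp: smooth_coord_mult partial_derivs_coord_mult
      intro!: rapid_add rapid_coord_mult rapid_sum_list)

lemma smooth_has_vector_derivative_axis:
  assumes "smooth f"
  shows "((\<lambda>u. f (x + u *\<^sub>R axis j 1)) has_vector_derivative partial_deriv j f x) (at 0)"
proof -
  have "((\<lambda>u. x + u *\<^sub>R axis j 1) has_derivative (\<lambda>u. u *\<^sub>R axis j 1)) (at 0)"
    by (auto intro!: derivative_eq_intros)
  moreover have "(f has_derivative frechet_derivative f (at x)) (at (x + 0 *\<^sub>R axis j 1))"
    using smooth_has_derivative[OF assms, of x] by simp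
  ultimately have "((\<lambda>u. f (x + u *\<^sub>R axis j 1)) has_derivative (\<lambda>u. frechet_derivative f (at x) (u *\<^sub>R axis j 1))) (at 0)"
    by (rule has_derivative_compose)
  then show ?thesis
    unfolding has_vector_derivative_def partial_deriv_def
    using linear_frechet_derivative[OF smooth_differentiable[OF assms], of x] by (simp add: linear_scale)
qed

abbreviation fourier_const :: "'d::finite itself \<Rightarrow> real" where
  "fourier_const _ \<equiv> (2 * pi) powr (- real CARD('d) / 2)"

lemma fourier_osc:
  "fourier f = (\<lambda>\<xi>. of_real (fourier_const TYPE('d)) * osc (-1) f \<xi>)"
  for f :: "real ^ 'd::finite \<Rightarrow> complex"
  unfolding fourier_def osc_def by (simp add: fun_eq_iff inner_commute mult.commute)

definition phase :: "real \<Rightarrow> (real ^ 'd::finite \<Rightarrow> real) \<Rightarrow> real ^ 'd \<Rightarrow> complex" where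
  "phase t p \<xi> = exp (- \<i> * of_real (t * p \<xi>))"

lemma propagator_osc:
  "propagator p t f = (\<lambda>x. of_real (fourier_const TYPE('d)) *
     osc 1 (\<lambda>\<xi>. phase t p \<xi> * fourier f \<xi>) x)"
  for f :: "real ^ 'd::finite \<Rightarrow> complex"
  unfolding propagator_def osc_def phase_def
  by (simp add: fun_eq_iff exp_add[symmetric] mult.assoc[symmetric])

lemma osc_add:
  assumes "rapid f" "rapid g"
  shows "osc \<sigma> (\<lambda>x. f x + g x) \<xi> = osc \<sigma> f \<xi> + osc \<sigma> g \<xi>"
  unfolding osc_def using assms[THEN rapid_osc_integrand, THEN rapid_integrable]
  by (subst Bochner_Integration.integral_add[symmetric]) (auto simp: distrib_left)

lemma osc_cmult: "osc \<sigma> (\<lambda>x. c * f x) \<xi> = c * osc \<sigma> f \<xi>"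
  unfolding osc_def by (subst integral_mult_right_zero[symmetric]) (simp add: mult_ac)

lemma fourier_add: "rapid f \<Longrightarrow> rapid g \<Longrightarrow> fourier (\<lambda>x. f x + g x) = (\<lambda>\<xi>. fourier f \<xi> + fourier g \<xi>)"
  unfolding fourier_osc by (simp add: osc_add distrib_left)

lemma fourier_cmult: "fourier (\<lambda>x. c * f x) = (\<lambda>\<xi>. c * fourier f \<xi>)"
  unfolding fourier_osc by (simp add: osc_cmult mult_ac)

lemma fourier_partial_deriv:
  assumes "schwartz w"
  shows "fourier (partial_deriv j w) \<xi> = \<i> * of_real (\<xi> $ j) * fourier w \<xi>"
proof -
  have "osc (-1) (partial_deriv j w) \<xi> = - \<i> * of_real (-1 * \<xi> $ j) * osc (-1) w \<xi>"
    by (rule osc_by_parts[OF schwartz_rapid[OF assms] schwartz_rapid[OF schwartz_partial_deriv[OF assms]]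
          smooth_has_vector_derivative_axis[OF schwartz_smooth[OF assms]]])
  then have "osc (-1) (partial_deriv j w) \<xi> = \<i> * of_real (\<xi> $ j) * osc (-1) w \<xi>" by simp
  then show ?thesis unfolding fourier_osc by (simp only: mult_ac)
qed

lemma smooth_fourier: "rapid w \<Longrightarrow> smooth (fourier w)"
  unfolding fourier_osc by (intro smooth_cmult smooth_osc)

lemma partial_deriv_fourier:
  assumes "rapid w"
  shows "partial_deriv j (fourier w) = fourier (\<lambda>x. - \<i> * (of_real (x $ j) * w x))"
proof -
  have "freq_mult (-1) j w = (\<lambda>x. - \<i> * (of_real (x $ j) * w x))"
    unfolding freq_mult_def by (simp add: fun_eq_iff)
  then show ?thesis
    unfolding fourier_osc by (simp add: partial_deriv_cmult smooth_osc assms partial_deriv_osc)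
qed

definition monomial :: "'d::finite list \<Rightarrow> real ^ 'd \<Rightarrow> real" where
  "monomial ls x = (\<Prod>j\<leftarrow>ls. x $ j)"

lemma monomial_simps [simp]: "monomial [] x = 1" "monomial (j # ls) x = x $ j * monomial ls x"
  unfolding monomial_def by auto

lemma monomial_replicate: "monomial (replicate n j) x = (x $ j) ^ n"
  by (induction n) auto

lemma monomial_eq_mi_pow: "monomial ls x = mi_pow x (count_list ls)"
proof (induction ls)
  case (Cons j ls)
  have "mi_pow x (count_list (j # ls)) = (\<Prod>k\<in>UNIV. (if k = j then x $ k else 1) * (x $ k) ^ count_list ls k)"
    unfolding mi_pow_def by (intro prod.cong) auto
  then show ?case using Cons by (simp add: prod.distrib mi_pow_def)
qed (simp add: mi_pow_def)

lemma monomial_mult_fourier: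
  assumes "schwartz w"
  shows "of_real (monomial ls \<xi>) * fourier w \<xi> = fourier (\<lambda>x. (- \<i>) ^ length ls * partial_derivs ls w x) \<xi>"
proof (induction ls)
  case (Cons j ls)
  have "of_real (monomial (j # ls) \<xi>) * fourier w \<xi> = of_real (\<xi> $ j) * ((- \<i>) ^ length ls * fourier (partial_derivs ls w) \<xi>)"
    using Cons.IH by (simp add: fourier_cmult mult.assoc)
  also have "\<dots> = (- \<i>) ^ length ls * (of_real (\<xi> $ j) * fourier (partial_derivs ls w) \<xi>)"
    by (rule mult.left_commute)
  also have "of_real (\<xi> $ j) * fourier (partial_derivs ls w) \<xi> = - \<i> * fourier (partial_deriv j (partial_derivs ls w)) \<xi>"
    by (simp add: fourier_partial_deriv schwartz_partial_derivs assms mult.assoc)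
  finally show ?case unfolding fourier_cmult by (simp add: mult_ac)
qed simp

lemma norm_power_le_sum_components:
  "norm x ^ n \<le> real CARD('d) ^ n * (\<Sum>j\<in>UNIV. \<bar>x $ j\<bar> ^ n)"
  for x :: "real ^ 'd::finite"
proof -
  have "(MAX j. \<bar>x $ j\<bar>) \<in> range (\<lambda>j. \<bar>x $ j\<bar>)" by (rule Max_in) auto
  then obtain k where k: "\<bar>x $ k\<bar> = (MAX j. \<bar>x $ j\<bar>)" by (metis imageE)
  have "norm x \<le> (\<Sum>j\<in>UNIV. \<bar>x $ j\<bar>)" by (rule norm_le_l1_cart)
  also have "\<dots> \<le> (\<Sum>j\<in>(UNIV :: 'd set). \<bar>x $ k\<bar>)" unfolding k by (intro sum_mono Max_ge) auto
  finally have "norm x ^ n \<le> (real CARD('d) * \<bar>x $ k\<bar>) ^ n" by (intro power_mono) auto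
  also have "\<bar>x $ k\<bar> ^ n \<le> (\<Sum>j\<in>UNIV. \<bar>x $ j\<bar> ^ n)" by (rule member_le_sum) auto
  then have "(real CARD('d) * \<bar>x $ k\<bar>) ^ n \<le> real CARD('d) ^ n * (\<Sum>j\<in>UNIV. \<bar>x $ j\<bar> ^ n)"
    unfolding power_mult_distrib by (intro mult_left_mono) auto
  finally show ?thesis .
qed

lemma one_plus_power_le: "(1 + y) ^ n \<le> 2 ^ n * (1 + y ^ n)" if "y \<ge> 0" for y :: real
proof -
  have "(1 + y) ^ n \<le> (2 * max 1 y) ^ n" using that by (intro power_mono) auto
  also have "\<dots> \<le> 2 ^ n * (1 + y ^ n)"
    using that unfolding power_mult_distrib by (intro mult_left_mono) (auto simp: max_def)
  finally show ?thesis .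
qed

lemma cmod_fourier_le:
  fixes w :: "real ^ 'd::finite \<Rightarrow> complex"
  assumes "continuous_on UNIV w" "\<And>x. (1 + norm x) ^ (2 * CARD('d)) * cmod (w x) \<le> B"
  shows "cmod (fourier w \<xi>) \<le> fourier_const TYPE('d) * (B * weight_integral TYPE('d))"
proof -
  have "cmod (osc (-1) w \<xi>) \<le> B * weight_integral TYPE('d)"
    using cmod_osc_le weighted_bound_integral(2)[OF assms] by (rule order_trans)
  then show ?thesis unfolding fourier_osc by (simp add: norm_mult mult_left_mono)
qed

text \<open>Since \<open>\<bar>\<xi>\<bar>\<^sup>n\<close> is comparable with the largest \<open>\<bar>\<xi>\<^sub>j\<bar>\<^sup>n\<close>, only derivatives of order \<open>0\<close> and \<open>n\<close> are
  needed; the bound is linear in their weighted suprema.\<close>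

lemma fourier_decay:
  fixes w :: "real ^ 'd::finite \<Rightarrow> complex"
  assumes w: "schwartz w" and B: "\<And>ls x. length ls = 0 \<or> length ls = n \<Longrightarrow>
      (1 + norm x) ^ (2 * CARD('d)) * cmod (partial_derivs ls w x) \<le> B"
  shows "(1 + norm \<xi>) ^ n * cmod (fourier w \<xi>)
    \<le> 2 ^ n * (1 + real CARD('d) ^ Suc n) * (fourier_const TYPE('d) * weight_integral TYPE('d)) * B"
proof -
  let ?C = "fourier_const TYPE('d) * (B * weight_integral TYPE('d))" and ?d = "real CARD('d)"
  have le: "\<bar>monomial ls \<xi>\<bar> * cmod (fourier w \<xi>) \<le> ?C" if "length ls = 0 \<or> length ls = n" for ls
  proof -
    have "cmod (of_real (monomial ls \<xi>) * fourier w \<xi>) \<le> ?C"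
      unfolding monomial_mult_fourier[OF w]
      using B[OF that] rapid_continuous[OF schwartz_rapid_derivs[OF w]]
      by (intro cmod_fourier_le continuous_intros) (auto simp: norm_mult norm_power)
    then show ?thesis by (simp add: norm_mult)
  qed
  have "norm \<xi> ^ n * cmod (fourier w \<xi>) \<le> (?d ^ n * (\<Sum>j\<in>UNIV. \<bar>\<xi> $ j\<bar> ^ n)) * cmod (fourier w \<xi>)"
    by (intro mult_right_mono norm_power_le_sum_components) auto
  also have "\<dots> = ?d ^ n * (\<Sum>j\<in>UNIV. \<bar>monomial (replicate n j) \<xi>\<bar> * cmod (fourier w \<xi>))"
    by (simp add: monomial_replicate power_abs sum_distrib_right)
  also have "\<dots> \<le> ?d ^ n * (\<Sum>j\<in>(UNIV :: 'd set). ?C)"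
    by (intro mult_left_mono sum_mono le) auto
  finally have "norm \<xi> ^ n * cmod (fourier w \<xi>) \<le> ?d ^ Suc n * ?C" by (simp add: mult_ac)
  moreover have "cmod (fourier w \<xi>) \<le> ?C" using le[of "[]"] by simp
  ultimately have "(1 + norm \<xi> ^ n) * cmod (fourier w \<xi>) \<le> (1 + ?d ^ Suc n) * ?C"
    unfolding distrib_right by (intro add_mono) auto
  then have le2: "2 ^ n * ((1 + norm \<xi> ^ n) * cmod (fourier w \<xi>)) \<le> 2 ^ n * ((1 + ?d ^ Suc n) * ?C)"
    by (intro mult_left_mono) auto
  have "(1 + norm \<xi>) ^ n * cmod (fourier w \<xi>) \<le> 2 ^ n * (1 + norm \<xi> ^ n) * cmod (fourier w \<xi>)"
    by (intro mult_right_mono one_plus_power_le) auto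
  also have "\<dots> \<le> 2 ^ n * ((1 + ?d ^ Suc n) * ?C)"
    using le2 by (simp only: mult.assoc)
  finally show ?thesis by (simp only: mult_ac)
qed

lemma rapid_fourier:
  fixes w :: "real ^ 'd::finite \<Rightarrow> complex"
  assumes w: "schwartz w"
  shows "rapid (fourier w)"
  unfolding rapid_def
proof (intro conjI allI)
  show "continuous_on UNIV (fourier w)" by (intro smooth_continuous smooth_fourier schwartz_rapid w)
  fix n
  let ?L = "{ls :: 'd list. length ls = 0 \<or> length ls = n}"
  have fin: "finite ?L"
    by (rule finite_subset[OF _ finite_lists_length_le[of "UNIV :: 'd set" n]]) auto
  have "\<forall>ls. \<exists>B. \<forall>x. (1 + norm x) ^ (2 * CARD('d)) * cmod (partial_derivs ls w x) \<le> B"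
    using schwartz_rapid_derivs[OF w] unfolding rapid_def by blast
  then obtain B where B: "\<And>ls x. (1 + norm x) ^ (2 * CARD('d)) * cmod (partial_derivs ls w x) \<le> B ls"
    by metis
  have "(1 + norm x) ^ (2 * CARD('d)) * cmod (partial_derivs ls w x) \<le> Max (B ` ?L)"
    if "length ls = 0 \<or> length ls = n" for ls x
    using that fin by (intro order_trans[OF B] Max_ge) auto
  from fourier_decay[OF w this]
  show "\<exists>B. \<forall>x. (1 + norm x) ^ n * cmod (fourier w x) \<le> B" by blast
qed

lemma continuous_on_phase:
  "continuous_on UNIV p \<Longrightarrow> continuous_on UNIV (phase t p)"
  unfolding phase_def by (intro continuous_intros)

lemma norm_phase: "cmod (phase t p \<xi>) = 1"
  unfolding phase_def by (simp add: norm_exp_eq_Re)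

lemma rapid_phase_mult:
  assumes "continuous_on UNIV p" "rapid f"
  shows "rapid (\<lambda>\<xi>. phase t p \<xi> * f \<xi>)"
  by (rule rapid_temperate_mult[where C = 1 and k = 0, OF assms(2) continuous_on_phase[OF assms(1)]])
    (simp add: norm_phase)

text \<open>The Fourier multiplier has modulus one, so the supremum is bounded by the \<open>L\<^sup>1\<close> norm of the Fourier
  transform, with a constant independent of \<open>p\<close> and \<open>t\<close>.\<close>

lemma cmod_propagator_le:
  fixes w :: "real ^ 'd::finite \<Rightarrow> complex"
  assumes p: "continuous_on UNIV p" and w: "schwartz w"
    and B: "\<And>ls x. length ls = 0 \<or> length ls = 2 * CARD('d) \<Longrightarrow>
      (1 + norm x) ^ (2 * CARD('d)) * cmod (partial_derivs ls w x) \<le> B"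
  shows "cmod (propagator p t w x)
    \<le> 2 ^ (2 * CARD('d)) * (1 + real CARD('d) ^ Suc (2 * CARD('d)))
       * (fourier_const TYPE('d) * weight_integral TYPE('d))\<^sup>2 * B"
proof -
  let ?g = "\<lambda>\<xi>. phase t p \<xi> * fourier w \<xi>"
  let ?A = "2 ^ (2 * CARD('d)) * (1 + real CARD('d) ^ Suc (2 * CARD('d)))
      * (fourier_const TYPE('d) * weight_integral TYPE('d)) * B"
  have "cmod (osc 1 ?g x) \<le> ?A * weight_integral TYPE('d)"
  proof (rule order_trans[OF cmod_osc_le weighted_bound_integral(2)])
    show "continuous_on UNIV ?g" by (intro rapid_continuous rapid_phase_mult p rapid_fourier w)
    show "(1 + norm \<xi>) ^ (2 * CARD('d)) * cmod (?g \<xi>) \<le> ?A" for \<xi>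
      using fourier_decay[OF w B, where \<xi> = \<xi>] by (simp add: norm_mult norm_phase)
  qed
  then have "fourier_const TYPE('d) * cmod (osc 1 ?g x) \<le> fourier_const TYPE('d) * (?A * weight_integral TYPE('d))"
    by (intro mult_left_mono) auto
  then show ?thesis unfolding propagator_osc by (simp add: norm_mult power2_eq_square mult_ac)
qed

lemma smooth_propagator:
  "continuous_on UNIV p \<Longrightarrow> schwartz w \<Longrightarrow> smooth (propagator p t w)"
  unfolding propagator_osc by (intro smooth_cmult smooth_osc rapid_phase_mult rapid_fourier)

lemma propagator_add:
  assumes "continuous_on UNIV p" "schwartz f" "schwartz g"
  shows "propagator p t (\<lambda>x. f x + g x) = (\<lambda>x. propagator p t f x + propagator p t g x)"
  unfolding propagator_osc fourier_add[OF assms(2,3)[THEN schwartz_rapid]] distrib_left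
  using assms by (subst osc_add) (auto intro!: rapid_phase_mult rapid_fourier simp: distrib_left)

lemma propagator_cmult: "propagator p t (\<lambda>x. c * f x) = (\<lambda>x. c * propagator p t f x)"
proof -
  have "(\<lambda>\<xi>. phase t p \<xi> * (c * fourier f \<xi>)) = (\<lambda>\<xi>. c * (phase t p \<xi> * fourier f \<xi>))"
    by (simp add: mult_ac)
  then show ?thesis unfolding propagator_osc fourier_cmult by (simp add: osc_cmult mult_ac)
qed

lemma partial_deriv_propagator:
  assumes p: "continuous_on UNIV p" and w: "schwartz w"
  shows "partial_deriv j (propagator p t w) = propagator p t (partial_deriv j w)"
proof -
  let ?g = "\<lambda>\<xi>. phase t p \<xi> * fourier w \<xi>"
  have r: "rapid ?g" by (intro rapid_phase_mult p rapid_fourier w)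
  have "freq_mult 1 j ?g = (\<lambda>\<xi>. phase t p \<xi> * fourier (partial_deriv j w) \<xi>)"
    unfolding freq_mult_def by (simp add: fourier_partial_deriv w fun_eq_iff mult_ac)
  then show ?thesis
    unfolding propagator_osc by (simp add: partial_deriv_cmult smooth_osc r partial_deriv_osc)
qed

lemma partial_derivs_propagator:
  assumes "continuous_on UNIV p" and "schwartz w"
  shows "partial_derivs js (propagator p t w) = propagator p t (partial_derivs js w)"
  by (induction js) (simp_all add: partial_deriv_propagator assms schwartz_partial_derivs)

section \<open>Polynomial symbols and the evolved coordinates\<close>

definition poly_eval :: "(real \<times> 'd::finite list) list \<Rightarrow> real ^ 'd \<Rightarrow> real" where
  "poly_eval ps x = (\<Sum>q\<leftarrow>ps. fst q * monomial (snd q) x)"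

definition poly_deriv :: "'d::finite \<Rightarrow> (real \<times> 'd list) list \<Rightarrow> (real \<times> 'd list) list" where
  "poly_deriv j ps = concat (map (\<lambda>q. map (Pair (fst q)) (removals j (snd q))) ps)"

text \<open>The differential operator \<open>q(D)\<close> with \<open>D = -i\<partial>\<close>.\<close>

definition poly_op :: "(real \<times> 'd::finite list) list \<Rightarrow> (real ^ 'd \<Rightarrow> complex) \<Rightarrow> real ^ 'd \<Rightarrow> complex" where
  "poly_op qs w x = (\<Sum>q\<leftarrow>qs. of_real (fst q) * (- \<i>) ^ length (snd q) * partial_derivs (snd q) w x)"

lemma polynomial_of_degree_poly_eval:
  assumes "polynomial_of_degree m p"
  obtains ps where "p = poly_eval ps" "\<forall>q\<in>set ps. length (snd q) \<le> m"
proof -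
  obtain c where c: "finite {\<alpha>. c \<alpha> \<noteq> 0}" "\<And>x. p x = (\<Sum>\<alpha> | c \<alpha> \<noteq> 0. c \<alpha> * mi_pow x \<alpha>)"
    "\<And>\<alpha>. c \<alpha> \<noteq> 0 \<Longrightarrow> mi_abs \<alpha> \<le> m"
    using assms unfolding polynomial_of_degree_def by blast
  obtain as where as: "set as = {\<alpha>. c \<alpha> \<noteq> 0}" "distinct as" using finite_distinct_list[OF c(1)] by blast
  have "\<forall>\<alpha> :: 'a \<Rightarrow> nat. \<exists>l. count_list l = \<alpha>"
    using ex_list_count by (auto simp: fun_eq_iff)
  from choice[OF this] obtain L where L: "\<And>\<alpha> :: 'a \<Rightarrow> nat. count_list (L \<alpha>) = \<alpha>" by blast
  have len: "length (L \<alpha>) = mi_abs \<alpha>" for \<alpha>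
    using sum_count_set[of "L \<alpha>" UNIV] unfolding L mi_abs_def by simp
  let ?ps = "map (\<lambda>\<alpha>. (c \<alpha>, L \<alpha>)) as"
  have "p = poly_eval ?ps"
    unfolding poly_eval_def
    by (simp add: fun_eq_iff c(2) as(1)[symmetric] sum_list_distinct_conv_sum_set[OF as(2)] o_def
        monomial_eq_mi_pow L)
  moreover have "\<forall>q\<in>set ?ps. length (snd q) \<le> m" using c(3) as(1) len by auto
  ultimately show ?thesis by (rule that)
qed

lemma poly_deriv_cases:
  assumes "q \<in> set (poly_deriv j ps)"
  obtains r where "r \<in> set ps" "Suc (length (snd q)) = length (snd r)"
  using assms unfolding poly_deriv_def by (auto dest!: length_in_removals)

lemma continuous_on_monomial: "continuous_on UNIV (monomial ls)"
proof (induction ls)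
  case (Cons j ls)
  have "monomial (j # ls) = (\<lambda>x. x $ j * monomial ls x)" by auto
  then show ?case using Cons by (auto intro!: continuous_intros)
next
  case Nil
  have "monomial [] = (\<lambda>x :: real ^ 'a. 1)" by auto
  then show ?case by auto
qed

lemma poly_eval_Cons: "poly_eval (q # qs) x = fst q * monomial (snd q) x + poly_eval qs x"
  unfolding poly_eval_def by simp

lemma continuous_on_poly_eval: "continuous_on UNIV (poly_eval ps)"
proof (induction ps)
  case (Cons q ps)
  have "poly_eval (q # ps) = (\<lambda>x. fst q * monomial (snd q) x + poly_eval ps x)"
    by (simp add: fun_eq_iff poly_eval_Cons)
  then show ?case using Cons continuous_on_monomial by (auto intro!: continuous_intros)
next
  case Nil
  have "poly_eval [] = (\<lambda>x :: real ^ 'a. 0)" unfolding poly_eval_def by auto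
  then show ?case by auto
qed

lemma monomial_line_deriv:
  "((\<lambda>u. monomial ls (x + u *\<^sub>R axis j 1)) has_real_derivative (\<Sum>k\<leftarrow>removals j ls. monomial k x)) (at 0)"
proof (induction ls)
  case (Cons i ls)
  have "((\<lambda>u. x $ i + u * axis j 1 $ i) has_real_derivative axis j 1 $ i) (at 0)"
    by (auto intro!: derivative_eq_intros)
  from DERIV_mult[OF this Cons.IH]
  have "((\<lambda>u. monomial (i # ls) (x + u *\<^sub>R axis j 1)) has_real_derivative
     axis j 1 $ i * monomial ls x + (\<Sum>k\<leftarrow>removals j ls. monomial k x) * (x $ i)) (at 0)"
    by simp
  moreover have "axis j 1 $ i * monomial ls x + (\<Sum>k\<leftarrow>removals j ls. monomial k x) * (x $ i)
     = (\<Sum>k\<leftarrow>removals j (i # ls). monomial k x)"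
    by (auto simp: axis_def o_def sum_list_const_mult mult.commute)
  ultimately show ?case by simp
qed simp

lemma poly_deriv_Cons:
  "poly_eval (poly_deriv j (q # ps)) x = fst q * (\<Sum>k\<leftarrow>removals j (snd q). monomial k x) + poly_eval (poly_deriv j ps) x"
  unfolding poly_deriv_def poly_eval_def by (simp add: o_def sum_list_const_mult)

lemma poly_eval_line_deriv:
  "((\<lambda>u. poly_eval ps (x + u *\<^sub>R axis j 1)) has_real_derivative poly_eval (poly_deriv j ps) x) (at 0)"
proof (induction ps)
  case (Cons q ps)
  show ?case
    unfolding poly_deriv_Cons unfolding poly_eval_Cons
    by (intro DERIV_add DERIV_cmult monomial_line_deriv Cons.IH)
next
  case Nil
  show ?case by (simp add: poly_eval_def poly_deriv_def)
qed

lemma poly_op_Cons: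
  "poly_op (q # qs) w = (\<lambda>x. of_real (fst q) * ((- \<i>) ^ length (snd q) * partial_derivs (snd q) w x) + poly_op qs w x)"
  unfolding poly_op_def by (simp add: fun_eq_iff mult.assoc)

lemma schwartz_poly_op:
  assumes "schwartz w"
  shows "schwartz (poly_op qs w)"
proof (induction qs)
  case (Cons q qs)
  then show ?case
    unfolding poly_op_Cons by (intro schwartz_add schwartz_cmult schwartz_partial_derivs assms)
next
  case Nil
  have "poly_op [] w = (\<lambda>x. 0)" unfolding poly_op_def by auto
  then show ?case by (simp add: schwartz_zero)
qed

lemma poly_eval_mult_fourier:
  assumes "schwartz w"
  shows "of_real (poly_eval qs \<xi>) * fourier w \<xi> = fourier (poly_op qs w) \<xi>"
proof (induction qs)
  case (Cons q qs)
  have r: "rapid (\<lambda>x. of_real (fst q) * ((- \<i>) ^ length (snd q) * partial_derivs (snd q) w x))"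
    "rapid (poly_op qs w)"
    by (intro rapid_cmult schwartz_rapid schwartz_partial_derivs schwartz_poly_op assms)+
  show ?case
    unfolding poly_op_Cons fourier_add[OF r] fourier_cmult[of "of_real (fst q)"]
      monomial_mult_fourier[OF assms, symmetric] Cons.IH[symmetric] poly_eval_Cons
    by (simp add: algebra_simps)
next
  case Nil
  then show ?case by (simp add: poly_eval_def poly_op_def fourier_def)
qed

text \<open>Conjugating multiplication by \<open>x\<^sub>j\<close> with the propagator gives the operator
  \<open>x\<^sub>j + t (\<partial>\<^sub>jp)(D)\<close>: this is how the propagator is handled without ever differentiating
  \<open>e\<^bsup>-itp\<^esup>\<close> more than once.\<close>

definition evolved_coord ::
  "real \<Rightarrow> (real \<times> 'd::finite list) list \<Rightarrow> 'd \<Rightarrow> (real ^ 'd \<Rightarrow> complex) \<Rightarrow> real ^ 'd \<Rightarrow> complex" where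
  "evolved_coord t ps j w = (\<lambda>x. of_real (x $ j) * w x + of_real t * poly_op (poly_deriv j ps) w x)"

lemma schwartz_evolved_coord: "schwartz w \<Longrightarrow> schwartz (evolved_coord t ps j w)"
  unfolding evolved_coord_def by (intro schwartz_add schwartz_cmult schwartz_coord_mult schwartz_poly_op)

lemma schwartz_evolved_coords: "schwartz w \<Longrightarrow> schwartz (foldr (evolved_coord t ps) js w)"
  by (induction js) (auto intro: schwartz_evolved_coord)

lemma phase_line_deriv:
  "((\<lambda>u. phase t (poly_eval ps) (\<xi> + u *\<^sub>R axis j 1)) has_vector_derivative
     - \<i> * of_real (t * poly_eval (poly_deriv j ps) \<xi>) * phase t (poly_eval ps) \<xi>) (at 0)"
proof -
  have "((\<lambda>u. t * poly_eval ps (\<xi> + u *\<^sub>R axis j 1)) has_real_derivative t * poly_eval (poly_deriv j ps) \<xi>) (at 0)"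
    by (rule DERIV_cmult[OF poly_eval_line_deriv])
  from has_vector_derivative_mult_right[OF has_vector_derivative_of_real[OF this], of "- \<i>"]
  have "((\<lambda>u. - \<i> * of_real (t * poly_eval ps (\<xi> + u *\<^sub>R axis j 1))) has_vector_derivative
     - \<i> * of_real (t * poly_eval (poly_deriv j ps) \<xi>)) (at 0)" .
  from field_vector_diff_chain_at[OF this DERIV_exp]
  show ?thesis unfolding phase_def by (simp add: o_def)
qed

text \<open>Multiplication by \<open>x\<^sub>j\<close> is integration by parts in \<open>\<xi>\<^sub>j\<close>. The derivative falls either on the phase, where
  it produces \<open>t \<partial>\<^sub>jp\<close>, or on the Fourier transform of \<open>w\<close>, where it produces \<open>x\<^sub>j w\<close>.\<close>

lemma coord_mult_propagator:
  fixes w :: "real ^ 'd::finite \<Rightarrow> complex"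
  assumes w: "schwartz w"
  shows "of_real (x $ j) * propagator (poly_eval ps) t w x = propagator (poly_eval ps) t (evolved_coord t ps j w) x"
proof -
  let ?p = "poly_eval ps" and ?q = "poly_eval (poly_deriv j ps)"
  let ?\<phi> = "\<lambda>\<xi>. phase t ?p \<xi> * fourier w \<xi>"
  let ?\<psi> = "\<lambda>\<xi>. phase t ?p \<xi> * fourier (evolved_coord t ps j w) \<xi>"
  have r: "rapid ?\<phi>" "rapid ?\<psi>"
    by (intro rapid_phase_mult continuous_on_poly_eval rapid_fourier schwartz_evolved_coord w)+
  have "osc 1 (\<lambda>\<xi>. - \<i> * ?\<psi> \<xi>) x = - \<i> * of_real (1 * x $ j) * osc 1 ?\<phi> x"
  proof (rule osc_by_parts[OF r(1) rapid_cmult[OF r(2)]])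
    fix \<xi>
    have "fourier (evolved_coord t ps j w) \<xi> = fourier (\<lambda>x. of_real (x $ j) * w x) \<xi> + of_real t * (of_real (?q \<xi>) * fourier w \<xi>)"
      unfolding evolved_coord_def poly_eval_mult_fourier[OF w]
      using w by (simp add: fourier_add fourier_cmult rapid_cmult schwartz_rapid schwartz_coord_mult schwartz_poly_op)
    moreover have "((\<lambda>u. fourier w (\<xi> + u *\<^sub>R axis j 1)) has_vector_derivative - \<i> * fourier (\<lambda>x. of_real (x $ j) * w x) \<xi>) (at 0)"
      using smooth_has_vector_derivative_axis[OF smooth_fourier[OF schwartz_rapid[OF w]], of \<xi> j]
      unfolding partial_deriv_fourier[OF schwartz_rapid[OF w]] fourier_cmult .
    ultimately show "((\<lambda>u. phase t ?p (\<xi> + u *\<^sub>R axis j 1) * fourier w (\<xi> + u *\<^sub>R axis j 1)) has_vector_derivative - \<i> * ?\<psi> \<xi>) (at 0)"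
      using has_vector_derivative_mult[OF phase_line_deriv[of t ps \<xi> j]] by (fastforce simp: algebra_simps)
  qed
  then have "osc 1 ?\<psi> x = of_real (x $ j) * osc 1 ?\<phi> x" unfolding osc_cmult by simp
  then show ?thesis unfolding propagator_osc by simp
qed

lemma monomial_mult_propagator:
  assumes "schwartz w"
  shows "of_real (monomial js x) * propagator (poly_eval ps) t w x
    = propagator (poly_eval ps) t (foldr (evolved_coord t ps) js w) x"
proof (induction js)
  case (Cons j js)
  have "of_real (monomial (j # js) x) * propagator (poly_eval ps) t w x
     = of_real (x $ j) * propagator (poly_eval ps) t (foldr (evolved_coord t ps) js w) x"
    unfolding Cons.IH[symmetric] by simp
  then show ?case by (simp add: coord_mult_propagator schwartz_evolved_coords assms)
qed simp

section \<open>The weighted estimate\<close>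

text \<open>The shift \<open>K\<close> records the operators already applied: a derivative raises it by \<open>s\<close> and an evolved
  coordinate by \<open>\<theta>\<close>, so that all these operators act within one family of bounds.\<close>

definition growth_bound ::
  "real \<Rightarrow> real \<Rightarrow> real \<Rightarrow> real \<Rightarrow> real \<Rightarrow> (real ^ 'd::finite \<Rightarrow> complex) \<Rightarrow> bool" where
  "growth_bound \<theta> s M h K f \<longleftrightarrow> (\<forall>n ls x. norm x ^ n * cmod (partial_derivs ls f x)
     \<le> M * h ^ (n + length ls) * growth (K + \<theta> * real n + s * real (length ls)))"

lemma growth_boundD:
  "growth_bound \<theta> s M h K f \<Longrightarrow> norm x ^ n * cmod (partial_derivs ls f x)
     \<le> M * h ^ (n + length ls) * growth (K + \<theta> * real n + s * real (length ls))"
  unfolding growth_bound_def by blast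

lemma growth_bound_schwartz:
  assumes "smooth f" "growth_bound \<theta> s M h K f"
  shows "schwartz f"
  unfolding schwartz_def rapid_def
proof (intro conjI allI assms(1))
  fix js n
  show "continuous_on UNIV (partial_derivs js f)"
    by (intro smooth_continuous smooth_partial_derivs assms(1))
  let ?G = "\<lambda>n. M * h ^ (n + length js) * growth (K + \<theta> * real n + s * real (length js))"
  have "(1 + norm x) ^ n * cmod (partial_derivs js f x) \<le> 2 ^ n * (?G 0 + ?G n)" for x
  proof -
    have "(1 + norm x) ^ n * cmod (partial_derivs js f x)
      \<le> 2 ^ n * (1 + norm x ^ n) * cmod (partial_derivs js f x)"
      by (intro mult_right_mono one_plus_power_le) auto
    also have "\<dots> = 2 ^ n * (norm x ^ 0 * cmod (partial_derivs js f x) + norm x ^ n * cmod (partial_derivs js f x))"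
      by (simp add: algebra_simps)
    also have "\<dots> \<le> 2 ^ n * (?G 0 + ?G n)"
      by (intro mult_left_mono add_mono growth_boundD[OF assms(2)]) auto
    finally show ?thesis .
  qed
  then show "\<exists>B. \<forall>x. (1 + norm x) ^ n * cmod (partial_derivs js f x) \<le> B" by blast
qed

lemma growth_bound_partial_derivs:
  assumes "growth_bound \<theta> s M h K f"
  shows "growth_bound \<theta> s (M * h ^ length js) h (K + s * real (length js)) (partial_derivs js f)"
  unfolding growth_bound_def
  using growth_boundD[OF assms, of _ _ "_ @ js"] by (simp add: power_add algebra_simps)

lemma norm_sum_list_le:
  fixes F :: "'a \<Rightarrow> complex"
  shows "cmod (\<Sum>k\<leftarrow>ks. F k) \<le> (\<Sum>k\<leftarrow>ks. cmod (F k))"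
  by (induction ks) (auto intro: order_trans[OF norm_triangle_ineq])

lemma sum_list_le_length_mult:
  fixes F :: "'a \<Rightarrow> real"
  assumes "\<And>k. k \<in> set ks \<Longrightarrow> F k \<le> B"
  shows "(\<Sum>k\<leftarrow>ks. F k) \<le> real (length ks) * B"
  using assms
proof (induction ks)
  case (Cons k ks)
  have "F k + (\<Sum>k\<leftarrow>ks. F k) \<le> B + real (length ks) * B"
    using Cons by (intro add_mono) auto
  then show ?case by (simp add: distrib_right)
qed simp

text \<open>The three terms of the cost factor belong to the coordinate, to its commutators with the
  derivatives already present, and to the derivatives in \<open>(\<partial>\<^sub>jp)(D)\<close>. The number \<open>L\<close> is a lower bound
  for \<open>K\<close> instead of \<open>K\<close> itself, so that the same factor serves for every step of an iteration in
  which \<open>K\<close> grows. Derivatives of positive order \<open>r\<close> gain \<open>h\<^sup>r\<close>; terms of order zero gain \<open>L\<^bsup>-\<theta>\<^esup>\<close> because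
  they leave \<open>X\<close> unchanged; \<open>\<tau>\<close> bounds both gains.\<close>

lemma growth_bound_evolved_coord:
  fixes f :: "real ^ 'd::finite \<Rightarrow> complex"
  assumes f: "smooth f" "growth_bound \<theta> s M h K f"
    and pos: "M \<ge> 0" "h > 0" "s > 0" "\<theta> > 0" "\<theta> + s \<ge> 1" "1 \<le> L" "L \<le> K"
    and len: "\<And>q. q \<in> set (poly_deriv j ps) \<Longrightarrow> s * real (length (snd q)) \<le> \<theta>"
    and \<tau>: "L powr (- \<theta>) \<le> \<tau>" "\<And>q. q \<in> set (poly_deriv j ps) \<Longrightarrow> snd q \<noteq> [] \<Longrightarrow> h ^ length (snd q) \<le> \<tau>"
    and C: "(\<Sum>q\<leftarrow>poly_deriv j ps. \<bar>fst q\<bar>) \<le> C"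
  shows "growth_bound \<theta> s (M * (h + L powr (1 - \<theta> - s) / (s * h) + \<bar>t\<bar> * (C * \<tau>))) h (K + \<theta>)
    (evolved_coord t ps j f)"
  unfolding growth_bound_def
proof (intro allI)
  fix n and ls :: "'d list" and x :: "real ^ 'd"
  let ?qs = "poly_deriv j ps"
  define b where "b = length ls"
  define X where "X = K + \<theta> * real n + s * real b"
  define G where "G = growth (X + \<theta>)"
  define R where "R = M * h ^ (n + b)"
  define N where "N = (\<lambda>k. norm x ^ n * cmod (partial_derivs k f x))"
  have XK: "X \<ge> K" "X \<ge> s * real b" unfolding X_def using pos by auto
  have X1: "X \<ge> 1" "X \<ge> L" using XK pos by auto
  have G: "G \<ge> 0" unfolding G_def using X1 pos growth_pos[of "X + \<theta>"] by simp
  have R: "R \<ge> 0" unfolding R_def using pos by auto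
  have \<tau>0: "\<tau> \<ge> 0" using \<tau>(1) by (rule order_trans[OF powr_ge_zero])
  have Nb: "N k \<le> M * h ^ (n + length k) * growth (K + \<theta> * real n + s * real (length k))" for k
    unfolding N_def by (rule growth_boundD[OF f(2)])
  have T1: "norm x ^ n * cmod (of_real (x $ j) * partial_derivs ls f x) \<le> R * (h * G)"
  proof -
    have "norm x ^ n * cmod (of_real (x $ j) * partial_derivs ls f x) \<le> norm x ^ n * (norm x * cmod (partial_derivs ls f x))"
      unfolding norm_mult by (intro mult_left_mono mult_right_mono) (auto simp: component_le_norm_cart)
    also have "\<dots> \<le> M * h ^ (Suc n + b) * growth (K + \<theta> * real (Suc n) + s * real b)"
      using growth_boundD[OF f(2), of x "Suc n" ls] unfolding b_def by (simp add: mult_ac)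
    also have "K + \<theta> * real (Suc n) + s * real b = X + \<theta>" unfolding X_def by (simp add: algebra_simps)
    finally show ?thesis unfolding R_def G_def by (simp add: mult_ac)
  qed
  have T2: "norm x ^ n * cmod (\<Sum>k\<leftarrow>removals j ls. partial_derivs k f x) \<le> R * (L powr (1 - \<theta> - s) / (s * h) * G)"
  proof (cases "b = 0")
    case True
    then show ?thesis using R G pos unfolding b_def by simp
  next
    case False
    have Xs: "X - s \<ge> 1"
    proof -
      have "s * 1 \<le> s * real b" using False pos by (intro mult_left_mono) auto
      moreover have "\<theta> * real n \<ge> 0" using pos by simp
      ultimately show ?thesis unfolding X_def using pos by linarith
    qed
    have each: "N k \<le> R / h * growth (X - s)" if "k \<in> set (removals j ls)" for k
    proof -
      have l: "Suc (length k) = b" using length_in_removals[OF that] unfolding b_def .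
      then have "K + \<theta> * real n + s * real (length k) = X - s" unfolding X_def l[symmetric] by (simp add: algebra_simps)
      moreover have "M * h ^ (n + length k) = R / h" unfolding R_def l[symmetric] using pos by simp
      ultimately show ?thesis using Nb[of k] by simp
    qed
    have g: "real b * growth (X - s) \<le> L powr (1 - \<theta> - s) / s * G"
    proof -
      have "X powr (\<theta> + s) * growth (X - s) \<le> G"
        unfolding G_def using Xs pos by (intro growth_diff_add) auto
      then have "X powr (1 - \<theta> - s) * (X powr (\<theta> + s) * growth (X - s)) \<le> X powr (1 - \<theta> - s) * G"
        by (intro mult_left_mono) auto
      moreover have "X powr (1 - \<theta> - s) * X powr (\<theta> + s) = X"
        using X1 by (simp add: powr_add[symmetric])
      ultimately have "X * growth (X - s) \<le> X powr (1 - \<theta> - s) * G" by (simp add: mult.assoc[symmetric])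
      also have "\<dots> \<le> L powr (1 - \<theta> - s) * G"
        using X1 pos G by (intro mult_right_mono powr_mono2') auto
      finally have "X * growth (X - s) \<le> L powr (1 - \<theta> - s) * G" .
      moreover have "(s * real b) * growth (X - s) \<le> X * growth (X - s)"
        using XK Xs growth_pos[of "X - s"] by (intro mult_right_mono) auto
      ultimately have "s * (real b * growth (X - s)) \<le> L powr (1 - \<theta> - s) * G" by (simp add: mult.assoc)
      then show ?thesis using pos by (simp add: field_simps)
    qed
    have "norm x ^ n * cmod (\<Sum>k\<leftarrow>removals j ls. partial_derivs k f x) \<le> norm x ^ n * (\<Sum>k\<leftarrow>removals j ls. cmod (partial_derivs k f x))"
      by (intro mult_left_mono norm_sum_list_le) auto
    also have "\<dots> = (\<Sum>k\<leftarrow>removals j ls. N k)" unfolding N_def by (simp add: sum_list_const_mult)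
    also have "\<dots> \<le> real (length (removals j ls)) * (R / h * growth (X - s))"
      by (rule sum_list_le_length_mult[OF each])
    also have "\<dots> \<le> real b * (R / h * growth (X - s))"
      using length_removals[of j ls] R pos growth_pos[OF Xs] unfolding b_def by (intro mult_right_mono) auto
    also have "\<dots> = R / h * (real b * growth (X - s))" by simp
    also have "\<dots> \<le> R / h * (L powr (1 - \<theta> - s) / s * G)" using g R pos by (intro mult_left_mono) auto
    finally show ?thesis by (simp add: mult.commute)
  qed
  have each: "N (ls @ snd q) \<le> R * (\<tau> * G)" if q: "q \<in> set ?qs" for q
  proof -
    let ?r = "length (snd q)"
    have "N (ls @ snd q) \<le> R * (h ^ ?r * growth (X + s * real ?r))"
      using Nb[of "ls @ snd q"] unfolding R_def X_def b_def by (simp add: power_add algebra_simps)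
    also have "h ^ ?r * growth (X + s * real ?r) \<le> \<tau> * G"
    proof (cases "snd q = []")
      case True
      have "X powr \<theta> * growth X \<le> G" unfolding G_def using X1 pos by (intro growth_add) auto
      then have "X powr (- \<theta>) * (X powr \<theta> * growth X) \<le> X powr (- \<theta>) * G" by (intro mult_left_mono) auto
      moreover have "X powr (- \<theta>) * X powr \<theta> = 1" using X1 by (simp add: powr_add[symmetric])
      ultimately have "growth X \<le> X powr (- \<theta>) * G" by (simp add: mult.assoc[symmetric])
      also have "\<dots> \<le> L powr (- \<theta>) * G" using X1 pos G by (intro mult_right_mono powr_mono2') auto
      also have "\<dots> \<le> \<tau> * G" using \<tau>(1) G by (intro mult_right_mono)
      finally show ?thesis using True by simp
    next
      case False
      have "0 \<le> s * real ?r" using pos by simp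
      then have X1r: "1 \<le> X + s * real ?r" using X1 by linarith
      have "growth (X + s * real ?r) \<le> G"
        unfolding G_def using X1r len[OF q] by (intro growth_mono) auto
      moreover have "growth (X + s * real ?r) \<ge> 0"
        using growth_pos[OF X1r] by simp
      ultimately show ?thesis using \<tau>(2)[OF q False] \<tau>0 by (intro mult_mono) auto
    qed
    then have "R * (h ^ ?r * growth (X + s * real ?r)) \<le> R * (\<tau> * G)" using R by (intro mult_left_mono)
    finally show ?thesis .
  qed
  have T3: "norm x ^ n * cmod (of_real t * partial_derivs ls (poly_op ?qs f) x) \<le> R * (\<bar>t\<bar> * (C * \<tau>) * G)"
  proof -
    have sm: "smooth (\<lambda>x. of_real (fst q) * (- \<i>) ^ length (snd q) * partial_derivs (snd q) f x)" for q :: "real \<times> 'd list"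
      by (intro smooth_cmult smooth_partial_derivs f)
    have "partial_derivs ls (poly_op ?qs f) x = (\<Sum>q\<leftarrow>?qs. of_real (fst q) * (- \<i>) ^ length (snd q) * partial_derivs (ls @ snd q) f x)"
      unfolding poly_op_def[abs_def] by (simp add: partial_derivs_sum_list sm partial_derivs_cmult smooth_partial_derivs f)
    then have "cmod (partial_derivs ls (poly_op ?qs f) x)
        \<le> (\<Sum>q\<leftarrow>?qs. cmod (of_real (fst q) * (- \<i>) ^ length (snd q) * partial_derivs (ls @ snd q) f x))"
      using norm_sum_list_le by simp
    also have "\<dots> = (\<Sum>q\<leftarrow>?qs. \<bar>fst q\<bar> * cmod (partial_derivs (ls @ snd q) f x))"
      by (simp add: norm_mult norm_power)
    finally have "norm x ^ n * cmod (partial_derivs ls (poly_op ?qs f) x)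
       \<le> norm x ^ n * (\<Sum>q\<leftarrow>?qs. \<bar>fst q\<bar> * cmod (partial_derivs (ls @ snd q) f x))"
      by (rule mult_left_mono) simp
    also have "\<dots> = (\<Sum>q\<leftarrow>?qs. \<bar>fst q\<bar> * N (ls @ snd q))"
      unfolding N_def sum_list_const_mult[symmetric] by (simp add: mult.left_commute)
    also have "\<dots> \<le> (\<Sum>q\<leftarrow>?qs. \<bar>fst q\<bar> * (R * (\<tau> * G)))"
      using each by (intro sum_list_mono mult_left_mono) auto
    also have "\<dots> = (\<Sum>q\<leftarrow>?qs. \<bar>fst q\<bar>) * (R * (\<tau> * G))" by (simp add: sum_list_mult_const)
    also have "\<dots> \<le> C * (R * (\<tau> * G))" using C R \<tau>0 G by (intro mult_right_mono) auto
    finally have "\<bar>t\<bar> * (norm x ^ n * cmod (partial_derivs ls (poly_op ?qs f) x)) \<le> \<bar>t\<bar> * (C * (R * (\<tau> * G)))"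
      by (rule mult_left_mono) simp
    then show ?thesis by (simp add: norm_mult mult_ac)
  qed
  have "smooth (poly_op ?qs f)"
    unfolding poly_op_def[abs_def] by (intro smooth_sum_list smooth_cmult smooth_partial_derivs f)
  then have "partial_derivs ls (evolved_coord t ps j f) x = of_real (x $ j) * partial_derivs ls f x
      + (\<Sum>k\<leftarrow>removals j ls. partial_derivs k f x) + of_real t * partial_derivs ls (poly_op ?qs f) x"
    unfolding evolved_coord_def using f
    by (simp add: partial_derivs_add smooth_coord_mult smooth_cmult partial_derivs_cmult partial_derivs_coord_mult)
  then have "norm x ^ n * cmod (partial_derivs ls (evolved_coord t ps j f) x)
     \<le> norm x ^ n * (cmod (of_real (x $ j) * partial_derivs ls f x)
        + cmod (\<Sum>k\<leftarrow>removals j ls. partial_derivs k f x) + cmod (of_real t * partial_derivs ls (poly_op ?qs f) x))"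
    by (simp only:) (intro mult_left_mono order_trans[OF norm_triangle_ineq add_right_mono[OF norm_triangle_ineq]]; simp)
  also have "\<dots> \<le> R * (h * G) + R * (L powr (1 - \<theta> - s) / (s * h) * G) + R * (\<bar>t\<bar> * (C * \<tau>) * G)"
    unfolding distrib_left by (intro add_mono T1 T2 T3)
  also have "\<dots> = M * (h + L powr (1 - \<theta> - s) / (s * h) + \<bar>t\<bar> * (C * \<tau>)) * h ^ (n + length ls)
      * growth (K + \<theta> + \<theta> * real n + s * real (length ls))"
    unfolding R_def G_def X_def b_def by (simp add: algebra_simps)
  finally show "norm x ^ n * cmod (partial_derivs ls (evolved_coord t ps j f) x)
    \<le> M * (h + L powr (1 - \<theta> - s) / (s * h) + \<bar>t\<bar> * (C * \<tau>)) * h ^ (n + length ls)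
      * growth (K + \<theta> + \<theta> * real n + s * real (length ls))" .
qed

lemma growth_bound_evolved_coords:
  fixes f :: "real ^ 'd::finite \<Rightarrow> complex" and t :: real
  assumes f: "smooth f" "growth_bound \<theta> s M h K f"
    and pos: "M \<ge> 0" "h > 0" "s > 0" "\<theta> > 0" "\<theta> + s \<ge> 1" "1 \<le> L" "L \<le> K" "\<tau> \<ge> 0" "C \<ge> 0"
    and len: "\<And>j q. q \<in> set (poly_deriv j ps) \<Longrightarrow> s * real (length (snd q)) \<le> \<theta>"
    and \<tau>: "L powr (- \<theta>) \<le> \<tau>" "\<And>j q. q \<in> set (poly_deriv j ps) \<Longrightarrow> snd q \<noteq> [] \<Longrightarrow> h ^ length (snd q) \<le> \<tau>"
    and C: "\<And>j. (\<Sum>q\<leftarrow>poly_deriv j ps. \<bar>fst q\<bar>) \<le> C"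
  defines "H \<equiv> h + L powr (1 - \<theta> - s) / (s * h) + \<bar>t\<bar> * (C * \<tau>)"
  shows "growth_bound \<theta> s (M * H ^ length js) h (K + \<theta> * real (length js)) (foldr (evolved_coord t ps) js f)"
proof (induction js)
  case Nil
  then show ?case using f by simp
next
  case (Cons j js)
  have H: "H \<ge> 0" unfolding H_def using pos by (intro add_nonneg_nonneg mult_nonneg_nonneg divide_nonneg_nonneg) auto
  have "L \<le> K + \<theta> * real (length js)"
    using pos(7) mult_nonneg_nonneg[of \<theta> "real (length js)"] pos(4) by linarith
  moreover have "smooth (foldr (evolved_coord t ps) js f)"
    by (intro schwartz_smooth schwartz_evolved_coords growth_bound_schwartz[OF f])
  ultimately have "growth_bound \<theta> s (M * H ^ length js * H) h (K + \<theta> * real (length js) + \<theta>)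
      (evolved_coord t ps j (foldr (evolved_coord t ps) js f))"
    unfolding H_def[symmetric] using Cons.IH pos H len \<tau> C unfolding H_def
    by (intro growth_bound_evolved_coord) auto
  then show ?case by (simp add: algebra_simps)
qed

text \<open>The factor of \<open>cmod_propagator_le\<close>.\<close>

definition sup_const :: "'d::finite itself \<Rightarrow> real" where
  "sup_const _ = 2 ^ (2 * CARD('d)) * (1 + real CARD('d) ^ Suc (2 * CARD('d)))
     * (fourier_const TYPE('d) * weight_integral TYPE('d))\<^sup>2"

lemma sup_const_nonneg: "sup_const TYPE('d::finite) \<ge> 0"
  unfolding sup_const_def by (intro mult_nonneg_nonneg) auto

lemma cmod_propagator_growth_le:
  fixes w :: "real ^ 'd::finite \<Rightarrow> complex"
  assumes w: "smooth w" "growth_bound \<theta> s M h K w" and pos: "M \<ge> 0" "h > 0" "K \<ge> 1" "\<theta> > 0" "s > 0"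
  shows "cmod (propagator (poly_eval ps) t w x) \<le> sup_const TYPE('d) *
    (2 ^ (2 * CARD('d)) * 2 * max 1 h ^ (4 * CARD('d)) * M * growth (K + (\<theta> + s) * real (2 * CARD('d))))"
proof -
  define N where "N = 2 * CARD('d)"
  let ?G = "growth (K + (\<theta> + s) * real N)"
  have hp: "h ^ k \<le> max 1 h ^ (2 * N)" if "k \<le> 2 * N" for k
  proof -
    have "h ^ k \<le> max 1 h ^ k" using pos by (intro power_mono) auto
    also have "\<dots> \<le> max 1 h ^ (2 * N)" using that by (intro power_increasing) auto
    finally show ?thesis .
  qed
  have tm: "norm x ^ n * cmod (partial_derivs ls w x) \<le> M * max 1 h ^ (2 * N) * ?G"
    if "n = 0 \<or> n = N" "length ls = 0 \<or> length ls = N" for n ls x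
  proof -
    have "0 \<le> \<theta> * real n" "\<theta> * real n \<le> \<theta> * real N" "0 \<le> s * real (length ls)" "s * real (length ls) \<le> s * real N"
      using that pos by auto
    then have "1 \<le> K + \<theta> * real n + s * real (length ls)"
      "K + \<theta> * real n + s * real (length ls) \<le> K + (\<theta> + s) * real N"
      using pos unfolding distrib_right by linarith+
    then have G: "growth (K + \<theta> * real n + s * real (length ls)) \<le> ?G"
      "0 \<le> growth (K + \<theta> * real n + s * real (length ls))"
      using growth_mono growth_pos less_imp_le by blast+
    have "M * h ^ (n + length ls) \<le> M * max 1 h ^ (2 * N)"
      using that pos by (intro mult_left_mono hp) auto
    then have "M * h ^ (n + length ls) * growth (K + \<theta> * real n + s * real (length ls)) \<le> M * max 1 h ^ (2 * N) * ?G"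
      by (rule mult_mono[OF _ G(1) _ G(2)]) (use pos in auto)
    then show ?thesis using growth_boundD[OF w(2), of x n ls] by (rule order_trans[rotated])
  qed
  have "(1 + norm x) ^ N * cmod (partial_derivs ls w x) \<le> 2 ^ N * 2 * max 1 h ^ (2 * N) * M * ?G"
    if "length ls = 0 \<or> length ls = N" for ls x
  proof -
    have "(1 + norm x) ^ N * cmod (partial_derivs ls w x) \<le> 2 ^ N * (1 + norm x ^ N) * cmod (partial_derivs ls w x)"
      by (intro mult_right_mono one_plus_power_le) auto
    also have "\<dots> = 2 ^ N * (norm x ^ 0 * cmod (partial_derivs ls w x) + norm x ^ N * cmod (partial_derivs ls w x))"
      by (simp add: algebra_simps)
    also have "\<dots> \<le> 2 ^ N * (M * max 1 h ^ (2 * N) * ?G + M * max 1 h ^ (2 * N) * ?G)"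
      using that by (intro mult_left_mono add_mono tm) auto
    finally show ?thesis by (simp add: algebra_simps)
  qed
  from cmod_propagator_le[OF continuous_on_poly_eval growth_bound_schwartz[OF w] this[unfolded N_def], of ps t x]
  show ?thesis unfolding sup_const_def N_def by (simp add: mult.assoc)
qed

lemma propagator_weighted_estimate:
  fixes u :: "real ^ 'd::finite \<Rightarrow> complex" and t :: real
  assumes u: "smooth u" "growth_bound \<theta> s M h K u"
    and pos: "M \<ge> 0" "h > 0" "s > 0" "\<theta> > 0" "\<theta> + s \<ge> 1" "1 \<le> L" "L \<le> K" "\<tau> \<ge> 0" "C \<ge> 0"
    and len: "\<And>j q. q \<in> set (poly_deriv j ps) \<Longrightarrow> s * real (length (snd q)) \<le> \<theta>"
    and \<tau>: "L powr (- \<theta>) \<le> \<tau>" "\<And>j q. q \<in> set (poly_deriv j ps) \<Longrightarrow> snd q \<noteq> [] \<Longrightarrow> h ^ length (snd q) \<le> \<tau>"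
    and C: "\<And>j. (\<Sum>q\<leftarrow>poly_deriv j ps. \<bar>fst q\<bar>) \<le> C"
  defines "H \<equiv> h + L powr (1 - \<theta> - s) / (s * h) + \<bar>t\<bar> * (C * \<tau>)"
  shows "\<bar>monomial as x\<bar> * cmod (partial_derivs bs (propagator (poly_eval ps) t u) x)
    \<le> sup_const TYPE('d) * (2 ^ (2 * CARD('d)) * 2 * max 1 h ^ (4 * CARD('d))) * M * max h H ^ (length as + length bs)
        * growth ((K + (\<theta> + s) * real (2 * CARD('d))) + \<theta> * real (length as) + s * real (length bs))"
proof -
  let ?a = "length as" and ?b = "length bs"
  let ?w = "foldr (evolved_coord t ps) as (partial_derivs bs u)"
  let ?G = "growth ((K + (\<theta> + s) * real (2 * CARD('d))) + \<theta> * real ?a + s * real ?b)"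
  have S: "schwartz u" by (rule growth_bound_schwartz[OF u])
  have nn: "0 \<le> s * real ?b" "0 \<le> \<theta> * real ?a" using pos by auto
  have H: "H \<ge> 0" unfolding H_def using pos by (intro add_nonneg_nonneg mult_nonneg_nonneg divide_nonneg_nonneg) auto
  have LK: "L \<le> K + s * real ?b" using pos nn by linarith
  then have K1: "1 \<le> (K + s * real ?b) + \<theta> * real ?a" using pos nn by linarith
  have "growth_bound \<theta> s ((M * h ^ ?b) * H ^ ?a) h ((K + s * real ?b) + \<theta> * real ?a) ?w"
    unfolding H_def
    using growth_bound_partial_derivs[OF u(2), of bs] pos nn LK len \<tau> C schwartz_smooth[OF schwartz_partial_derivs[OF S]]
    by (intro growth_bound_evolved_coords) auto
  moreover have "smooth ?w" by (intro schwartz_smooth schwartz_evolved_coords schwartz_partial_derivs S)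
  ultimately have est: "cmod (propagator (poly_eval ps) t ?w x) \<le> sup_const TYPE('d) *
    (2 ^ (2 * CARD('d)) * 2 * max 1 h ^ (4 * CARD('d)) * ((M * h ^ ?b) * H ^ ?a)
      * growth (((K + s * real ?b) + \<theta> * real ?a) + (\<theta> + s) * real (2 * CARD('d))))"
    using pos H nn K1 by (intro cmod_propagator_growth_le) auto
  have "of_real (monomial as x) * partial_derivs bs (propagator (poly_eval ps) t u) x = propagator (poly_eval ps) t ?w x"
    by (simp add: partial_derivs_propagator[OF continuous_on_poly_eval S] monomial_mult_propagator schwartz_partial_derivs S)
  then have "\<bar>monomial as x\<bar> * cmod (partial_derivs bs (propagator (poly_eval ps) t u) x) = cmod (propagator (poly_eval ps) t ?w x)"
    by (metis norm_mult norm_of_real)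
  also note est
  also have "((K + s * real ?b) + \<theta> * real ?a) + (\<theta> + s) * real (2 * CARD('d))
     = (K + (\<theta> + s) * real (2 * CARD('d))) + \<theta> * real ?a + s * real ?b" by simp
  also have "sup_const TYPE('d) * (2 ^ (2 * CARD('d)) * 2 * max 1 h ^ (4 * CARD('d)) * ((M * h ^ ?b) * H ^ ?a) * ?G)
    \<le> sup_const TYPE('d) * (2 ^ (2 * CARD('d)) * 2 * max 1 h ^ (4 * CARD('d)) * (M * max h H ^ (?a + ?b)) * ?G)"
  proof -
    have "h ^ ?b * H ^ ?a \<le> max h H ^ ?b * max h H ^ ?a"
      using pos H by (intro mult_mono power_mono) auto
    then have "M * h ^ ?b * H ^ ?a \<le> M * max h H ^ (?a + ?b)"
      using pos by (simp add: power_add mult.assoc mult.commute[of "max h H ^ ?b"] mult_left_mono)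
    moreover have "0 \<le> (\<theta> + s) * real (2 * CARD('d))" using pos by auto
    then have "?G \<ge> 0" using pos nn by (intro less_imp_le[OF growth_pos]) linarith
    ultimately show ?thesis
      using sup_const_nonneg[where 'd = 'd] by (intro mult_left_mono mult_right_mono) auto
  qed
  finally show ?thesis by (simp add: mult.assoc)
qed

section \<open>Gelfand--Shilov norms\<close>

lemma mi_abs_add: "mi_abs (\<lambda>j. \<alpha> j + \<beta> j) = mi_abs \<alpha> + mi_abs \<beta>"
  unfolding mi_abs_def by (rule sum.distrib)

lemma cmod_mi_D: "cmod (mi_D \<beta> f x) = cmod (mi_partial \<beta> f x)"
  unfolding mi_D_def by (simp add: norm_mult norm_power norm_divide)

lemma GS_quot_eq:
  "GS_quot \<theta> s h f (\<alpha>, \<beta>, x) = \<bar>mi_pow x \<alpha>\<bar> * cmod (mi_partial \<beta> f x) /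
     (h ^ (mi_abs \<alpha> + mi_abs \<beta>) * mi_fact \<alpha> powr \<theta> * mi_fact \<beta> powr s)"
  unfolding GS_quot_def by (simp add: norm_mult cmod_mi_D mi_abs_add)

lemma GS_denominator_pos:
  assumes "h > 0"
  shows "h ^ (mi_abs \<alpha> + mi_abs \<beta>) * mi_fact \<alpha> powr \<theta> * mi_fact \<beta> powr s > 0"
proof -
  have "mi_fact \<alpha> > 0" "mi_fact \<beta> > 0"
    using mi_fact_ge_1[of \<alpha>] mi_fact_ge_1[of \<beta>] by linarith+
  then show ?thesis using assms by simp
qed

lemma GS_quot_le_GS_norm: "f \<in> GS_step \<theta> s h \<Longrightarrow> GS_quot \<theta> s h f z \<le> GS_norm \<theta> s h f"
  unfolding GS_step_def GS_norm_def by (auto intro: cSUP_upper)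

lemma GS_quot_nonneg: "h > 0 \<Longrightarrow> GS_quot \<theta> s h f z \<ge> 0"
  using GS_denominator_pos[of h] by (cases z) (auto simp: GS_quot_eq less_imp_le)

lemma GS_norm_nonneg: "f \<in> GS_step \<theta> s h \<Longrightarrow> h > 0 \<Longrightarrow> GS_norm \<theta> s h f \<ge> 0"
  using GS_quot_nonneg GS_quot_le_GS_norm order_trans by blast

lemma GS_step_smooth: "f \<in> GS_step \<theta> s h \<Longrightarrow> smooth f"
  unfolding GS_step_def by simp

lemma GS_stepI:
  assumes "smooth f" and le: "\<And>z. GS_quot \<theta> s h f z \<le> Q"
  shows "f \<in> GS_step \<theta> s h" and "GS_norm \<theta> s h f \<le> Q"
proof -
  have "bdd_above (range (GS_quot \<theta> s h f))" using le by (intro bdd_aboveI2)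
  then show "f \<in> GS_step \<theta> s h" using assms(1) unfolding GS_step_def by simp
  show "GS_norm \<theta> s h f \<le> Q" unfolding GS_norm_def using le by (intro cSUP_least) auto
qed

lemma GS_step_bound:
  assumes "f \<in> GS_step \<theta> s h" "h > 0"
  shows "\<bar>mi_pow x \<alpha>\<bar> * cmod (mi_partial \<beta> f x)
    \<le> GS_norm \<theta> s h f * (h ^ (mi_abs \<alpha> + mi_abs \<beta>) * mi_fact \<alpha> powr \<theta> * mi_fact \<beta> powr s)"
  using GS_quot_le_GS_norm[OF assms(1), of "(\<alpha>, \<beta>, x)"]
  unfolding GS_quot_eq pos_divide_le_eq[OF GS_denominator_pos[OF assms(2)]] .

lemma GS_step_mono:
  assumes f: "f \<in> GS_step \<theta> s h" and h: "0 < h" "h \<le> k"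
  shows "f \<in> GS_step \<theta> s k" and "GS_norm \<theta> s k f \<le> GS_norm \<theta> s h f"
proof -
  have "GS_quot \<theta> s k f z \<le> GS_norm \<theta> s h f" for z
  proof -
    obtain \<alpha> \<beta> x where z: "z = (\<alpha>, \<beta>, x)" by (cases z)
    have "h ^ (mi_abs \<alpha> + mi_abs \<beta>) * mi_fact \<alpha> powr \<theta> * mi_fact \<beta> powr s
       \<le> k ^ (mi_abs \<alpha> + mi_abs \<beta>) * mi_fact \<alpha> powr \<theta> * mi_fact \<beta> powr s"
      using h by (intro mult_right_mono power_mono) auto
    then have "GS_quot \<theta> s k f z \<le> GS_quot \<theta> s h f z"
      unfolding z GS_quot_eq using GS_denominator_pos[OF h(1)]
      by (intro divide_left_mono mult_pos_pos[OF _ GS_denominator_pos[OF h(1)]]) (use h GS_denominator_pos[of k] in auto)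
    then show ?thesis using GS_quot_le_GS_norm[OF f] by (rule order_trans)
  qed
  then show "f \<in> GS_step \<theta> s k" "GS_norm \<theta> s k f \<le> GS_norm \<theta> s h f"
    using GS_stepI[OF GS_step_smooth[OF f]] by blast+
qed

lemma mi_partial_add:
  "smooth f \<Longrightarrow> smooth g \<Longrightarrow> mi_partial \<beta> (\<lambda>x. f x + g x) x = mi_partial \<beta> f x + mi_partial \<beta> g x"
  unfolding mi_partial_def by (simp add: partial_derivs_add)

lemma mi_partial_cmult: "smooth f \<Longrightarrow> mi_partial \<beta> (\<lambda>x. c * f x) x = c * mi_partial \<beta> f x"
  unfolding mi_partial_def by (simp add: partial_derivs_cmult)

lemma GS_step_add:
  assumes "f \<in> GS_step \<theta> s h" "g \<in> GS_step \<theta> s h" "h > 0"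
  shows "(\<lambda>x. f x + g x) \<in> GS_step \<theta> s h"
    and "GS_norm \<theta> s h (\<lambda>x. f x + g x) \<le> GS_norm \<theta> s h f + GS_norm \<theta> s h g"
proof -
  have sm: "smooth f" "smooth g" using assms GS_step_smooth by auto
  have "GS_quot \<theta> s h (\<lambda>x. f x + g x) z \<le> GS_norm \<theta> s h f + GS_norm \<theta> s h g" for z
  proof -
    obtain \<alpha> \<beta> x where z: "z = (\<alpha>, \<beta>, x)" by (cases z)
    have "\<bar>mi_pow x \<alpha>\<bar> * cmod (mi_partial \<beta> (\<lambda>x. f x + g x) x)
      \<le> \<bar>mi_pow x \<alpha>\<bar> * (cmod (mi_partial \<beta> f x) + cmod (mi_partial \<beta> g x))"
      unfolding mi_partial_add[OF sm] by (intro mult_left_mono norm_triangle_ineq) auto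
    then have "GS_quot \<theta> s h (\<lambda>x. f x + g x) z \<le> GS_quot \<theta> s h f z + GS_quot \<theta> s h g z"
      unfolding z GS_quot_eq add_divide_distrib[symmetric] distrib_left[symmetric]
      by (rule divide_right_mono[OF _ less_imp_le[OF GS_denominator_pos[OF assms(3)]]])
    also have "\<dots> \<le> GS_norm \<theta> s h f + GS_norm \<theta> s h g"
      by (intro add_mono GS_quot_le_GS_norm assms)
    finally show ?thesis .
  qed
  then show "(\<lambda>x. f x + g x) \<in> GS_step \<theta> s h"
    "GS_norm \<theta> s h (\<lambda>x. f x + g x) \<le> GS_norm \<theta> s h f + GS_norm \<theta> s h g"
    using GS_stepI[OF smooth_add[OF sm]] by blast+
qed

lemma GS_step_cmult:
  assumes "f \<in> GS_step \<theta> s h" "h > 0"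
  shows "(\<lambda>x. c * f x) \<in> GS_step \<theta> s h"
    and "GS_norm \<theta> s h (\<lambda>x. c * f x) = cmod c * GS_norm \<theta> s h f"
proof -
  have le: "(\<lambda>x. c * f x) \<in> GS_step \<theta> s h \<and> GS_norm \<theta> s h (\<lambda>x. c * f x) \<le> cmod c * GS_norm \<theta> s h f"
    if "f \<in> GS_step \<theta> s h" for c f
  proof -
    have sm: "smooth f" using that GS_step_smooth by auto
    have "GS_quot \<theta> s h (\<lambda>x. c * f x) z = cmod c * GS_quot \<theta> s h f z" for z
      by (cases z) (simp add: GS_quot_eq mi_partial_cmult sm norm_mult)
    then have "GS_quot \<theta> s h (\<lambda>x. c * f x) z \<le> cmod c * GS_norm \<theta> s h f" for z
      using GS_quot_le_GS_norm[OF that, of z] by (simp add: mult_left_mono)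
    then show ?thesis using GS_stepI[OF smooth_cmult[OF sm]] by blast
  qed
  show 1: "(\<lambda>x. c * f x) \<in> GS_step \<theta> s h" using le[OF assms(1)] by blast
  show "GS_norm \<theta> s h (\<lambda>x. c * f x) = cmod c * GS_norm \<theta> s h f"
  proof (cases "c = 0")
    case True
    then show ?thesis using le[OF assms(1), of 0] GS_norm_nonneg[OF 1 assms(2)] by simp
  next
    case False
    have "GS_norm \<theta> s h (\<lambda>x. (1 / c) * (c * f x)) \<le> cmod (1 / c) * GS_norm \<theta> s h (\<lambda>x. c * f x)"
      using le[OF 1] by blast
    then have "GS_norm \<theta> s h f \<le> GS_norm \<theta> s h (\<lambda>x. c * f x) / cmod c"
      using False by (simp add: norm_divide)
    then have "cmod c * GS_norm \<theta> s h f \<le> GS_norm \<theta> s h (\<lambda>x. c * f x)"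
      using False by (simp add: pos_le_divide_eq mult.commute)
    then show ?thesis using le[OF assms(1), of c] by (simp add: antisym)
  qed
qed

lemma fun_subspace_GS_step: "h > 0 \<Longrightarrow> fun_subspace (GS_step \<theta> s h)"
  unfolding fun_subspace_def by (intro conjI ballI allI GS_step_add(1) GS_step_cmult(1))

lemma seminorm_on_GS_norm: "h > 0 \<Longrightarrow> seminorm_on (GS_step \<theta> s h) (GS_norm \<theta> s h)"
  unfolding seminorm_on_def by (intro conjI ballI allI GS_norm_nonneg GS_step_add(2) GS_step_cmult(2))

lemma fun_subspace_Roumieu: "fun_subspace (Roumieu \<theta> s :: (real ^ 'd::finite \<Rightarrow> complex) set)"
  unfolding fun_subspace_def
proof (intro conjI ballI allI)
  fix f g :: "real ^ 'd \<Rightarrow> complex"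
  assume "f \<in> Roumieu \<theta> s" "g \<in> Roumieu \<theta> s"
  then obtain h k where "h > 0" "f \<in> GS_step \<theta> s h" "k > 0" "g \<in> GS_step \<theta> s k"
    unfolding Roumieu_def by auto
  then have "f \<in> GS_step \<theta> s (max h k)" "g \<in> GS_step \<theta> s (max h k)" "max h k > 0"
    using GS_step_mono(1)[of f \<theta> s h "max h k"] GS_step_mono(1)[of g \<theta> s k "max h k"] by auto
  then show "(\<lambda>x. f x + g x) \<in> Roumieu \<theta> s"
    unfolding Roumieu_def using GS_step_add(1) by blast
qed (auto simp: Roumieu_def intro: GS_step_cmult(1))

lemma fun_subspace_Beurling: "fun_subspace (Beurling \<theta> s :: (real ^ 'd::finite \<Rightarrow> complex) set)"
  unfolding fun_subspace_def
proof (intro conjI ballI allI)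
  fix f g :: "real ^ 'd \<Rightarrow> complex" and c
  assume f: "f \<in> Beurling \<theta> s"
  show "(\<lambda>x. c * f x) \<in> Beurling \<theta> s"
    using f GS_step_cmult(1)[of f \<theta> s] by (auto simp: Beurling_def)
  assume "g \<in> Beurling \<theta> s"
  then show "(\<lambda>x. f x + g x) \<in> Beurling \<theta> s"
    using f GS_step_add(1)[of f \<theta> s _ g] by (auto simp: Beurling_def)
qed

text \<open>Only powers of single coordinates enter, because \<open>\<bar>x\<bar> \<le> d max\<^sub>j \<bar>x\<^sub>j\<bar>\<close>.\<close>

lemma GS_step_growth_bound:
  assumes "\<theta> > 0" "s > 0"
  obtains c where "c > 0" and "\<And>h K (u :: real ^ 'd::finite \<Rightarrow> complex). h > 0 \<Longrightarrow> K \<ge> 1 \<Longrightarrow> u \<in> GS_step \<theta> s h \<Longrightarrow>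
    growth_bound \<theta> s (real CARD('d) * GS_norm \<theta> s h u) (c * h) K u"
proof -
  obtain c where c: "c \<ge> 1" and fg: "\<And>K a b. K \<ge> 1 \<Longrightarrow>
    fact a powr \<theta> * fact b powr s \<le> c ^ (a + b) * growth (K + \<theta> * real a + s * real b)"
    using fact_le_growth[OF assms] by metis
  let ?d = "real CARD('d)"
  have d: "?d \<ge> 1" by (simp add: Suc_le_eq)
  have "growth_bound \<theta> s (?d * GS_norm \<theta> s h u) ((?d * c) * h) K u"
    if h: "h > 0" and K: "K \<ge> 1" and u: "u \<in> GS_step \<theta> s h" for h K and u :: "real ^ 'd \<Rightarrow> complex"
    unfolding growth_bound_def
  proof (intro allI)
    fix n and ls :: "'d list" and x :: "real ^ 'd"
    let ?b = "length ls" and ?N = "GS_norm \<theta> s h u"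
    have N: "?N \<ge> 0" by (rule GS_norm_nonneg[OF u h])
    have each: "\<bar>x $ j\<bar> ^ n * cmod (partial_derivs ls u x) \<le> ?N * (h ^ (n + ?b) * fact n powr \<theta> * fact ?b powr s)" for j
    proof -
      let ?\<alpha> = "count_list (replicate n j)" and ?\<beta> = "count_list ls"
      have abs: "mi_abs ?\<alpha> = n" "mi_abs ?\<beta> = ?b"
        unfolding mi_abs_def using sum_count_set[of "replicate n j" UNIV] sum_count_set[of ls UNIV] by auto
      have "\<bar>x $ j\<bar> ^ n * cmod (partial_derivs ls u x) = \<bar>mi_pow x ?\<alpha>\<bar> * cmod (mi_partial ?\<beta> u x)"
        by (simp add: monomial_eq_mi_pow[symmetric] monomial_replicate power_abs mi_partial_count_list GS_step_smooth[OF u])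
      also have "\<dots> \<le> ?N * (h ^ (n + ?b) * mi_fact ?\<alpha> powr \<theta> * mi_fact ?\<beta> powr s)"
        using GS_step_bound[OF u h, of x ?\<alpha> ?\<beta>] unfolding abs .
      also have "\<dots> \<le> ?N * (h ^ (n + ?b) * fact n powr \<theta> * fact ?b powr s)"
        using mi_fact_le[of ?\<alpha>] mi_fact_le[of ?\<beta>] mi_fact_ge_1[of ?\<alpha>] mi_fact_ge_1[of ?\<beta>] assms N h
        unfolding abs by (intro mult_left_mono mult_mono powr_mono2) auto
      finally show ?thesis .
    qed
    have "norm x ^ n * cmod (partial_derivs ls u x) \<le> (?d ^ n * (\<Sum>j\<in>UNIV. \<bar>x $ j\<bar> ^ n)) * cmod (partial_derivs ls u x)"
      by (intro mult_right_mono norm_power_le_sum_components) auto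
    also have "\<dots> = ?d ^ n * (\<Sum>j\<in>UNIV. \<bar>x $ j\<bar> ^ n * cmod (partial_derivs ls u x))"
      by (simp add: sum_distrib_right)
    also have "\<dots> \<le> ?d ^ n * (\<Sum>j\<in>(UNIV :: 'd set). ?N * (h ^ (n + ?b) * fact n powr \<theta> * fact ?b powr s))"
      by (intro mult_left_mono sum_mono each) auto
    also have "\<dots> = ?d ^ n * (?d * ?N * h ^ (n + ?b) * (fact n powr \<theta> * fact ?b powr s))"
      by simp
    also have "\<dots> \<le> ?d ^ (n + ?b) * (?d * ?N * h ^ (n + ?b) * (c ^ (n + ?b) * growth (K + \<theta> * real n + s * real ?b)))"
    proof (rule mult_mono)
      show "?d ^ n \<le> ?d ^ (n + ?b)" using d by (intro power_increasing) auto
      show "?d * ?N * h ^ (n + ?b) * (fact n powr \<theta> * fact ?b powr s)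
        \<le> ?d * ?N * h ^ (n + ?b) * (c ^ (n + ?b) * growth (K + \<theta> * real n + s * real ?b))"
        using N h by (intro mult_left_mono fg[OF K]) auto
    qed (use N h in auto)
    finally show "norm x ^ n * cmod (partial_derivs ls u x)
       \<le> ?d * ?N * (?d * c * h) ^ (n + ?b) * growth (K + \<theta> * real n + s * real ?b)"
      by (simp add: power_mult_distrib mult_ac)
  qed
  moreover have "?d * c > 0" using c d by simp
  ultimately show ?thesis using that by blast
qed

lemma powr_fact_mi_abs_le:
  fixes \<alpha> :: "'d::finite \<Rightarrow> nat"
  assumes "0 < r" "r \<le> a"
  shows "fact (mi_abs \<alpha>) powr r \<le> ((2 ^ CARD('d)) powr a) ^ mi_abs \<alpha> * mi_fact \<alpha> powr r"
proof -
  let ?D = "2 ^ CARD('d) :: real"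
  have m: "mi_fact \<alpha> \<ge> 1" by (rule mi_fact_ge_1)
  have "fact (mi_abs \<alpha>) powr r \<le> (?D ^ mi_abs \<alpha> * mi_fact \<alpha>) powr r"
    using fact_mi_abs_le[of \<alpha>] assms by (intro powr_mono2) auto
  also have "\<dots> = (?D powr r) ^ mi_abs \<alpha> * mi_fact \<alpha> powr r"
    using m by (simp add: powr_mult powr_realpow[symmetric] powr_powr mult_ac)
  also have "\<dots> \<le> (?D powr a) ^ mi_abs \<alpha> * mi_fact \<alpha> powr r"
    using assms by (intro mult_right_mono power_mono powr_mono) auto
  finally show ?thesis .
qed

lemma GS_stepI_lists:
  fixes v :: "real ^ 'd::finite \<Rightarrow> complex"
  assumes pos: "\<theta> > 0" "s > 0" "k > 0" "Q \<ge> 0" and v: "smooth v"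
    and le: "\<And>as bs x. \<bar>monomial as x\<bar> * cmod (partial_derivs bs v x)
      \<le> Q * k ^ (length as + length bs) * fact (length as) powr \<theta> * fact (length bs) powr s"
  shows "v \<in> GS_step \<theta> s (k * (2 ^ CARD('d)) powr max \<theta> s)"
    and "GS_norm \<theta> s (k * (2 ^ CARD('d)) powr max \<theta> s) v \<le> Q"
proof -
  let ?A = "(2 ^ CARD('d)) powr max \<theta> s :: real"
  have "GS_quot \<theta> s (k * ?A) v z \<le> Q" for z
  proof -
    obtain \<alpha> \<beta> x where z: "z = (\<alpha>, \<beta>, x)" by (cases z)
    obtain as where as: "count_list as = \<alpha>" using ex_list_count[of \<alpha>] by (auto simp: fun_eq_iff)
    obtain bs where bs: "length bs = mi_abs \<beta>" "mi_partial \<beta> v = partial_derivs bs v"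
      by (rule mi_partial_obtains_list)
    have las: "length as = mi_abs \<alpha>"
      unfolding mi_abs_def as[symmetric] by (simp add: sum_count_set)
    have "\<bar>mi_pow x \<alpha>\<bar> * cmod (mi_partial \<beta> v x)
       \<le> Q * k ^ (mi_abs \<alpha> + mi_abs \<beta>) * fact (mi_abs \<alpha>) powr \<theta> * fact (mi_abs \<beta>) powr s"
      using le[of as x bs] unfolding monomial_eq_mi_pow as bs las .
    also have "\<dots> \<le> Q * k ^ (mi_abs \<alpha> + mi_abs \<beta>) * (?A ^ mi_abs \<alpha> * mi_fact \<alpha> powr \<theta>) * (?A ^ mi_abs \<beta> * mi_fact \<beta> powr s)"
      using pos by (intro mult_mono mult_left_mono powr_fact_mi_abs_le) auto
    also have "\<dots> = Q * ((k * ?A) ^ (mi_abs \<alpha> + mi_abs \<beta>) * mi_fact \<alpha> powr \<theta> * mi_fact \<beta> powr s)"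
      by (simp add: power_mult_distrib power_add mult_ac)
    finally show ?thesis
      unfolding z GS_quot_eq using GS_denominator_pos[of "k * ?A" \<alpha> \<beta> \<theta> s] pos
      by (simp add: pos_divide_le_eq)
  qed
  then show "v \<in> GS_step \<theta> s (k * ?A)" "GS_norm \<theta> s (k * ?A) v \<le> Q"
    using GS_stepI[OF v] by blast+
qed

section \<open>Continuity of the propagator\<close>

text \<open>The constants \<open>A\<close>, \<open>c\<close> and \<open>C\<close> do not depend on \<open>h\<close> and \<open>L\<close>, so that \<open>H\<close> can be made small by choosing
  first \<open>h\<close> and then \<open>L\<close>; only the operator norm \<open>D\<close> deteriorates.\<close>

lemma propagator_GS_step:
  fixes t :: real and ps :: "(real \<times> 'd::finite list) list"
  assumes pos: "\<theta> > 0" "s > 0" "\<theta> + s \<ge> 1"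
    and deg: "\<forall>q\<in>set ps. length (snd q) \<le> m" and ms: "(real m - 1) * s \<le> \<theta>" and m: "m \<ge> 1"
  obtains A c C where "A > 0" "c > 0" "C \<ge> 0"
    "\<And>h L \<tau> H. h > 0 \<Longrightarrow> L \<ge> 1 \<Longrightarrow> \<tau> \<ge> 0 \<Longrightarrow> L powr (- \<theta>) \<le> \<tau> \<Longrightarrow>
      (\<And>r. 1 \<le> r \<Longrightarrow> r < m \<Longrightarrow> (c * h) ^ r \<le> \<tau>) \<Longrightarrow>
      H = c * h + L powr (1 - \<theta> - s) / (s * (c * h)) + \<bar>t\<bar> * (C * \<tau>) \<Longrightarrow>
      \<exists>D. \<forall>u\<in>GS_step \<theta> s h. propagator (poly_eval ps) t u \<in> GS_step \<theta> s (A * H)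
        \<and> GS_norm \<theta> s (A * H) (propagator (poly_eval ps) t u) \<le> D * GS_norm \<theta> s h u"
proof -
  obtain c where c: "c > 0" and gb: "\<And>h K (u :: real ^ 'd \<Rightarrow> complex). h > 0 \<Longrightarrow> K \<ge> 1 \<Longrightarrow> u \<in> GS_step \<theta> s h \<Longrightarrow>
    growth_bound \<theta> s (real CARD('d) * GS_norm \<theta> s h u) (c * h) K u"
    using GS_step_growth_bound[OF pos(1,2), where 'd = 'd] by metis
  obtain e where e: "e \<ge> 1" and ge: "\<And>K. K \<ge> 1 \<Longrightarrow>
    \<exists>C>0. \<forall>a b. growth (K + \<theta> * real a + s * real b) \<le> C * e ^ (a + b) * fact a powr \<theta> * fact b powr s"
    using growth_le_fact[OF pos(1,2)] by metis
  define C where "C = (\<Sum>j\<in>UNIV. \<Sum>q\<leftarrow>poly_deriv j ps. \<bar>fst q\<bar>)"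
  have Cj: "(\<Sum>q\<leftarrow>poly_deriv j ps. \<bar>fst q\<bar>) \<le> C" for j
    unfolding C_def by (rule member_le_sum) (auto intro!: sum_list_nonneg)
  have C: "C \<ge> 0" unfolding C_def by (auto intro!: sum_nonneg sum_list_nonneg)
  have lt: "length (snd q) < m" if "q \<in> set (poly_deriv j ps)" for q j
    using that deg by (elim poly_deriv_cases) fastforce
  have len: "s * real (length (snd q)) \<le> \<theta>" if "q \<in> set (poly_deriv j ps)" for q j
  proof -
    have "real (length (snd q)) \<le> real m - 1" using lt[OF that] by linarith
    then have "real (length (snd q)) * s \<le> (real m - 1) * s" using pos by (intro mult_right_mono) auto
    then show ?thesis using ms by (simp add: mult.commute)
  qed
  define A where "A = e * (2 ^ CARD('d)) powr max \<theta> s"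
  have A: "A > 0" unfolding A_def using e by simp
  have main: "\<exists>D. \<forall>u\<in>GS_step \<theta> s h. propagator (poly_eval ps) t u \<in> GS_step \<theta> s (A * H)
        \<and> GS_norm \<theta> s (A * H) (propagator (poly_eval ps) t u) \<le> D * GS_norm \<theta> s h u"
    if h: "h > 0" and L: "L \<ge> 1" and \<tau>: "\<tau> \<ge> 0" "L powr (- \<theta>) \<le> \<tau>"
      "\<And>r. 1 \<le> r \<Longrightarrow> r < m \<Longrightarrow> (c * h) ^ r \<le> \<tau>"
      and H: "H = c * h + L powr (1 - \<theta> - s) / (s * (c * h)) + \<bar>t\<bar> * (C * \<tau>)" for h L \<tau> H
  proof -
    let ?K = "L + (\<theta> + s) * real (2 * CARD('d))"
    have ch: "c * h > 0" using c h by simp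
    have Hch: "H \<ge> c * h" unfolding H using pos ch C \<tau> by simp
    have "?K \<ge> 1" using L pos mult_nonneg_nonneg[of "\<theta> + s" "real (2 * CARD('d))"] by linarith
    from ge[OF this] obtain E where E: "E > 0"
      "\<And>a b. growth (?K + \<theta> * real a + s * real b) \<le> E * e ^ (a + b) * fact a powr \<theta> * fact b powr s" by blast
    define B where "B = sup_const TYPE('d) * (2 ^ (2 * CARD('d)) * 2 * max 1 (c * h) ^ (4 * CARD('d)))"
    have B: "B \<ge> 0" unfolding B_def by (intro mult_nonneg_nonneg sup_const_nonneg) auto
    have "propagator (poly_eval ps) t u \<in> GS_step \<theta> s (A * H)
        \<and> GS_norm \<theta> s (A * H) (propagator (poly_eval ps) t u) \<le> (B * real CARD('d) * E) * GS_norm \<theta> s h u"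
      if u: "u \<in> GS_step \<theta> s h" for u
    proof -
      let ?M = "real CARD('d) * GS_norm \<theta> s h u"
      have sm: "smooth u" by (rule GS_step_smooth[OF u])
      have M: "?M \<ge> 0" using GS_norm_nonneg[OF u h] by simp
      have "\<bar>monomial as x\<bar> * cmod (partial_derivs bs (propagator (poly_eval ps) t u) x)
        \<le> (B * ?M * E) * (H * e) ^ (length as + length bs) * fact (length as) powr \<theta> * fact (length bs) powr s" for as bs x
      proof -
        let ?a = "length as" and ?b = "length bs"
        have "\<bar>monomial as x\<bar> * cmod (partial_derivs bs (propagator (poly_eval ps) t u) x)
          \<le> B * ?M * max (c * h) H ^ (?a + ?b) * growth (?K + \<theta> * real ?a + s * real ?b)"
          unfolding B_def H using M ch pos L \<tau> C Cj len lt
          by (intro propagator_weighted_estimate sm gb h u order.refl)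
            (auto simp: Suc_le_eq)
        also have "max (c * h) H = H" using Hch by simp
        also have "B * ?M * H ^ (?a + ?b) * growth (?K + \<theta> * real ?a + s * real ?b)
          \<le> B * ?M * H ^ (?a + ?b) * (E * e ^ (?a + ?b) * fact ?a powr \<theta> * fact ?b powr s)"
          using B M Hch ch by (intro mult_left_mono E) auto
        finally show ?thesis by (simp add: power_mult_distrib mult_ac)
      qed
      moreover have "smooth (propagator (poly_eval ps) t u)"
        by (intro smooth_propagator continuous_on_poly_eval growth_bound_schwartz[OF sm gb[OF h L u]])
      moreover have "B * ?M * E \<ge> 0" using B M E by simp
      moreover have "H * e > 0" using Hch ch e by simp
      moreover have "H * e * (2 ^ CARD('d)) powr max \<theta> s = A * H" unfolding A_def by (simp add: mult_ac)
      moreover have "B * ?M * E = (B * real CARD('d) * E) * GS_norm \<theta> s h u" by simp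
      ultimately show ?thesis
        using GS_stepI_lists[OF pos(1,2), of "H * e" "B * ?M * E" "propagator (poly_eval ps) t u"] by metis
    qed
    then show ?thesis by blast
  qed
  show ?thesis by (rule that[OF A c C main])
qed

lemma Roumieu_schwartz:
  assumes "\<theta> > 0" "s > 0" "u \<in> Roumieu \<theta> s"
  shows "schwartz u"
proof -
  obtain h where h: "h > 0" "u \<in> GS_step \<theta> s h" using assms(3) unfolding Roumieu_def by auto
  obtain c where "growth_bound \<theta> s (real CARD('a) * GS_norm \<theta> s h u) (c * h) 1 u"
    using GS_step_growth_bound[OF assms(1,2), where 'd = 'a] h by (metis order_refl)
  then show ?thesis using growth_bound_schwartz GS_step_smooth[OF h(2)] by blast
qed

lemma Beurling_subset_Roumieu: "Beurling \<theta> s \<subseteq> Roumieu \<theta> s"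
  unfolding Beurling_def Roumieu_def by (auto intro!: exI[of _ 1])

lemma fun_linear_on_propagator:
  assumes "\<theta> > 0" "s > 0" "continuous_on UNIV p"
  shows "fun_linear_on (Roumieu \<theta> s) (propagator p t)"
  unfolding fun_linear_on_def using assms
  by (auto intro!: propagator_add Roumieu_schwartz[OF assms(1,2)] propagator_cmult)

theorem propagator_continuous_Roumieu:
  fixes p :: "real ^ 'd::finite \<Rightarrow> real"
  assumes p: "polynomial_of_degree m p" and m: "m \<ge> 1" and pos: "\<theta> > 0" "s > 0" "\<theta> + s \<ge> 1"
    and ms: "(real m - 1) * s \<le> \<theta>"
  shows "continuous_map (Roumieu_topology \<theta> s) (Roumieu_topology \<theta> s) (propagator p t)"
proof -
  obtain ps where ps: "p = poly_eval ps" "\<forall>q\<in>set ps. length (snd q) \<le> m"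
    by (rule polynomial_of_degree_poly_eval[OF p])
  obtain A c C where A: "A > 0" "c > 0" "C \<ge> 0" and est:
    "\<And>h L \<tau> H. h > 0 \<Longrightarrow> L \<ge> 1 \<Longrightarrow> \<tau> \<ge> 0 \<Longrightarrow> L powr (- \<theta>) \<le> \<tau> \<Longrightarrow>
      (\<And>r. 1 \<le> r \<Longrightarrow> r < m \<Longrightarrow> (c * h) ^ r \<le> \<tau>) \<Longrightarrow>
      H = c * h + L powr (1 - \<theta> - s) / (s * (c * h)) + \<bar>t\<bar> * (C * \<tau>) \<Longrightarrow>
      \<exists>D. \<forall>u\<in>GS_step \<theta> s h. propagator (poly_eval ps) t u \<in> GS_step \<theta> s (A * H)
        \<and> GS_norm \<theta> s (A * H) (propagator (poly_eval ps) t u) \<le> D * GS_norm \<theta> s h u"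
    by (rule propagator_GS_step[OF pos ps(2) ms m, of t]) blast
  have bound: "\<exists>k\<in>{0<..}. \<exists>D. \<forall>f\<in>GS_step \<theta> s h. propagator p t f \<in> GS_step \<theta> s k
      \<and> GS_norm \<theta> s k (propagator p t f) \<le> D * GS_norm \<theta> s h f" if h: "h \<in> {0<..}" for h
  proof -
    define \<tau> where "\<tau> = max 1 (c * h) ^ m"
    define H where "H = c * h + 1 powr (1 - \<theta> - s) / (s * (c * h)) + \<bar>t\<bar> * (C * \<tau>)"
    have \<tau>: "\<tau> \<ge> 1" unfolding \<tau>_def by (rule one_le_power) simp
    have ch: "c * h > 0" using A h by simp
    have "(c * h) ^ r \<le> \<tau>" if "r < m" for r
    proof -
      have "(c * h) ^ r \<le> max 1 (c * h) ^ r" using ch by (intro power_mono) auto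
      also have "\<dots> \<le> \<tau>" unfolding \<tau>_def using that by (intro power_increasing) auto
      finally show ?thesis .
    qed
    then have "\<exists>D. \<forall>u\<in>GS_step \<theta> s h. propagator (poly_eval ps) t u \<in> GS_step \<theta> s (A * H)
        \<and> GS_norm \<theta> s (A * H) (propagator (poly_eval ps) t u) \<le> D * GS_norm \<theta> s h u"
      using h \<tau> by (intro est[of h 1 \<tau> H]) (auto simp: H_def)
    moreover have "0 < c * h + 1 powr (1 - \<theta> - s) / (s * (c * h))"
      using ch pos by (intro add_pos_nonneg) auto
    then have "H > 0"
      unfolding H_def by (rule add_pos_nonneg) (use A \<tau> in simp)
    then have "A * H > 0" using A by simp
    ultimately show ?thesis unfolding ps(1) by blast
  qed
  have U: "(\<Union>h\<in>{0<..}. GS_step \<theta> s h) = (Roumieu \<theta> s :: (real ^ 'd \<Rightarrow> complex) set)" unfolding Roumieu_def ..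
  have "fun_linear_on (Roumieu \<theta> s) (propagator p t)"
    unfolding ps(1) by (rule fun_linear_on_propagator[OF pos(1,2) continuous_on_poly_eval])
  then show ?thesis
    unfolding Roumieu_topology_def
    by (intro continuous_map_lc_inductive_limit bound)
      (simp_all add: U fun_subspace_GS_step seminorm_on_GS_norm fun_subspace_Roumieu)
qed

lemma seminorm_on_subset: "seminorm_on E q \<Longrightarrow> F \<subseteq> E \<Longrightarrow> seminorm_on F q"
  unfolding seminorm_on_def by (simp add: subset_iff)

theorem propagator_continuous_Beurling:
  fixes p :: "real ^ 'd::finite \<Rightarrow> real"
  assumes p: "polynomial_of_degree m p" and m: "m \<ge> 1" and pos: "\<theta> > 0" "s > 0" "\<theta> + s > 1"
    and ms: "(real m - 1) * s \<le> \<theta>"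
  shows "continuous_map (Beurling_topology \<theta> s) (Beurling_topology \<theta> s) (propagator p t)"
proof -
  obtain ps where ps: "p = poly_eval ps" "\<forall>q\<in>set ps. length (snd q) \<le> m"
    by (rule polynomial_of_degree_poly_eval[OF p])
  obtain A c C where A: "A > 0" "c > 0" "C \<ge> 0" and est:
    "\<And>h L \<tau> H. h > 0 \<Longrightarrow> L \<ge> 1 \<Longrightarrow> \<tau> \<ge> 0 \<Longrightarrow> L powr (- \<theta>) \<le> \<tau> \<Longrightarrow>
      (\<And>r. 1 \<le> r \<Longrightarrow> r < m \<Longrightarrow> (c * h) ^ r \<le> \<tau>) \<Longrightarrow>
      H = c * h + L powr (1 - \<theta> - s) / (s * (c * h)) + \<bar>t\<bar> * (C * \<tau>) \<Longrightarrow>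
      \<exists>D. \<forall>u\<in>GS_step \<theta> s h. propagator (poly_eval ps) t u \<in> GS_step \<theta> s (A * H)
        \<and> GS_norm \<theta> s (A * H) (propagator (poly_eval ps) t u) \<le> D * GS_norm \<theta> s h u"
    by (rule propagator_GS_step[OF pos(1,2) less_imp_le[OF pos(3)] ps(2) ms m, of t]) blast
  have bound: "\<exists>h>0. \<exists>D. \<forall>f\<in>GS_step \<theta> s h. propagator p t f \<in> GS_step \<theta> s k
      \<and> GS_norm \<theta> s k (propagator p t f) \<le> D * GS_norm \<theta> s h f" if k: "k > 0" for k
  proof -
    \<comment> \<open>The step \<open>h\<close> and the shift \<open>L\<close> are chosen so that each term of \<open>H\<close> is at most a multiple of \<open>a\<close>.\<close>
    define a where "a = min 1 (k / (A * (2 + \<bar>t\<bar> * C)))"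
    have tC: "2 + \<bar>t\<bar> * C > 0" using A by (intro add_pos_nonneg) auto
    have a: "a > 0" "a \<le> 1" "a \<le> k / (A * (2 + \<bar>t\<bar> * C))" unfolding a_def using k A tC by auto
    define L where "L = max 1 (max (a powr (- (1 / \<theta>))) ((s * a * a) powr (- (1 / (\<theta> + s - 1)))))"
    have sa: "s * a * a > 0" using a pos by simp
    have L: "L \<ge> 1" "a powr (- (1 / \<theta>)) \<le> L" "(s * a * a) powr (- (1 / (\<theta> + s - 1))) \<le> L" unfolding L_def by auto
    have "L powr (- \<theta>) \<le> (a powr (- (1 / \<theta>))) powr (- \<theta>)"
      using L a pos by (intro powr_mono2') auto
    then have 1: "L powr (- \<theta>) \<le> a" using a pos by (simp add: powr_powr)
    have "L powr (1 - \<theta> - s) \<le> ((s * a * a) powr (- (1 / (\<theta> + s - 1)))) powr (1 - \<theta> - s)"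
      using L sa pos by (intro powr_mono2') auto
    also have "\<dots> = s * a * a"
    proof -
      have "- (1 / (\<theta> + s - 1)) * (1 - \<theta> - s) = 1" using pos by (simp add: field_simps)
      then show ?thesis using sa by (simp add: powr_powr)
    qed
    finally have 2: "L powr (1 - \<theta> - s) / (s * a) \<le> a" using a pos by (simp add: field_simps)
    define h where "h = a / c"
    have h: "h > 0" "c * h = a" unfolding h_def using a A by auto
    define H where "H = c * h + L powr (1 - \<theta> - s) / (s * (c * h)) + \<bar>t\<bar> * (C * a)"
    have "(c * h) ^ r \<le> a" if "1 \<le> r" for r
      unfolding h(2) using power_decreasing[OF that, of a] a by simp
    then obtain D where D: "\<And>u. u \<in> GS_step \<theta> s h \<Longrightarrow> propagator (poly_eval ps) t u \<in> GS_step \<theta> s (A * H)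
        \<and> GS_norm \<theta> s (A * H) (propagator (poly_eval ps) t u) \<le> D * GS_norm \<theta> s h u"
      using est[of h L a H] h L a 1 unfolding H_def by auto
    have "H \<le> a * (2 + \<bar>t\<bar> * C)" unfolding H_def h(2) using 2 by (simp add: algebra_simps)
    then have "A * H \<le> A * (a * (2 + \<bar>t\<bar> * C))" using A by (intro mult_left_mono) auto
    also have "\<dots> = a * (A * (2 + \<bar>t\<bar> * C))" by simp
    also have "\<dots> \<le> k" using a(3) A tC by (simp add: pos_le_divide_eq)
    finally have AH: "A * H \<le> k" .
    have "H \<ge> a" unfolding H_def h(2) using a pos A by simp
    then have "A * H > 0" using A a by simp
    then have "propagator p t u \<in> GS_step \<theta> s k \<and> GS_norm \<theta> s k (propagator p t u) \<le> D * GS_norm \<theta> s h u"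
      if "u \<in> GS_step \<theta> s h" for u
      using D[OF that] GS_step_mono[of "propagator p t u" \<theta> s "A * H" k] AH unfolding ps(1)
      by (meson order_trans)
    then show ?thesis using h by blast
  qed
  let ?T = "propagator p t"
  have maps: "?T f \<in> Beurling \<theta> s" if "f \<in> Beurling \<theta> s" for f
    unfolding Beurling_def
  proof
    fix k :: real assume "k \<in> {0<..}"
    then obtain h where "h > 0" "\<And>f. f \<in> GS_step \<theta> s h \<Longrightarrow> ?T f \<in> GS_step \<theta> s k" using bound[of k] by auto
    then show "?T f \<in> GS_step \<theta> s k" using that unfolding Beurling_def by auto
  qed
  have "fun_linear_on (Beurling \<theta> s) ?T"
    using fun_linear_on_subset[OF fun_linear_on_propagator[OF pos(1,2) continuous_on_poly_eval] Beurling_subset_Roumieu]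
    unfolding ps(1) .
  then show ?thesis
    unfolding Beurling_topology_def
  proof (rule continuous_map_seminorm_topology[OF fun_subspace_Beurling fun_subspace_Beurling _ maps])
    have sub: "Beurling \<theta> s \<subseteq> (GS_step \<theta> s k :: (real ^ 'd \<Rightarrow> complex) set)" if "k > 0" for k
      using that unfolding Beurling_def by auto
    show "seminorm_on (Beurling \<theta> s) q" if "q \<in> GS_norm \<theta> s ` {0<..}" for q :: "(real ^ 'd \<Rightarrow> complex) \<Rightarrow> real"
    proof -
      obtain k where k: "k > 0" "q = GS_norm \<theta> s k" using \<open>q \<in> GS_norm \<theta> s ` {0<..}\<close> by auto
      show ?thesis using seminorm_on_subset[OF seminorm_on_GS_norm[OF k(1)] sub[OF k(1)]] unfolding k(2) .
    qed
    then show "seminorm_on (Beurling \<theta> s) q" if "q \<in> GS_norm \<theta> s ` {0<..}" for q :: "(real ^ 'd \<Rightarrow> complex) \<Rightarrow> real"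
      using that by blast
    show "\<exists>p\<in>GS_norm \<theta> s ` {0<..}. \<exists>D. \<forall>f\<in>Beurling \<theta> s. q (?T f) \<le> D * p f" if q: "q \<in> GS_norm \<theta> s ` {0<..}" for q
    proof -
      obtain k where k: "k > 0" "q = GS_norm \<theta> s k" using q by auto
      obtain h D where h: "h > 0" and D: "\<And>f. f \<in> GS_step \<theta> s h \<Longrightarrow> GS_norm \<theta> s k (?T f) \<le> D * GS_norm \<theta> s h f"
        using bound[OF k(1)] by blast
      have "\<forall>f\<in>Beurling \<theta> s. q (?T f) \<le> D * GS_norm \<theta> s h f" using D sub[OF h] unfolding k(2) by blast
      then show ?thesis using h by blast
    qed
  qed
qed

section \<open>An analytic profile with prescribed decay\<close>

text \<open>The principal branch of \<open>(1 + z\<^sup>2)\<^sup>a\<close>.\<close>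

definition bracket_pow :: "real \<Rightarrow> complex \<Rightarrow> complex" where
  "bracket_pow a z = exp (of_real a * Ln (1 + z\<^sup>2))"

definition bracket_domain :: "complex set" where
  "bracket_domain = {z. 0 < Re (1 + z\<^sup>2)}"

lemma open_bracket_domain: "open bracket_domain"
  unfolding bracket_domain_def by (intro open_Collect_less continuous_intros)

lemma bracket_domainD: "z \<in> bracket_domain \<Longrightarrow> 1 + z\<^sup>2 \<notin> \<real>\<^sub>\<le>\<^sub>0"
  unfolding bracket_domain_def by (auto simp: complex_nonpos_Reals_iff)

lemma of_real_in_bracket_domain: "of_real x \<in> bracket_domain"
  unfolding bracket_domain_def by (simp add: power2_eq_square add_pos_nonneg)

lemma bracket_pow_holomorphic: "bracket_pow a holomorphic_on bracket_domain"
  unfolding bracket_pow_def[abs_def] using bracket_domainD by (intro holomorphic_intros) auto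

lemma cmod_bracket_pow:
  assumes "z \<in> bracket_domain"
  shows "cmod (bracket_pow a z) = cmod (1 + z\<^sup>2) powr a"
proof -
  have "1 + z\<^sup>2 \<noteq> 0" using bracket_domainD[OF assms] by auto
  then show ?thesis unfolding bracket_pow_def by (simp add: norm_exp_eq_Re powr_def)
qed

lemma bracket_pow_of_real: "bracket_pow a (of_real x) = of_real ((1 + x\<^sup>2) powr a)"
proof -
  have pos: "0 < 1 + x\<^sup>2" by (simp add: add_pos_nonneg)
  have "Ln (1 + (of_real x)\<^sup>2) = of_real (ln (1 + x\<^sup>2))"
    using Ln_of_real[OF pos] by simp
  then show ?thesis unfolding bracket_pow_def using pos by (simp add: powr_def exp_of_real[symmetric])
qed

lemma abs_arctan_le: "\<bar>arctan y\<bar> \<le> \<bar>y\<bar>"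
proof -
  have "norm (arctan y - arctan 0) \<le> 1 * norm (y - 0)"
  proof (rule field_differentiable_bound[of UNIV arctan "\<lambda>x. inverse (1 + x\<^sup>2)"])
    fix x :: real
    show "(arctan has_field_derivative inverse (1 + x\<^sup>2)) (at x within UNIV)"
      using DERIV_arctan by simp
    have "1 \<le> 1 + x\<^sup>2" by simp
    then show "norm (inverse (1 + x\<^sup>2)) \<le> 1" by (simp add: inverse_le_1_iff)
  qed auto
  then show ?thesis by simp
qed

text \<open>In a sufficiently thin strip around the real axis the argument of \<open>1 + z\<^sup>2\<close> is so small that
  the power keeps a positive real part.\<close>

lemma Re_bracket_pow_ge:
  assumes a: "a > 0"
  obtains \<delta> where "0 < \<delta>" "\<delta> \<le> 1 / 2"
    "\<And>z. \<bar>Im z\<bar> \<le> \<delta> \<Longrightarrow> z \<in> bracket_domain \<and> ((Re z)\<^sup>2) powr a / 2 \<le> Re (bracket_pow a z)"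
proof -
  define \<delta> where "\<delta> = min (1 / 2) (1 / (2 * a))"
  have \<delta>: "0 < \<delta>" "\<delta> \<le> 1 / 2" "2 * a * \<delta> \<le> 1" unfolding \<delta>_def using a by (auto simp: min_def field_simps)
  have "z \<in> bracket_domain \<and> ((Re z)\<^sup>2) powr a / 2 \<le> Re (bracket_pow a z)" if z: "\<bar>Im z\<bar> \<le> \<delta>" for z
  proof -
    let ?x = "Re z" and ?y = "Im z" and ?w = "1 + z\<^sup>2"
    have y2: "?y\<^sup>2 \<le> 1 / 4"
      using abs_le_square_iff[of ?y "1 / 2"] z \<delta> by (simp add: power2_eq_square)
    have Re: "Re ?w = 1 + ?x\<^sup>2 - ?y\<^sup>2" and Im: "Im ?w = 2 * ?x * ?y"
      by (simp_all add: Re_power2 Im_power2)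
    have Re_ge: "1 + ?x\<^sup>2 \<le> 2 * Re ?w" "Re ?w \<ge> ?x\<^sup>2" using Re y2 zero_le_power2[of ?x] by linarith+
    have sq: "2 * \<bar>?x\<bar> \<le> 1 + ?x\<^sup>2" using zero_le_power2[of "\<bar>?x\<bar> - 1"] by (simp add: power2_diff)
    then have pos: "Re ?w > 0" using Re_ge(1) zero_le_power2[of ?x] by linarith
    then have dom: "z \<in> bracket_domain" unfolding bracket_domain_def by simp
    have "\<bar>Im ?w\<bar> = (2 * \<bar>?x\<bar>) * \<bar>?y\<bar>" unfolding Im by (simp add: abs_mult)
    also have "\<dots> \<le> (1 + ?x\<^sup>2) * \<delta>" using sq z by (intro mult_mono) auto
    also have "\<dots> \<le> (2 * Re ?w) * \<delta>" using Re_ge(1) \<delta> by (intro mult_right_mono) auto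
    finally have "\<bar>Im ?w / Re ?w\<bar> \<le> 2 * \<delta>" using pos by (simp add: abs_divide pos_divide_le_eq mult_ac)
    moreover have w0: "?w \<noteq> 0" using pos by (metis less_irrefl zero_complex.sel(1))
    then have "Im (Ln ?w) = arctan (Im ?w / Re ?w)"
      using arg_conv_arctan[OF pos] unfolding Arg_def by simp
    ultimately have "\<bar>Im (Ln ?w)\<bar> \<le> 2 * \<delta>" using abs_arctan_le order_trans by metis
    then have "a * \<bar>Im (Ln ?w)\<bar> \<le> a * (2 * \<delta>)" using a by (intro mult_left_mono) auto
    also have "\<dots> = 2 * a * \<delta>" by simp
    also have "\<dots> \<le> 1" by (rule \<delta>(3))
    finally have "\<bar>a * Im (Ln ?w)\<bar> \<le> 1" using a by (simp add: abs_mult)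
    then have "\<bar>a * Im (Ln ?w)\<bar> \<le> pi / 3" using pi_gt3 by linarith
    then have "cos (pi / 3) \<le> cos \<bar>a * Im (Ln ?w)\<bar>" by (intro cos_monotone_0_pi_le) auto
    then have cos: "1 / 2 \<le> cos (a * Im (Ln ?w))" by (simp add: cos_60)
    have "(?x\<^sup>2) powr a \<le> cmod ?w powr a"
      using Re_ge(2) complex_Re_le_cmod[of ?w] a by (intro powr_mono2) auto
    then have "(?x\<^sup>2) powr a / 2 \<le> cmod ?w powr a * (1 / 2)" by simp
    also have "\<dots> \<le> cmod ?w powr a * cos (a * Im (Ln ?w))" using cos by (intro mult_left_mono) auto
    also have "\<dots> = Re (bracket_pow a z)"
      using w0 unfolding bracket_pow_def by (simp add: Re_exp powr_def)
    finally show ?thesis using dom by blast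
  qed
  from that[OF \<delta>(1,2) this] show ?thesis .
qed

text \<open>With \<open>v = y\<^bsup>2a\<^esup>\<close> this is the power \<open>s\<close> of the elementary inequality
  \<open>(v/(2s))\<^sup>n \<le> n! exp (v/(2s))\<close>.\<close>

lemma power_times_exp_neg_powr_le:
  fixes a y :: real
  assumes a: "a > 0" and y: "y \<ge> 0"
  defines "s \<equiv> 1 / (2 * a)"
  shows "y ^ n * exp (- ((y\<^sup>2) powr a / 2)) \<le> ((2 * s) powr s) ^ n * fact n powr s"
proof -
  have s: "s > 0" unfolding s_def using a by simp
  define v where "v = (y\<^sup>2) powr a"
  have v: "v \<ge> 0" unfolding v_def by simp
  have "(v / (2 * s)) ^ n \<le> exp (v / (2 * s)) * fact n" using v s by (intro power_le_exp_fact) auto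
  then have "(v / (2 * s)) ^ n * exp (- (v / (2 * s))) \<le> exp (v / (2 * s)) * fact n * exp (- (v / (2 * s)))"
    by (rule mult_right_mono) simp
  also have "\<dots> = fact n" by (simp add: exp_minus)
  finally have "(v / (2 * s)) ^ n * exp (- (v / (2 * s))) \<le> fact n" .
  then have "((v / (2 * s)) ^ n * exp (- (v / (2 * s)))) powr s \<le> fact n powr s"
    using v s by (intro powr_mono2) auto
  moreover have "((v / (2 * s)) ^ n * exp (- (v / (2 * s)))) powr s = ((v / (2 * s)) powr s) ^ n * exp (- (v / 2))"
  proof -
    have "((v / (2 * s)) ^ n) powr s = ((v / (2 * s)) powr s) ^ n"
    proof -
      have "(w ^ n) powr s = (w powr s) ^ n" if "w \<ge> 0" for w :: real
        using that by (induction n) (auto simp: powr_mult)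
      then show ?thesis using v s by simp
    qed
    moreover have "exp (- (v / (2 * s))) powr s = exp (- (v / 2))" using s by (simp add: powr_def field_simps)
    ultimately show ?thesis using v s by (simp add: powr_mult)
  qed
  moreover have "v powr s = y"
  proof (cases "y = 0")
    case False
    have "a * s = 1 / 2" unfolding s_def using a by simp
    have "v powr s = (y\<^sup>2) powr (1 / 2)" unfolding v_def powr_powr \<open>a * s = 1 / 2\<close> ..
    then show ?thesis using y by (simp add: powr_half_sqrt)
  qed (simp add: v_def)
  ultimately have "(y / (2 * s) powr s) ^ n * exp (- (v / 2)) \<le> fact n powr s"
    using v s by (simp add: powr_divide)
  then have "((2 * s) powr s) ^ n * ((y / (2 * s) powr s) ^ n * exp (- (v / 2))) \<le> ((2 * s) powr s) ^ n * fact n powr s"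
    by (intro mult_left_mono) auto
  moreover have "((2 * s) powr s) ^ n * (y / (2 * s) powr s) ^ n = y ^ n"
    using s by (simp add: power_mult_distrib[symmetric])
  ultimately show ?thesis unfolding v_def by (simp add: mult.assoc[symmetric])
qed

lemma shifted_power_times_exp_neg_powr_le:
  fixes a :: real
  assumes a: "a > 0"
  defines "s \<equiv> 1 / (2 * a)"
  obtains A where "A \<ge> 1" "\<And>n y. y \<ge> 0 \<Longrightarrow> (2 + y) ^ n * exp (- ((y\<^sup>2) powr a / 2)) \<le> 2 * A ^ n * fact n powr s"
proof -
  define A where "A = max 4 (2 * (2 * s) powr s)"
  have A: "A \<ge> 1" "4 \<le> A" "2 * (2 * s) powr s \<le> A" unfolding A_def by auto
  have s: "s > 0" unfolding s_def using a by simp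
  have "(2 + y) ^ n * exp (- ((y\<^sup>2) powr a / 2)) \<le> 2 * A ^ n * fact n powr s" if y: "y \<ge> 0" for n y
  proof -
    let ?E = "exp (- ((y\<^sup>2) powr a / 2))"
    have f1: "1 \<le> (fact n :: real) powr s" using s by (intro ge_one_powr_ge_zero) auto
    have E1: "?E \<le> fact n powr s" using f1 by (rule order_trans[rotated]) simp
    have "(2 + y) ^ n \<le> 4 ^ n + 2 ^ n * y ^ n"
    proof (cases "y \<le> 2")
      case True
      have "(2 + y) ^ n \<le> 4 ^ n" using True y by (intro power_mono) auto
      then show ?thesis using y by (simp add: add_increasing2)
    next
      case False
      have "(2 + y) ^ n \<le> (2 * y) ^ n" using False y by (intro power_mono) auto
      then show ?thesis using y by (simp add: add_increasing power_mult_distrib)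
    qed
    then have "(2 + y) ^ n * ?E \<le> (4 ^ n + 2 ^ n * y ^ n) * ?E" by (intro mult_right_mono) auto
    also have "\<dots> = 4 ^ n * ?E + 2 ^ n * (y ^ n * ?E)" by (simp add: algebra_simps)
    also have "\<dots> \<le> 4 ^ n * fact n powr s + 2 ^ n * (((2 * s) powr s) ^ n * fact n powr s)"
      using power_times_exp_neg_powr_le[OF a y, of n, folded s_def] f1 E1
      by (intro add_mono mult_left_mono) auto
    also have "\<dots> = 4 ^ n * fact n powr s + (2 * (2 * s) powr s) ^ n * fact n powr s"
      by (simp add: power_mult_distrib)
    also have "\<dots> \<le> A ^ n * fact n powr s + A ^ n * fact n powr s"
      using A by (intro add_mono mult_right_mono power_mono) auto
    finally show ?thesis by simp
  qed
  from that[OF A(1) this] show ?thesis .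
qed

definition profile :: "real \<Rightarrow> complex \<Rightarrow> complex" where
  "profile a z = exp (- bracket_pow a z)"

text \<open>Differentiating the inverse Fourier transform of the profile \<open>b\<close> times multiplies the profile by
  \<open>(iz)\<^sup>b\<close>.\<close>

definition profile_times :: "real \<Rightarrow> nat \<Rightarrow> complex \<Rightarrow> complex" where
  "profile_times a b z = (\<i> * z) ^ b * profile a z"

lemma profile_holomorphic: "profile a holomorphic_on bracket_domain"
  unfolding profile_def[abs_def] by (intro holomorphic_intros bracket_pow_holomorphic)

lemma profile_times_holomorphic: "profile_times a b holomorphic_on bracket_domain"
  unfolding profile_times_def[abs_def] by (intro holomorphic_intros profile_holomorphic)

text \<open>Cauchy's inequality on discs of a fixed radius \<open>\<delta>\<close> inside the strip of positivity. The factor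
  \<open>(1 + \<bar>x\<bar>)\<^sup>k\<close> is carried along to make the derivatives integrable.\<close>

lemma deriv_profile_times_bound:
  fixes a :: real
  assumes a: "a > 0"
  defines "s \<equiv> 1 / (2 * a)"
  obtains A \<delta> where "A \<ge> 1" "0 < \<delta>" "\<And>n b k x. (1 + \<bar>x\<bar>) ^ k * cmod ((deriv ^^ n) (profile_times a b) (of_real x))
     \<le> fact n / \<delta> ^ n * (2 * A ^ (b + k) * fact (b + k) powr s)"
proof -
  obtain \<delta> where \<delta>: "0 < \<delta>" "\<delta> \<le> 1 / 2"
    "\<And>z. \<bar>Im z\<bar> \<le> \<delta> \<Longrightarrow> z \<in> bracket_domain \<and> ((Re z)\<^sup>2) powr a / 2 \<le> Re (bracket_pow a z)"
    using Re_bracket_pow_ge[OF a] by metis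
  obtain A where A: "A \<ge> 1" "\<And>n y. y \<ge> 0 \<Longrightarrow> (2 + y) ^ n * exp (- ((y\<^sup>2) powr a / 2)) \<le> 2 * A ^ n * fact n powr s"
    using shifted_power_times_exp_neg_powr_le[OF a] unfolding s_def by metis
  have "(1 + \<bar>x\<bar>) ^ k * cmod ((deriv ^^ n) (profile_times a b) (of_real x))
     \<le> fact n / \<delta> ^ n * (2 * A ^ (b + k) * fact (b + k) powr s)" for n b k x
  proof -
    let ?B = "2 * A ^ (b + k) * fact (b + k) powr s"
    have near: "\<bar>Im z\<bar> \<le> \<delta>" "\<bar>Re z - x\<bar> \<le> \<delta>" if "cmod (of_real x - z) \<le> \<delta>" for z
      using that abs_Im_le_cmod[of "of_real x - z"] abs_Re_le_cmod[of "of_real x - z"] by auto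
    have sub: "cball (of_real x) \<delta> \<subseteq> bracket_domain"
      using near(1) \<delta>(3) by (auto simp: dist_norm)
    have hol: "profile_times a b holomorphic_on cball (of_real x) \<delta>"
      using profile_times_holomorphic sub by (rule holomorphic_on_subset)
    have "cmod ((deriv ^^ n) (profile_times a b) (of_real x)) \<le> fact n * (?B / (1 + \<bar>x\<bar>) ^ k) / \<delta> ^ n"
    proof (rule Cauchy_inequality)
      show "profile_times a b holomorphic_on ball (of_real x) \<delta>"
        using hol by (rule holomorphic_on_subset) auto
      show "continuous_on (cball (of_real x) \<delta>) (profile_times a b)"
        using hol by (rule holomorphic_on_imp_continuous_on)
      fix z assume "cmod (of_real x - z) = \<delta>"
      then have z: "\<bar>Im z\<bar> \<le> \<delta>" "\<bar>Re z - x\<bar> \<le> \<delta>" using near by auto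
      have x1: "1 + \<bar>x\<bar> \<le> 2 + \<bar>Re z\<bar>" "cmod z \<le> 2 + \<bar>Re z\<bar>"
        using z \<delta>(2) cmod_le[of z] by linarith+
      have "cmod (profile a z) = exp (- Re (bracket_pow a z))" unfolding profile_def by (simp add: norm_exp_eq_Re)
      also have "\<dots> \<le> exp (- ((\<bar>Re z\<bar>\<^sup>2) powr a / 2))" using \<delta>(3)[OF z(1)] by simp
      finally have p: "cmod (profile a z) \<le> exp (- ((\<bar>Re z\<bar>\<^sup>2) powr a / 2))" .
      have "(1 + \<bar>x\<bar>) ^ k * (cmod z ^ b * cmod (profile a z))
        \<le> (2 + \<bar>Re z\<bar>) ^ k * ((2 + \<bar>Re z\<bar>) ^ b * exp (- ((\<bar>Re z\<bar>\<^sup>2) powr a / 2)))"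
        using x1 p by (intro mult_mono power_mono) auto
      also have "\<dots> = (2 + \<bar>Re z\<bar>) ^ (b + k) * exp (- ((\<bar>Re z\<bar>\<^sup>2) powr a / 2))" by (simp add: power_add)
      also have "\<dots> \<le> ?B" by (rule A(2)) simp
      finally have "cmod (profile_times a b z) * (1 + \<bar>x\<bar>) ^ k \<le> ?B"
        unfolding profile_times_def by (simp add: norm_mult norm_power mult_ac)
      then show "cmod (profile_times a b z) \<le> ?B / (1 + \<bar>x\<bar>) ^ k"
        by (simp add: pos_le_divide_eq)
    qed (use \<delta> in auto)
    then have "(1 + \<bar>x\<bar>) ^ k * cmod ((deriv ^^ n) (profile_times a b) (of_real x))
      \<le> (1 + \<bar>x\<bar>) ^ k * (fact n * (?B / (1 + \<bar>x\<bar>) ^ k) / \<delta> ^ n)" by (intro mult_left_mono) auto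
    also have "\<dots> = fact n / \<delta> ^ n * ?B"
    proof -
      have "1 + \<bar>x\<bar> \<noteq> 0" using abs_ge_zero[of x] by linarith
      then show ?thesis using \<delta>(1) by (simp add: field_simps)
    qed
    finally show ?thesis .
  qed
  from that[OF A(1) \<delta>(1) this] show ?thesis .
qed

section \<open>Dimension one\<close>

text \<open>On the one-dimensional space a function of a complex variable is restricted to the real axis by
  means of the only coordinate.\<close>

definition slice :: "'d::finite \<Rightarrow> (complex \<Rightarrow> complex) \<Rightarrow> real ^ 'd \<Rightarrow> complex" where
  "slice j f x = f (of_real (x $ j))"

lemma slice_has_derivative:
  assumes "f holomorphic_on S" "open S" "\<And>r. of_real r \<in> S"
  shows "(slice j f has_derivative (\<lambda>v. deriv f (of_real (x $ j)) * of_real (v $ j))) (at x)"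
proof -
  have "((\<lambda>x. complex_of_real (x $ j)) has_derivative (\<lambda>v. of_real (v $ j))) (at x)"
    by (intro has_derivative_of_real bounded_linear.has_derivative[OF bounded_linear_vec_nth] has_derivative_ident)
  moreover have "(f has_derivative (\<lambda>h. deriv f (of_real (x $ j)) * h)) (at (of_real (x $ j)))"
    using holomorphic_derivI[OF assms(1,2,3)] by (simp add: has_field_derivative_def)
  ultimately show ?thesis unfolding slice_def by (rule has_derivative_compose)
qed

lemma partial_deriv_slice:
  assumes "f holomorphic_on S" "open S" "\<And>r. of_real r \<in> S"
  shows "partial_deriv j (slice j f) = slice j (deriv f)"
  by (subst partial_deriv_eqI[OF slice_has_derivative[OF assms]]) (simp add: slice_def fun_eq_iff)

lemma singleton_list_eq_replicate:
  assumes "(UNIV :: 'd set) = {j}"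
  shows "js = replicate (length js) (j :: 'd)"
  using assms by (intro replicate_eqI) auto

lemma partial_derivs_slice:
  assumes "f holomorphic_on S" "open S" "\<And>r. of_real r \<in> S"
  shows "partial_derivs (replicate n j) (slice j f) = slice j ((deriv ^^ n) f)"
proof (induction n)
  case (Suc n)
  then show ?case
    using partial_deriv_slice[OF holomorphic_higher_deriv[OF assms(1,2)] assms(2,3)] by simp
qed simp

lemma partial_derivs_slice_list:
  fixes j :: "'d::finite"
  assumes "f holomorphic_on S" "open S" "\<And>r. of_real r \<in> S" and j: "(UNIV :: 'd set) = {j}"
  shows "partial_derivs js (slice j f) = slice j ((deriv ^^ length js) f)"
  by (subst singleton_list_eq_replicate[OF j, of js]) (rule partial_derivs_slice[OF assms(1-3)])

lemma smooth_slice: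
  assumes "f holomorphic_on S" "open S" "\<And>r. of_real r \<in> S" and j: "(UNIV :: 'd::finite set) = {j}"
  shows "smooth (slice j f :: real ^ 'd \<Rightarrow> complex)"
  unfolding smooth_def partial_derivs_slice_list[OF assms] differentiable_def
  using slice_has_derivative[OF holomorphic_higher_deriv[OF assms(1,2)] assms(2,3)] by blast

lemma norm_eq_abs_component:
  assumes "(UNIV :: 'd::finite set) = {j}"
  shows "norm (x :: real ^ 'd) = \<bar>x $ j\<bar>"
  unfolding norm_vec_def L2_set_def assms by simp

subsection \<open>Fourier inversion\<close>

lemma integral_gaussian_eq_normal:
  fixes h :: "real \<Rightarrow> complex"
  assumes [measurable]: "h \<in> borel_measurable borel"
  shows "(LINT y|lborel. of_real (exp (- y\<^sup>2 / 2)) * h y)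
    = of_real (sqrt (2 * pi)) * (LINT y|std_normal_distribution. h y)"
proof -
  have "(LINT y|std_normal_distribution. h y) = (LINT y|lborel. std_normal_density y *\<^sub>R h y)"
    by (rule integral_density) (auto simp: normal_density_nonneg)
  also have "\<dots> = (LINT y|lborel. of_real (1 / sqrt (2 * pi)) * (of_real (exp (- y\<^sup>2 / 2)) * h y))"
    by (simp add: std_normal_density_def scaleR_conv_of_real mult_ac)
  also have "\<dots> = of_real (1 / sqrt (2 * pi)) * (LINT y|lborel. of_real (exp (- y\<^sup>2 / 2)) * h y)"
    by (rule integral_mult_right_zero)
  finally show ?thesis by (simp add: field_simps of_real_divide)
qed

text \<open>Inserting a Gaussian cut-off of width \<open>1/\<epsilon>\<close> turns the inversion integral into the average of
  \<open>f\<close> over a normal variable of standard deviation \<open>\<epsilon>\<close> centred at \<open>\<xi>\<close>.\<close>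

lemma gaussian_regularised_inversion:
  fixes f :: "real \<Rightarrow> complex"
  assumes cont: "continuous_on UNIV f" and int: "integrable lborel f" and e: "\<epsilon> > 0"
  defines "u \<equiv> \<lambda>x. LINT \<eta>|lborel. exp (\<i> * of_real (x * \<eta>)) * f \<eta>"
  assumes u: "u \<in> borel_measurable borel"
  shows "(LINT x|lborel. of_real (exp (- (\<epsilon> * x)\<^sup>2 / 2)) * (exp (- (\<i> * of_real (x * \<xi>))) * u x))
    = of_real (2 * pi) * (LINT y|std_normal_distribution. f (\<xi> + \<epsilon> * y))"
proof -
  let ?N = "std_normal_distribution"
  have f[measurable]: "f \<in> borel_measurable borel" by (rule borel_measurable_continuous_onI[OF cont])
  note u[measurable]
  interpret N: real_distribution ?N by (rule real_dist_normal_dist)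
  interpret NL: pair_sigma_finite ?N lborel ..
  have "(LINT x|lborel. of_real (exp (- (\<epsilon> * x)\<^sup>2 / 2)) * (exp (- (\<i> * of_real (x * \<xi>))) * u x))
    = of_real (1 / \<epsilon>) * (LINT y|lborel. of_real (exp (- y\<^sup>2 / 2)) * (exp (- (\<i> * of_real (y / \<epsilon> * \<xi>))) * u (y / \<epsilon>)))"
    using lborel_integral_real_affine[of "1 / \<epsilon>" "\<lambda>x. of_real (exp (- (\<epsilon> * x)\<^sup>2 / 2)) * (exp (- (\<i> * of_real (x * \<xi>))) * u x)" 0] e
    by (simp add: scaleR_conv_of_real)
  also have "(LINT y|lborel. of_real (exp (- y\<^sup>2 / 2)) * (exp (- (\<i> * of_real (y / \<epsilon> * \<xi>))) * u (y / \<epsilon>)))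
    = of_real (sqrt (2 * pi)) * (LINT y|?N. exp (- (\<i> * of_real (y / \<epsilon> * \<xi>))) * u (y / \<epsilon>))"
    by (rule integral_gaussian_eq_normal) measurable
  also have "(LINT y|?N. exp (- (\<i> * of_real (y / \<epsilon> * \<xi>))) * u (y / \<epsilon>))
    = (LINT y|?N. (LINT \<eta>|lborel. exp (\<i> * of_real ((\<eta> - \<xi>) / \<epsilon> * y)) * f \<eta>))"
  proof (rule Bochner_Integration.integral_cong[OF refl])
    fix y
    have "exp (- (\<i> * of_real (y / \<epsilon> * \<xi>))) * u (y / \<epsilon>)
      = (LINT \<eta>|lborel. exp (- (\<i> * of_real (y / \<epsilon> * \<xi>))) * (exp (\<i> * of_real (y / \<epsilon> * \<eta>)) * f \<eta>))"
      unfolding u_def by (rule integral_mult_right_zero[symmetric])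
    also have "\<dots> = (LINT \<eta>|lborel. exp (\<i> * of_real ((\<eta> - \<xi>) / \<epsilon> * y)) * f \<eta>)"
    proof (rule Bochner_Integration.integral_cong[OF refl])
      fix \<eta>
      have "- (\<i> * of_real (y / \<epsilon> * \<xi>)) + \<i> * of_real (y / \<epsilon> * \<eta>) = \<i> * complex_of_real ((\<eta> - \<xi>) / \<epsilon> * y)"
        by (simp add: algebra_simps diff_divide_distrib)
      then show "exp (- (\<i> * of_real (y / \<epsilon> * \<xi>))) * (exp (\<i> * of_real (y / \<epsilon> * \<eta>)) * f \<eta>)
        = exp (\<i> * of_real ((\<eta> - \<xi>) / \<epsilon> * y)) * f \<eta>"
        unfolding mult.assoc[symmetric] exp_add[symmetric] by simp
    qed
    finally show "exp (- (\<i> * of_real (y / \<epsilon> * \<xi>))) * u (y / \<epsilon>)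
      = (LINT \<eta>|lborel. exp (\<i> * of_real ((\<eta> - \<xi>) / \<epsilon> * y)) * f \<eta>)" .
  qed
  also have "\<dots> = (LINT \<eta>|lborel. (LINT y|?N. exp (\<i> * of_real ((\<eta> - \<xi>) / \<epsilon> * y)) * f \<eta>))"
  proof (rule NL.Fubini_integral[symmetric], rule NL.Fubini_integrable)
    show "(\<lambda>(y, \<eta>). exp (\<i> * of_real ((\<eta> - \<xi>) / \<epsilon> * y)) * f \<eta>) \<in> borel_measurable (?N \<Otimes>\<^sub>M lborel)"
      by measurable
    show "integrable ?N (\<lambda>y. LINT \<eta>|lborel. norm (case (y, \<eta>) of (y, \<eta>) \<Rightarrow> exp (\<i> * of_real ((\<eta> - \<xi>) / \<epsilon> * y)) * f \<eta>))"
      by (simp add: norm_mult)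
    show "AE y in ?N. integrable lborel (\<lambda>\<eta>. case (y, \<eta>) of (y, \<eta>) \<Rightarrow> exp (\<i> * of_real ((\<eta> - \<xi>) / \<epsilon> * y)) * f \<eta>)"
    proof (rule AE_I2)
      fix y
      show "integrable lborel (\<lambda>\<eta>. case (y, \<eta>) of (y, \<eta>) \<Rightarrow> exp (\<i> * of_real ((\<eta> - \<xi>) / \<epsilon> * y)) * f \<eta>)"
        by (rule Bochner_Integration.integrable_bound[OF int]) (auto simp: norm_mult)
    qed
  qed
  also have "\<dots> = (LINT \<eta>|lborel. of_real (exp (- ((\<eta> - \<xi>) / \<epsilon>)\<^sup>2 / 2)) * f \<eta>)"
  proof (rule Bochner_Integration.integral_cong[OF refl])
    fix \<eta>
    have "(LINT y|?N. exp (\<i> * of_real ((\<eta> - \<xi>) / \<epsilon> * y))) = of_real (exp (- ((\<eta> - \<xi>) / \<epsilon>)\<^sup>2 / 2))"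
      using fun_cong[OF char_std_normal_distribution, of "(\<eta> - \<xi>) / \<epsilon>"] unfolding char_def by simp
    then show "(LINT y|?N. exp (\<i> * of_real ((\<eta> - \<xi>) / \<epsilon> * y)) * f \<eta>) = of_real (exp (- ((\<eta> - \<xi>) / \<epsilon>)\<^sup>2 / 2)) * f \<eta>"
      by (simp only: integral_mult_left_zero)
  qed
  also have "\<dots> = of_real \<epsilon> * (LINT y|lborel. of_real (exp (- y\<^sup>2 / 2)) * f (\<xi> + \<epsilon> * y))"
    using lborel_integral_real_affine[of \<epsilon> "\<lambda>\<eta>. of_real (exp (- ((\<eta> - \<xi>) / \<epsilon>)\<^sup>2 / 2)) * f \<eta>" \<xi>] e
    by (simp add: scaleR_conv_of_real)
  also have "(LINT y|lborel. of_real (exp (- y\<^sup>2 / 2)) * f (\<xi> + \<epsilon> * y)) = of_real (sqrt (2 * pi)) * (LINT y|?N. f (\<xi> + \<epsilon> * y))"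
    by (rule integral_gaussian_eq_normal) measurable
  also have "of_real (1 / \<epsilon>) * (of_real (sqrt (2 * pi)) * (of_real \<epsilon> * (of_real (sqrt (2 * pi)) * (LINT y|?N. f (\<xi> + \<epsilon> * y)))))
    = of_real (2 * pi) * (LINT y|?N. f (\<xi> + \<epsilon> * y))"
  proof -
    have "(1 / \<epsilon>) * (sqrt (2 * pi) * (\<epsilon> * sqrt (2 * pi))) = 2 * pi" using e by simp
    then have "complex_of_real (1 / \<epsilon>) * (of_real (sqrt (2 * pi)) * (of_real \<epsilon> * of_real (sqrt (2 * pi)))) = of_real (2 * pi)"
      by (metis of_real_mult)
    then show ?thesis by (metis mult.assoc)
  qed
  finally show ?thesis .
qed

lemma fourier_inversion_real:
  fixes f :: "real \<Rightarrow> complex"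
  assumes cont: "continuous_on UNIV f" and int: "integrable lborel f" and B: "\<And>x. cmod (f x) \<le> B"
  defines "u \<equiv> \<lambda>x. LINT \<eta>|lborel. exp (\<i> * of_real (x * \<eta>)) * f \<eta>"
  assumes u: "integrable lborel u"
  shows "(LINT x|lborel. exp (- (\<i> * of_real (x * \<xi>))) * u x) = of_real (2 * pi) * f \<xi>"
proof -
  let ?N = "std_normal_distribution"
  have [measurable]: "f \<in> borel_measurable borel" by (rule borel_measurable_continuous_onI[OF cont])
  have um[measurable]: "u \<in> borel_measurable borel" using borel_measurable_integrable[OF u] by simp
  interpret N: real_distribution ?N by (rule real_dist_normal_dist)
  define \<epsilon> where "\<epsilon> = (\<lambda>n. inverse (real (Suc n)))"
  have e: "\<epsilon> n > 0" for n unfolding \<epsilon>_def by simp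
  have e0: "\<epsilon> \<longlonglongrightarrow> 0" unfolding \<epsilon>_def by (rule LIMSEQ_inverse_real_of_nat)
  have L1: "(\<lambda>n. LINT x|lborel. of_real (exp (- (\<epsilon> n * x)\<^sup>2 / 2)) * (exp (- (\<i> * of_real (x * \<xi>))) * u x))
     \<longlonglongrightarrow> (LINT x|lborel. exp (- (\<i> * of_real (x * \<xi>))) * u x)"
  proof (rule integral_dominated_convergence)
    show "integrable lborel (\<lambda>x. cmod (u x))" by (rule integrable_norm[OF u])
    show "AE x in lborel. (\<lambda>n. of_real (exp (- (\<epsilon> n * x)\<^sup>2 / 2)) * (exp (- (\<i> * of_real (x * \<xi>))) * u x))
      \<longlonglongrightarrow> exp (- (\<i> * of_real (x * \<xi>))) * u x"
    proof (rule AE_I2)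
      fix x
      have "(\<lambda>n. complex_of_real (exp (- (\<epsilon> n * x)\<^sup>2 / 2)) * (exp (- (\<i> * of_real (x * \<xi>))) * u x))
        \<longlonglongrightarrow> complex_of_real (exp (- (0 * x)\<^sup>2 / 2)) * (exp (- (\<i> * of_real (x * \<xi>))) * u x)"
        by (intro tendsto_intros e0) auto
      then show "(\<lambda>n. of_real (exp (- (\<epsilon> n * x)\<^sup>2 / 2)) * (exp (- (\<i> * of_real (x * \<xi>))) * u x))
        \<longlonglongrightarrow> exp (- (\<i> * of_real (x * \<xi>))) * u x" by simp
    qed
    show "AE x in lborel. norm (complex_of_real (exp (- (\<epsilon> n * x)\<^sup>2 / 2)) * (exp (- (\<i> * of_real (x * \<xi>))) * u x)) \<le> cmod (u x)" for n
      by (rule AE_I2) (simp add: norm_mult norm_exp_eq_Re mult_left_le_one_le)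
  qed measurable
  have eq: "(LINT x|lborel. of_real (exp (- (\<epsilon> n * x)\<^sup>2 / 2)) * (exp (- (\<i> * of_real (x * \<xi>))) * u x))
     = of_real (2 * pi) * (LINT y|?N. f (\<xi> + \<epsilon> n * y))" for n
    unfolding u_def by (rule gaussian_regularised_inversion[OF cont int e um[unfolded u_def]])
  have L2: "(\<lambda>n. of_real (2 * pi) * (LINT y|?N. f (\<xi> + \<epsilon> n * y))) \<longlonglongrightarrow> of_real (2 * pi) * (LINT y|?N. f \<xi>)"
  proof (intro tendsto_mult tendsto_const integral_dominated_convergence)
    show "integrable ?N (\<lambda>_. B)" by simp
    show "AE y in ?N. (\<lambda>n. f (\<xi> + \<epsilon> n * y)) \<longlonglongrightarrow> f \<xi>"
    proof (rule AE_I2)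
      fix y
      have "(\<lambda>n. \<xi> + \<epsilon> n * y) \<longlonglongrightarrow> \<xi> + 0 * y" by (intro tendsto_intros e0)
      then show "(\<lambda>n. f (\<xi> + \<epsilon> n * y)) \<longlonglongrightarrow> f \<xi>"
        using continuous_on_tendsto_compose[OF cont, of _ \<xi>] by auto
    qed
    show "AE y in ?N. norm (f (\<xi> + \<epsilon> n * y)) \<le> B" for n using B by (intro AE_I2)
  qed measurable
  have "N.prob UNIV = 1" using N.prob_space by simp
  then have "(LINT y|?N. f \<xi>) = f \<xi>" by simp
  with LIMSEQ_unique[OF L1[unfolded eq] L2] show ?thesis by (simp only:)
qed

lemma lborel_distr_axis:
  assumes j: "(UNIV :: 'd::finite set) = {j}"
  shows "distr lborel borel (\<lambda>r. r *\<^sub>R axis j 1 :: real ^ 'd) = lborel"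
proof (rule lborel_eqI[symmetric])
  have Basis: "(Basis :: (real ^ 'd) set) = {axis j 1}" unfolding Basis_vec_def j by simp
  fix l u :: "real ^ 'd" assume "\<And>b. b \<in> Basis \<Longrightarrow> l \<bullet> b \<le> u \<bullet> b"
  then have lu: "l $ j \<le> u $ j" unfolding Basis by (simp add: inner_axis)
  have "(\<lambda>r. r *\<^sub>R axis j 1 :: real ^ 'd) -` box l u = {l $ j<..<u $ j}"
    unfolding box_def Basis by (auto simp: inner_axis)
  then show "emeasure (distr lborel borel (\<lambda>r. r *\<^sub>R axis j 1)) (box l u) = (\<Prod>b\<in>Basis. (u - l) \<bullet> b)"
    using lu unfolding Basis by (subst emeasure_distr) (auto simp: inner_axis)
qed simp

lemma integral_axis:
  fixes f :: "real ^ 'd::finite \<Rightarrow> complex"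
  assumes j: "(UNIV :: 'd set) = {j}" and f: "f \<in> borel_measurable borel"
  shows "(LINT x|lborel. f x) = (LINT r|lborel. f (r *\<^sub>R axis j 1))"
    and "integrable lborel f \<longleftrightarrow> integrable lborel (\<lambda>r. f (r *\<^sub>R axis j 1))"
proof -
  have m: "(\<lambda>r. r *\<^sub>R axis j 1 :: real ^ 'd) \<in> measurable lborel borel" by measurable
  show "(LINT x|lborel. f x) = (LINT r|lborel. f (r *\<^sub>R axis j 1))"
    using integral_distr[OF m f] unfolding lborel_distr_axis[OF j] .
  show "integrable lborel f \<longleftrightarrow> integrable lborel (\<lambda>r. f (r *\<^sub>R axis j 1))"
    using integrable_distr_eq[OF m f] unfolding lborel_distr_axis[OF j] .
qed

lemma osc_inversion:
  fixes \<phi> :: "real ^ 'd::finite \<Rightarrow> complex"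
  assumes j: "(UNIV :: 'd set) = {j}" and r: "rapid \<phi>" "rapid (osc 1 \<phi>)"
  shows "osc (-1) (osc 1 \<phi>) \<xi> = of_real (2 * pi) * \<phi> \<xi>"
proof -
  let ?e = "axis j 1 :: real ^ 'd"
  define f where "f = (\<lambda>r. \<phi> (r *\<^sub>R ?e))"
  have inner: "(r *\<^sub>R ?e) \<bullet> x = r * x $ j" "x \<bullet> (r *\<^sub>R ?e) = r * x $ j" for r x
    by (simp_all add: inner_axis' inner_axis)
  have bm: "g \<in> borel_measurable borel" if "rapid g" for g :: "real ^ 'd \<Rightarrow> complex"
    by (rule borel_measurable_continuous_onI[OF rapid_continuous[OF that]])
  have osc: "osc \<sigma> g x = (LINT r|lborel. exp (\<i> * of_real (\<sigma> * (r * x $ j))) * g (r *\<^sub>R ?e))" if "rapid g" for \<sigma> g x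
    unfolding osc_def using integral_axis(1)[OF j bm[OF rapid_osc_integrand[OF that]]] by (simp add: inner_axis)
  have u: "osc 1 \<phi> (x *\<^sub>R ?e) = (LINT \<eta>|lborel. exp (\<i> * of_real (x * \<eta>)) * f \<eta>)" for x
    unfolding osc[OF r(1)] f_def by (simp add: mult.commute)
  obtain B where B: "\<And>x. (1 + norm x) ^ 0 * cmod (\<phi> x) \<le> B" using rapid_bound[OF r(1)] by blast
  have "(LINT x|lborel. exp (- (\<i> * of_real (x * \<xi> $ j))) * (LINT \<eta>|lborel. exp (\<i> * of_real (x * \<eta>)) * f \<eta>))
     = of_real (2 * pi) * f (\<xi> $ j)"
  proof (rule fourier_inversion_real)
    show "continuous_on UNIV f"
      unfolding f_def by (intro continuous_on_compose2[OF rapid_continuous[OF r(1)]] continuous_intros) auto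
    show "integrable lborel f"
      using integral_axis(2)[OF j bm[OF r(1)]] rapid_integrable[OF r(1)] unfolding f_def by blast
    show "cmod (f x) \<le> B" for x using B unfolding f_def by simp
    show "integrable lborel (\<lambda>x. LINT \<eta>|lborel. exp (\<i> * of_real (x * \<eta>)) * f \<eta>)"
      using integral_axis(2)[OF j bm[OF r(2)]] rapid_integrable[OF r(2)] unfolding u by blast
  qed
  moreover have "f (\<xi> $ j) = \<phi> \<xi>"
  proof -
    have "(\<xi> $ j) *\<^sub>R ?e = \<xi>" using j by (auto simp: vec_eq_iff axis_def)
    then show ?thesis unfolding f_def by simp
  qed
  ultimately show ?thesis unfolding osc[OF r(2)] u by simp
qed

lemma fourier_inverse_osc:
  fixes \<phi> :: "real ^ 'd::finite \<Rightarrow> complex"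
  assumes j: "(UNIV :: 'd set) = {j}" and r: "rapid \<phi>" "rapid (osc 1 \<phi>)"
  shows "fourier (\<lambda>x. of_real (fourier_const TYPE('d)) * osc 1 \<phi> x) = \<phi>"
proof
  fix \<xi>
  have "fourier_const TYPE('d) * fourier_const TYPE('d) * (2 * pi) = 1"
    unfolding j by (simp add: powr_add[symmetric] powr_minus_divide)
  then have "complex_of_real (fourier_const TYPE('d)) * of_real (fourier_const TYPE('d)) * of_real (2 * pi) = 1"
    by (metis of_real_1 of_real_mult)
  then show "fourier (\<lambda>x. of_real (fourier_const TYPE('d)) * osc 1 \<phi> x) \<xi> = \<phi> \<xi>"
    unfolding fourier_cmult unfolding fourier_osc osc_inversion[OF assms]
    by (metis mult.assoc mult_1)
qed

subsection \<open>The inverse Fourier transform of the profile\<close>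

lemma fact_add_2_le: "fact (b + 2) \<le> (8 * 2 ^ b) * (fact b :: real)"
proof -
  have "fact (b + 2) = real ((b + 2) choose b) * (fact b * fact 2)" by (rule fact_add_eq_binomial)
  also have "\<dots> \<le> 2 ^ (b + 2) * (fact b * fact 2)"
    using of_nat_mono[OF binomial_le_pow2[of "b + 2" b], where 'a = real] by (intro mult_right_mono) auto
  finally show ?thesis by (simp add: power_add fact_numeral)
qed

lemma fact_add_2_powr_le:
  fixes s :: real
  assumes "s > 0"
  shows "fact (b + 2) powr s \<le> 8 powr s * (2 powr s) ^ b * fact b powr s"
proof -
  have "fact (b + 2) powr s \<le> ((8 * 2 ^ b) * fact b) powr s"
    using assms fact_add_2_le by (intro powr_mono2) auto
  also have "\<dots> = 8 powr s * (2 ^ b) powr s * fact b powr s" by (simp add: powr_mult)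
  also have "(2 ^ b) powr s = ((2 :: real) powr s) ^ b" by (induction b) (auto simp: powr_mult)
  finally show ?thesis .
qed

lemma one_plus_square_le: "(1 + y)\<^sup>2 \<le> 2 * (1 + y\<^sup>2)" for y :: real
  using zero_le_power2[of "1 - y"] by (simp add: power2_sum power2_diff)

definition profile_deriv :: "'d::finite \<Rightarrow> real \<Rightarrow> nat \<Rightarrow> nat \<Rightarrow> real ^ 'd \<Rightarrow> complex" where
  "profile_deriv j a n b = slice j ((deriv ^^ n) (profile_times a b))"

lemma slice_profile: "slice j (profile a) = profile_deriv j a 0 0"
  unfolding profile_deriv_def slice_def profile_times_def by simp

lemma rapid_profile_deriv:
  assumes j: "(UNIV :: 'd::finite set) = {j}" and a: "a > 0"
  shows "rapid (profile_deriv j a n b :: real ^ 'd \<Rightarrow> complex)"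
  unfolding rapid_def profile_deriv_def
proof (intro conjI allI)
  have "smooth (slice j ((deriv ^^ n) (profile_times a b)) :: real ^ 'd \<Rightarrow> complex)"
    by (intro smooth_slice[OF _ open_bracket_domain of_real_in_bracket_domain j]
        holomorphic_higher_deriv profile_times_holomorphic open_bracket_domain)
  then show "continuous_on UNIV (slice j ((deriv ^^ n) (profile_times a b)) :: real ^ 'd \<Rightarrow> complex)"
    by (rule smooth_continuous)
  fix k
  obtain A \<delta> where "\<And>n b k x. (1 + \<bar>x\<bar>) ^ k * cmod ((deriv ^^ n) (profile_times a b) (of_real x))
     \<le> fact n / \<delta> ^ n * (2 * A ^ (b + k) * fact (b + k) powr (1 / (2 * a)))"
    using deriv_profile_times_bound[OF a] by metis
  then show "\<exists>B. \<forall>x. (1 + norm x) ^ k * cmod (slice j ((deriv ^^ n) (profile_times a b)) (x :: real ^ 'd)) \<le> B"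
    unfolding norm_eq_abs_component[OF j] slice_def by blast
qed

lemma freq_mult_profile_deriv:
  "foldr (freq_mult 1) (replicate b j) (profile_deriv j a 0 0) = profile_deriv j a 0 b"
proof (induction b)
  case (Suc b)
  then show ?case
    by (simp add: freq_mult_def profile_deriv_def slice_def profile_times_def fun_eq_iff mult_ac)
qed simp

lemma freq_mult_list_profile_deriv:
  fixes j :: "'d::finite"
  assumes j: "(UNIV :: 'd set) = {j}"
  shows "foldr (freq_mult 1) bs (profile_deriv j a 0 0) = profile_deriv j a 0 (length bs)"
  by (subst singleton_list_eq_replicate[OF j, of bs]) (rule freq_mult_profile_deriv)

lemma monomial_mult_osc_profile_deriv:
  assumes j: "(UNIV :: 'd::finite set) = {j}" and a: "a > 0"
  shows "of_real (monomial (replicate l j) x) * osc 1 (profile_deriv j a n b) (x :: real ^ 'd)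
    = \<i> ^ l * osc 1 (profile_deriv j a (n + l) b) x"
proof (induction l)
  case (Suc l)
  have step: "of_real (x $ j) * osc 1 (profile_deriv j a m b) x = \<i> * osc 1 (profile_deriv j a (Suc m) b) x" for m
  proof -
    have hol: "(deriv ^^ m) (profile_times a b) holomorphic_on bracket_domain"
      by (intro holomorphic_higher_deriv profile_times_holomorphic open_bracket_domain)
    have d: "partial_deriv j (profile_deriv j a m b) = (profile_deriv j a (Suc m) b :: real ^ 'd \<Rightarrow> complex)"
      unfolding profile_deriv_def
      using partial_deriv_slice[OF hol open_bracket_domain of_real_in_bracket_domain] by simp
    have sm: "smooth (profile_deriv j a m b :: real ^ 'd \<Rightarrow> complex)"
      unfolding profile_deriv_def by (rule smooth_slice[OF hol open_bracket_domain of_real_in_bracket_domain j])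
    have "osc 1 (profile_deriv j a (Suc m) b) x = - \<i> * of_real (1 * x $ j) * osc 1 (profile_deriv j a m b) x"
      by (rule osc_by_parts[OF rapid_profile_deriv[OF j a] rapid_profile_deriv[OF j a]
            smooth_has_vector_derivative_axis[OF sm, of _ j, unfolded d]])
    then show ?thesis by (simp add: mult.assoc)
  qed
  have "of_real (monomial (replicate (Suc l) j) x) * osc 1 (profile_deriv j a n b) x
    = of_real (x $ j) * (of_real (monomial (replicate l j) x) * osc 1 (profile_deriv j a n b) x)" by simp
  also have "\<dots> = \<i> ^ l * (of_real (x $ j) * osc 1 (profile_deriv j a (n + l) b) x)"
    unfolding Suc.IH by (rule mult.left_commute)
  finally show ?case unfolding step by (simp add: mult_ac)
qed simp

definition inverse_profile :: "'d::finite \<Rightarrow> real \<Rightarrow> real ^ 'd \<Rightarrow> complex" where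
  "inverse_profile j a x = of_real (fourier_const TYPE('d)) * osc 1 (slice j (profile a)) x"

lemma smooth_inverse_profile:
  assumes "(UNIV :: 'd::finite set) = {j}" "a > 0"
  shows "smooth (inverse_profile j a :: real ^ 'd \<Rightarrow> complex)"
  unfolding inverse_profile_def[abs_def] slice_profile
  by (intro smooth_cmult smooth_osc rapid_profile_deriv assms)

text \<open>Powers of \<open>x\<close> become derivatives of the profile, which cost \<open>a!\<close> by analyticity; derivatives become
  powers of \<open>\<xi>\<close>, which cost \<open>b!\<^sup>s\<close> against the decay \<open>exp (-\<bar>\<xi>\<bar>\<^bsup>1/s\<^esup>/2)\<close>.\<close>

lemma inverse_profile_estimate:
  assumes j: "(UNIV :: 'd::finite set) = {j}" and a: "a > 0"
  defines "s \<equiv> 1 / (2 * a)"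
  obtains Q k where "Q \<ge> 0" "k > 0"
    "\<And>as bs x. \<bar>monomial as x\<bar> * cmod (partial_derivs bs (inverse_profile j a :: real ^ 'd \<Rightarrow> complex) x)
      \<le> Q * k ^ (length as + length bs) * fact (length as) * fact (length bs) powr s"
proof -
  obtain A \<delta> where A: "A \<ge> 1" and \<delta>: "0 < \<delta>" and bd: "\<And>n b k x. (1 + \<bar>x\<bar>) ^ k * cmod ((deriv ^^ n) (profile_times a b) (of_real x))
     \<le> fact n / \<delta> ^ n * (2 * A ^ (b + k) * fact (b + k) powr s)"
    using deriv_profile_times_bound[OF a] unfolding s_def by metis
  have s: "s > 0" unfolding s_def using a by simp
  have card: "CARD('d) = 1" unfolding j by simp
  define k where "k = max (1 / \<delta>) (A * 2 powr s)"
  let ?c = "fourier_const TYPE('d)" and ?w = "weight_integral TYPE('d)"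
  define Q where "Q = ?c * ?w * (2 * A\<^sup>2 * 8 powr s)"
  have w: "?w \<ge> 0" by (rule weight_integral_nonneg)
  have Q: "Q \<ge> 0" unfolding Q_def using w A by simp
  have k: "k > 0" "1 / \<delta> \<le> k" "A * 2 powr s \<le> k" unfolding k_def using \<delta> by (auto simp: less_max_iff_disj)
  have "\<bar>monomial as x\<bar> * cmod (partial_derivs bs (inverse_profile j a) x)
      \<le> Q * k ^ (length as + length bs) * fact (length as) * fact (length bs) powr s" for as bs and x :: "real ^ 'd"
  proof -
    let ?a = "length as" and ?b = "length bs"
    let ?\<phi> = "profile_deriv j a ?a ?b :: real ^ 'd \<Rightarrow> complex"
    let ?B = "fact ?a / \<delta> ^ ?a * (2 * A ^ (?b + 2) * fact (?b + 2) powr s)"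
    have r: "rapid (profile_deriv j a n b :: real ^ 'd \<Rightarrow> complex)" for n b by (rule rapid_profile_deriv[OF j a])
    have "partial_derivs bs (inverse_profile j a) x = of_real ?c * osc 1 (profile_deriv j a 0 ?b) x"
      unfolding inverse_profile_def[abs_def] slice_profile
      by (simp add: partial_derivs_cmult smooth_osc r partial_derivs_osc freq_mult_list_profile_deriv[OF j])
    then have "of_real (monomial as x) * partial_derivs bs (inverse_profile j a) x
       = of_real ?c * (of_real (monomial (replicate ?a j) x) * osc 1 (profile_deriv j a 0 ?b) x)"
      using singleton_list_eq_replicate[OF j, of as] by (metis mult.left_commute)
    also have "\<dots> = of_real ?c * (\<i> ^ ?a * osc 1 ?\<phi> x)"
      unfolding monomial_mult_osc_profile_deriv[OF j a] by simp
    finally have "cmod (of_real (monomial as x) * partial_derivs bs (inverse_profile j a) x) = ?c * cmod (osc 1 ?\<phi> x)"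
      by (simp add: norm_mult norm_power)
    then have eq: "\<bar>monomial as x\<bar> * cmod (partial_derivs bs (inverse_profile j a) x) = ?c * cmod (osc 1 ?\<phi> x)"
      by (simp only: norm_mult norm_of_real)
    have le: "cmod (osc 1 ?\<phi> x) \<le> ?B * ?w"
    proof (rule order_trans[OF cmod_osc_le weighted_bound_integral(2)])
      show "continuous_on UNIV ?\<phi>" by (rule rapid_continuous[OF r])
      show "(1 + norm x) ^ (2 * CARD('d)) * cmod (?\<phi> x) \<le> ?B" for x
        using bd[of "x $ j" 2 ?a ?b] unfolding norm_eq_abs_component[OF j] profile_deriv_def slice_def card by simp
    qed
    have "\<bar>monomial as x\<bar> * cmod (partial_derivs bs (inverse_profile j a) x) \<le> ?c * (?B * ?w)"
      unfolding eq by (rule mult_left_mono[OF le]) simp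
    also have "\<dots> = ?c * ?w * (2 * A\<^sup>2) * ((1 / \<delta>) ^ ?a * fact ?a) * (A ^ ?b * fact (?b + 2) powr s)"
      by (simp add: power_add power_divide power2_eq_square)
    also have "\<dots> \<le> ?c * ?w * (2 * A\<^sup>2) * (k ^ ?a * fact ?a) * (A ^ ?b * (8 powr s * (2 powr s) ^ ?b * fact ?b powr s))"
      using k \<delta> A w s by (intro mult_mono mult_left_mono mult_right_mono power_mono fact_add_2_powr_le) auto
    also have "\<dots> = Q * (k ^ ?a * fact ?a) * ((A * 2 powr s) ^ ?b * fact ?b powr s)"
      unfolding Q_def by (simp add: power_mult_distrib mult_ac)
    also have "\<dots> \<le> Q * (k ^ ?a * fact ?a) * (k ^ ?b * fact ?b powr s)"
      using k A Q by (intro mult_left_mono mult_right_mono power_mono) auto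
    finally show ?thesis by (simp add: power_add mult_ac)
  qed
  from that[OF Q k(1) this] show ?thesis .
qed

lemma inverse_profile_Roumieu:
  assumes j: "(UNIV :: 'd::finite set) = {j}" and "s > 0" "\<theta> \<ge> 1"
  shows "(inverse_profile j (1 / (2 * s)) :: real ^ 'd \<Rightarrow> complex) \<in> Roumieu \<theta> s"
proof -
  let ?a = "1 / (2 * s)"
  have a: "?a > 0" "1 / (2 * ?a) = s" using assms by auto
  obtain Q k where Qk: "Q \<ge> 0" "k > 0" and le: "\<And>as bs x. \<bar>monomial as x\<bar> * cmod (partial_derivs bs (inverse_profile j ?a :: real ^ 'd \<Rightarrow> complex) x)
      \<le> Q * k ^ (length as + length bs) * fact (length as) * fact (length bs) powr s"
    using inverse_profile_estimate[OF j a(1)] unfolding a(2) by metis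
  have "\<bar>monomial as x\<bar> * cmod (partial_derivs bs (inverse_profile j ?a) x)
      \<le> Q * k ^ (length as + length bs) * fact (length as) powr \<theta> * fact (length bs) powr s" for as bs and x :: "real ^ 'd"
  proof -
    have "(fact (length as) :: real) powr 1 \<le> fact (length as) powr \<theta>" using assms by (intro powr_mono) auto
    then have "(fact (length as) :: real) \<le> fact (length as) powr \<theta>" by simp
    then show ?thesis
      using Qk by (intro order_trans[OF le] mult_right_mono mult_left_mono) auto
  qed
  from GS_stepI_lists(1)[OF _ assms(2) Qk(2,1) smooth_inverse_profile[OF j a(1)] this] assms(3) Qk(2)
  show ?thesis unfolding Roumieu_def by auto
qed

lemma power_le_fact_powr:
  fixes c \<epsilon> :: real
  assumes "c > 0" "\<epsilon> > 0"
  obtains C where "C > 0" "\<And>n. c ^ n \<le> C * fact n powr \<epsilon>"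
proof -
  define w where "w = c powr (1 / \<epsilon>)"
  have "c ^ n \<le> exp w powr \<epsilon> * fact n powr \<epsilon>" for n
  proof -
    have "(w ^ n) powr \<epsilon> \<le> (exp w * fact n) powr \<epsilon>"
      using assms power_le_exp_fact[of w n] unfolding w_def by (intro powr_mono2) auto
    moreover have "(w ^ n) powr \<epsilon> = (w powr \<epsilon>) ^ n" by (induction n) (auto simp: powr_mult w_def)
    moreover have "w powr \<epsilon> = c" unfolding w_def using assms by (simp add: powr_powr)
    ultimately show ?thesis by (simp add: powr_mult)
  qed
  from that[OF _ this] show ?thesis by simp
qed

text \<open>The slack in both indices turns the geometric factors \<open>(k/h)\<^sup>n\<close> into constants.\<close>

lemma inverse_profile_Beurling:
  assumes j: "(UNIV :: 'd::finite set) = {j}" and "0 < r" "r < s" "\<theta> > 1"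
  shows "(inverse_profile j (1 / (2 * r)) :: real ^ 'd \<Rightarrow> complex) \<in> Beurling \<theta> s"
  unfolding Beurling_def
proof
  fix h :: real assume "h \<in> {0<..}"
  then have h: "h > 0" by simp
  let ?a = "1 / (2 * r)" and ?D = "(2 ^ CARD('d)) powr max \<theta> s :: real"
  define h' where "h' = h / ?D"
  have h': "h' > 0" "h' * ?D = h" unfolding h'_def using h by auto
  have a: "?a > 0" "1 / (2 * ?a) = r" using assms by auto
  obtain Q k where Qk: "Q \<ge> 0" "k > 0" and le: "\<And>as bs x. \<bar>monomial as x\<bar> * cmod (partial_derivs bs (inverse_profile j ?a :: real ^ 'd \<Rightarrow> complex) x)
      \<le> Q * k ^ (length as + length bs) * fact (length as) * fact (length bs) powr r"
    using inverse_profile_estimate[OF j a(1)] unfolding a(2) by metis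
  have kh: "k / h' > 0" using Qk h' by simp
  obtain C1 where C1: "C1 > 0" "\<And>n. (k / h') ^ n \<le> C1 * fact n powr (\<theta> - 1)"
    using power_le_fact_powr[OF kh, of "\<theta> - 1"] assms by auto
  obtain C2 where C2: "C2 > 0" "\<And>n. (k / h') ^ n \<le> C2 * fact n powr (s - r)"
    using power_le_fact_powr[OF kh, of "s - r"] assms by auto
  have "\<bar>monomial as x\<bar> * cmod (partial_derivs bs (inverse_profile j ?a) x)
      \<le> (Q * C1 * C2) * h' ^ (length as + length bs) * fact (length as) powr \<theta> * fact (length bs) powr s" for as bs and x :: "real ^ 'd"
  proof -
    let ?m = "length as" and ?n = "length bs"
    have "Q * k ^ (?m + ?n) * fact ?m * fact ?n powr r
      = Q * h' ^ (?m + ?n) * ((k / h') ^ ?m * fact ?m) * ((k / h') ^ ?n * fact ?n powr r)"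
      using h' by (simp add: power_add power_divide)
    also have "\<dots> \<le> Q * h' ^ (?m + ?n) * ((C1 * fact ?m powr (\<theta> - 1)) * fact ?m) * ((C2 * fact ?n powr (s - r)) * fact ?n powr r)"
      using Qk h' C1 C2 kh by (intro mult_mono mult_left_mono mult_right_mono C1 C2) auto
    also have "\<dots> = (Q * C1 * C2) * h' ^ (?m + ?n) * (fact ?m powr (\<theta> - 1) * fact ?m powr 1) * (fact ?n powr (s - r) * fact ?n powr r)"
      by simp
    also have "\<dots> = (Q * C1 * C2) * h' ^ (?m + ?n) * fact ?m powr \<theta> * fact ?n powr s"
      unfolding powr_add[symmetric] by simp
    finally show ?thesis by (rule order_trans[OF le])
  qed
  from GS_stepI_lists(1)[OF _ _ h'(1) _ smooth_inverse_profile[OF j a(1)] this] assms Qk C1 C2 h'(2)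
  show "inverse_profile j ?a \<in> GS_step \<theta> s h" by simp
qed

section \<open>A lower bound for the derivatives of an exponential\<close>

lemma higher_deriv_exp_affine:
  "(deriv ^^ n) (\<lambda>z. exp (c + l * (z - x))) = (\<lambda>z. l ^ n * exp (c + l * (z - x)))" for c l x :: complex
proof (induction n)
  case (Suc n)
  have "deriv (\<lambda>z. l ^ n * exp (c + l * (z - x))) z = l ^ Suc n * exp (c + l * (z - x))" for z
    by (rule DERIV_imp_deriv) (auto intro!: derivative_eq_intros)
  then show ?case by (simp only: funpow.simps o_apply Suc.IH)
qed simp

lemma sum_tenth_powers_le: "(\<Sum>i<n. (1 / 10 :: real) ^ (n - i)) \<le> 1 / 9"
proof (induction n)
  case (Suc n)
  have "(\<Sum>i<Suc n. (1 / 10 :: real) ^ (Suc n - i)) = (\<Sum>i<n. (1 / 10) * (1 / 10) ^ (n - i)) + 1 / 10"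
    by (simp add: Suc_diff_le)
  also have "\<dots> = (1 / 10) * (\<Sum>i<n. (1 / 10) ^ (n - i)) + 1 / 10" by (simp only: sum_distrib_left)
  also have "\<dots> \<le> (1 / 10) * (1 / 9) + 1 / 10" by (intro add_right_mono mult_left_mono Suc.IH) auto
  finally show ?case by simp
qed simp

text \<open>On a disc where the second derivative of \<open>\<Psi>\<close> is harmless, \<open>exp \<Psi>\<close> is its first order
  approximation \<open>exp (\<Psi> x + \<Psi>' x (z - x))\<close> times a factor that Cauchy's inequality controls. If the
  order \<open>n\<close> is small compared with the number of oscillations across the disc, the Leibniz formula is
  dominated by the term in which all derivatives fall on the linear exponential.\<close>

lemma higher_deriv_exp_lower_bound:
  fixes \<Psi> :: "complex \<Rightarrow> complex"
  assumes hol: "\<Psi> holomorphic_on ball x R" and \<rho>: "0 < \<rho>" "\<rho> < R"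
    and B: "\<And>z. z \<in> ball x R \<Longrightarrow> cmod (deriv (deriv \<Psi>) z) \<le> B" "B * \<rho>\<^sup>2 \<le> 1"
    and n: "10 * real n \<le> \<rho> * cmod (deriv \<Psi> x)" and pos: "deriv \<Psi> x \<noteq> 0"
  shows "cmod ((deriv ^^ n) (\<lambda>z. exp (\<Psi> z)) x) \<ge> cmod (deriv \<Psi> x) ^ n * cmod (exp (\<Psi> x)) / 2"
proof -
  define l where "l = deriv \<Psi> x"
  define r where "r = (\<lambda>z. \<Psi> z - (\<Psi> x + l * (z - x)))"
  let ?f = "\<lambda>z. exp (\<Psi> x + l * (z - x))" and ?g = "\<lambda>z. exp (r z)"
  let ?L = "cmod l" and ?E = "cmod (exp (\<Psi> x))"
  have L: "?L > 0" unfolding l_def using pos by simp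
  have R: "R > 0" using \<rho> by linarith
  then have x: "x \<in> ball x R" by simp
  have d1: "deriv \<Psi> holomorphic_on ball x R" using hol by (intro holomorphic_deriv) auto
  have rB: "cmod (r z) \<le> B * cmod (z - x) ^ 2" if z: "z \<in> ball x R" for z
  proof -
    define F where "F = (\<lambda>i::nat. (deriv ^^ i) \<Psi>)"
    have "cmod (F 0 z - (\<Sum>i\<le>1. F i x * (z - x) ^ i / fact i)) \<le> B * cmod (z - x) ^ Suc 1 / fact 1"
    proof (rule complex_Taylor[of "ball x R"])
      fix i :: nat and y assume y: "y \<in> ball x R" and "i \<le> 1"
      have "F i holomorphic_on ball x R" unfolding F_def by (intro holomorphic_higher_deriv hol) auto
      from holomorphic_derivI[OF this _ y] have "(F i has_field_derivative deriv (F i) y) (at y)" by simp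
      then show "(F i has_field_derivative F (Suc i) y) (at y within ball x R)"
        unfolding F_def by (simp add: has_field_derivative_at_within)
    next
      fix y assume "y \<in> ball x R"
      then show "cmod (F (Suc 1) y) \<le> B" unfolding F_def using B(1) by simp
    qed (use z x in auto)
    then show ?thesis unfolding F_def r_def l_def by (simp add: power2_eq_square)
  qed
  have rhol: "r holomorphic_on ball x R"
    unfolding r_def by (intro holomorphic_intros hol)
  have g: "cmod ((deriv ^^ k) ?g x) \<le> fact k * 3 / \<rho> ^ k" for k
  proof (rule Cauchy_inequality)
    have sub: "cball x \<rho> \<subseteq> ball x R" using \<rho> by (intro subsetI) simp
    show "?g holomorphic_on ball x \<rho>"
      by (intro holomorphic_intros holomorphic_on_subset[OF rhol]) (use sub in auto)
    show "continuous_on (cball x \<rho>) ?g"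
      by (intro continuous_intros holomorphic_on_imp_continuous_on holomorphic_on_subset[OF rhol sub])
    fix z assume z: "cmod (x - z) = \<rho>"
    then have zb: "z \<in> ball x R" using \<rho> by (simp add: dist_norm)
    have "cmod (r z) \<le> 1" using rB[OF zb] B(2) z by (simp add: norm_minus_commute)
    then have "Re (r z) \<le> 1" using complex_Re_le_cmod[of "r z"] by linarith
    then have "cmod (?g z) \<le> exp 1" by (simp add: norm_exp_eq_Re)
    also have "\<dots> \<le> 3" by (rule exp_le)
    finally show "cmod (?g z) \<le> 3" .
  qed (use \<rho> in auto)
  have split: "(\<lambda>z. exp (\<Psi> z)) = (\<lambda>z. ?f z * ?g z)"
    unfolding r_def by (simp add: exp_add[symmetric])
  have gx: "?g x = 1" unfolding r_def by simp
  let ?t = "\<lambda>i. of_nat (n choose i) * (deriv ^^ i) ?f x * (deriv ^^ (n - i)) ?g x"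
  have "(deriv ^^ n) (\<lambda>z. exp (\<Psi> z)) x = (\<Sum>i = 0..n. ?t i)"
    unfolding split
    by (rule higher_deriv_mult[of _ "ball x R"]) (auto intro!: holomorphic_intros rhol R)
  also have "\<dots> = (\<Sum>i<n. ?t i) + ?t n"
    by (simp add: atLeast0AtMost lessThan_Suc_atMost[symmetric])
  finally have sum: "(deriv ^^ n) (\<lambda>z. exp (\<Psi> z)) x = (\<Sum>i<n. ?t i) + l ^ n * exp (\<Psi> x)"
    using gx by (simp add: higher_deriv_exp_affine)
  have each: "cmod (?t i) \<le> ?L ^ n * ?E * 3 * (1 / 10) ^ (n - i)" if i: "i < n" for i
  proof -
    let ?k = "n - i"
    have "real (n choose i) * fact ?k \<le> real n ^ ?k"
    proof -
      have "(n choose i) * fact ?k \<le> n ^ ?k"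
        using binomial_fact_pow[of n ?k] binomial_symmetric[of i n] i by simp
      then have "real ((n choose i) * fact ?k) \<le> real (n ^ ?k)" by (simp only: of_nat_le_iff)
      then show ?thesis by simp
    qed
    then have c: "real (n choose i) * fact ?k * (3 / \<rho> ^ ?k) \<le> real n ^ ?k * (3 / \<rho> ^ ?k)"
      using \<rho> by (intro mult_right_mono) auto
    have q: "real n / (\<rho> * ?L) \<le> 1 / 10"
      using n \<rho> L unfolding l_def[symmetric] by (simp add: pos_divide_le_eq)
    have "cmod (?t i) = real (n choose i) * (?L ^ i * ?E) * cmod ((deriv ^^ ?k) ?g x)"
      by (simp add: higher_deriv_exp_affine norm_mult norm_power)
    also have "\<dots> \<le> real (n choose i) * (?L ^ i * ?E) * (fact ?k * 3 / \<rho> ^ ?k)"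
      by (intro mult_left_mono g) auto
    also have "\<dots> = (?L ^ i * ?E) * (real (n choose i) * fact ?k * (3 / \<rho> ^ ?k))" by simp
    also have "\<dots> \<le> (?L ^ i * ?E) * (real n ^ ?k * (3 / \<rho> ^ ?k))"
      by (intro mult_left_mono c) auto
    also have "\<dots> = (?L ^ i * ?L ^ ?k) * ?E * 3 * (real n / (\<rho> * ?L)) ^ ?k"
      using L by (simp add: power_divide power_mult_distrib)
    also have "?L ^ i * ?L ^ ?k = ?L ^ n" using i by (simp add: power_add[symmetric])
    also have "?L ^ n * ?E * 3 * (real n / (\<rho> * ?L)) ^ ?k \<le> ?L ^ n * ?E * 3 * (1 / 10) ^ ?k"
      using q \<rho> L by (intro mult_left_mono power_mono) auto
    finally show ?thesis .
  qed
  have "cmod (\<Sum>i<n. ?t i) \<le> (\<Sum>i<n. ?L ^ n * ?E * 3 * (1 / 10) ^ (n - i))"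
    by (intro order_trans[OF norm_sum] sum_mono each) auto
  also have "\<dots> = ?L ^ n * ?E * 3 * (\<Sum>i<n. (1 / 10) ^ (n - i))" by (simp only: sum_distrib_left)
  also have "\<dots> \<le> ?L ^ n * ?E * 3 * (1 / 9)"
    by (intro mult_left_mono sum_tenth_powers_le) auto
  finally have small: "cmod (\<Sum>i<n. ?t i) \<le> ?L ^ n * ?E / 3" by simp
  have "cmod (l ^ n * exp (\<Psi> x)) \<le> cmod ((\<Sum>i<n. ?t i) + l ^ n * exp (\<Psi> x)) + cmod (\<Sum>i<n. ?t i)"
    using norm_triangle_ineq4[of "(\<Sum>i<n. ?t i) + l ^ n * exp (\<Psi> x)" "\<Sum>i<n. ?t i"] by simp
  then have "?L ^ n * ?E \<le> cmod ((deriv ^^ n) (\<lambda>z. exp (\<Psi> z)) x) + ?L ^ n * ?E / 3"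
    using small unfolding sum by (simp add: norm_mult norm_power)
  moreover have "0 \<le> ?L ^ n * ?E" by simp
  ultimately show ?thesis unfolding l_def by linarith
qed

section \<open>Polynomials in one variable\<close>

lemma polynomial_of_degree_one_dim:
  fixes p :: "real ^ 'd::finite \<Rightarrow> real"
  assumes "polynomial_of_degree m p" and j: "(UNIV :: 'd set) = {j}"
  obtains c where "c m \<noteq> 0" "\<And>x. p x = (\<Sum>k\<le>m. c k * (x $ j) ^ k)"
proof -
  obtain e where fin: "finite {\<alpha>. e \<alpha> \<noteq> 0}" and p: "\<And>x. p x = (\<Sum>\<alpha> | e \<alpha> \<noteq> 0. e \<alpha> * mi_pow x \<alpha>)"
    and top: "\<exists>\<alpha>. e \<alpha> \<noteq> 0 \<and> mi_abs \<alpha> = m" and le: "\<And>\<alpha>. e \<alpha> \<noteq> 0 \<Longrightarrow> mi_abs \<alpha> \<le> m"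
    using assms(1) unfolding polynomial_of_degree_def by blast
  have abs: "mi_abs \<alpha> = \<alpha> j" and pow: "mi_pow x \<alpha> = (x $ j) ^ \<alpha> j" for x \<alpha>
    unfolding mi_abs_def mi_pow_def j by auto
  have const: "(\<lambda>_. \<alpha> j) = \<alpha>" for \<alpha> :: "'d \<Rightarrow> nat"
  proof
    fix i show "\<alpha> j = \<alpha> i" using j by (metis UNIV_I singletonD)
  qed
  define c where "c = (\<lambda>k. e (\<lambda>_. k))"
  have "p x = (\<Sum>k\<le>m. c k * (x $ j) ^ k)" for x
  proof -
    have "(\<Sum>k\<le>m. c k * (x $ j) ^ k) = (\<Sum>k | k \<le> m \<and> c k \<noteq> 0. c k * (x $ j) ^ k)"
      by (rule sum.mono_neutral_right) auto
    also have "\<dots> = (\<Sum>\<alpha> | e \<alpha> \<noteq> 0. e \<alpha> * (x $ j) ^ \<alpha> j)"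
      by (rule sum.reindex_bij_witness[where i = "\<lambda>\<alpha>. \<alpha> j" and j = "\<lambda>k _. k"])
        (use le in \<open>auto simp: c_def const abs\<close>)
    finally show ?thesis unfolding p pow by simp
  qed
  moreover have "c m \<noteq> 0" unfolding c_def using top const abs by metis
  ultimately show ?thesis using that by blast
qed

lemma real_poly_lower_bound:
  fixes d :: "nat \<Rightarrow> real"
  assumes "d n \<noteq> 0"
  obtains X where "X \<ge> 1" "\<And>x. x \<ge> X \<Longrightarrow> \<bar>d n\<bar> / 2 * x ^ n \<le> \<bar>\<Sum>k\<le>n. d k * x ^ k\<bar>"
proof -
  define S where "S = (\<Sum>k<n. \<bar>d k\<bar>)"
  define X where "X = max 1 (2 * S / \<bar>d n\<bar>)"
  have S: "S \<ge> 0" unfolding S_def by (rule sum_nonneg) auto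
  have "\<bar>d n\<bar> / 2 * x ^ n \<le> \<bar>\<Sum>k\<le>n. d k * x ^ k\<bar>" if x: "x \<ge> X" for x
  proof -
    have x1: "x \<ge> 1" "2 * S / \<bar>d n\<bar> \<le> x" using x unfolding X_def by auto
    then have Sx: "2 * S \<le> \<bar>d n\<bar> * x" using assms by (simp add: pos_divide_le_eq mult.commute)
    have "x * \<bar>\<Sum>k<n. d k * x ^ k\<bar> \<le> x * (\<Sum>k<n. \<bar>d k\<bar> * x ^ k)"
      using x1 by (intro mult_left_mono order_trans[OF sum_abs]) (auto simp: abs_mult)
    also have "\<dots> = (\<Sum>k<n. \<bar>d k\<bar> * x ^ Suc k)" by (simp add: sum_distrib_left mult_ac)
    also have "\<dots> \<le> (\<Sum>k<n. \<bar>d k\<bar> * x ^ n)"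
      using x1 by (intro sum_mono mult_left_mono power_increasing) auto
    also have "\<dots> = S * x ^ n" unfolding S_def by (simp add: sum_distrib_right)
    finally have "x * \<bar>\<Sum>k<n. d k * x ^ k\<bar> \<le> S * x ^ n" .
    moreover have "(2 * S) * x ^ n \<le> (\<bar>d n\<bar> * x) * x ^ n" using Sx x1 by (intro mult_right_mono) auto
    ultimately have "x * (2 * \<bar>\<Sum>k<n. d k * x ^ k\<bar>) \<le> x * (\<bar>d n\<bar> * x ^ n)" by (simp add: mult_ac)
    then have "2 * \<bar>\<Sum>k<n. d k * x ^ k\<bar> \<le> \<bar>d n\<bar> * x ^ n" using x1 by simp
    moreover have "(\<Sum>k\<le>n. d k * x ^ k) = (\<Sum>k<n. d k * x ^ k) + d n * x ^ n"
      by (simp add: lessThan_Suc_atMost[symmetric])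
    moreover have "\<bar>d n * x ^ n\<bar> = \<bar>d n\<bar> * x ^ n" using x1 by (simp add: abs_mult)
    ultimately show ?thesis by linarith
  qed
  moreover have "X \<ge> 1" unfolding X_def by simp
  ultimately show ?thesis using that by blast
qed

lemma real_poly_deriv_lower_bound:
  fixes c :: "nat \<Rightarrow> real"
  assumes "c m \<noteq> 0" "m \<ge> 1"
  obtains X b where "X \<ge> 1" "b > 0" "\<And>x. x \<ge> X \<Longrightarrow> b * x ^ (m - 1) \<le> \<bar>\<Sum>k\<le>m. real k * c k * x ^ (k - 1)\<bar>"
proof -
  obtain n where m: "m = Suc n" using assms(2) by (cases m) auto
  define d where "d = (\<lambda>k. real (Suc k) * c (Suc k))"
  have dn: "d n \<noteq> 0" unfolding d_def using assms(1) m by simp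
  have eq: "(\<Sum>k\<le>m. real k * c k * x ^ (k - 1)) = (\<Sum>k\<le>n. d k * x ^ k)" for x
    unfolding m d_def by (subst sum.atMost_Suc_shift) simp
  obtain X where "X \<ge> 1" "\<And>x. x \<ge> X \<Longrightarrow> \<bar>d n\<bar> / 2 * x ^ n \<le> \<bar>\<Sum>k\<le>n. d k * x ^ k\<bar>"
    using real_poly_lower_bound[of d n, OF dn] by metis
  with that[of X "\<bar>d n\<bar> / 2"] dn show ?thesis unfolding eq by (simp add: m)
qed

section \<open>Failure of invariance\<close>

definition one_dim_symbol :: "(nat \<Rightarrow> real) \<Rightarrow> nat \<Rightarrow> complex \<Rightarrow> complex" where
  "one_dim_symbol c m z = (\<Sum>k\<le>m. of_real (c k) * z ^ k)"

definition exponent :: "real \<Rightarrow> (nat \<Rightarrow> real) \<Rightarrow> nat \<Rightarrow> real \<Rightarrow> complex \<Rightarrow> complex" where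
  "exponent t c m a z = - (\<i> * of_real t * one_dim_symbol c m z + bracket_pow a z)"

lemma one_dim_symbol_holomorphic: "one_dim_symbol c m holomorphic_on S"
  unfolding one_dim_symbol_def[abs_def] by (intro holomorphic_intros)

lemma exponent_holomorphic: "exponent t c m a holomorphic_on bracket_domain"
  unfolding exponent_def[abs_def]
  by (intro holomorphic_intros bracket_pow_holomorphic one_dim_symbol_holomorphic)

lemma ball_subset_bracket_domain:
  assumes "cmod (z - of_real x) \<le> x / 2" "x \<ge> 1"
  shows "z \<in> bracket_domain" and "cmod z \<le> 2 * x" and "cmod (1 + z\<^sup>2) \<le> 4 * x\<^sup>2"
proof -
  have "\<bar>Re z - x\<bar> \<le> x / 2" "\<bar>Im z\<bar> \<le> x / 2"
    using assms abs_Re_le_cmod[of "z - of_real x"] abs_Im_le_cmod[of "z - of_real x"] by auto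
  then have "\<bar>Im z\<bar> \<le> \<bar>Re z\<bar>" using assms(2) by linarith
  then have "(Im z)\<^sup>2 \<le> (Re z)\<^sup>2" by (simp add: abs_le_square_iff)
  then show "z \<in> bracket_domain" unfolding bracket_domain_def by (simp add: Re_power2)
  have z: "cmod z \<le> 3 / 2 * x"
    using norm_triangle_ineq[of "z - of_real x" "of_real x"] assms by simp
  then show "cmod z \<le> 2 * x" using assms by linarith
  have "cmod (1 + z\<^sup>2) \<le> 1 + (cmod z)\<^sup>2"
    using norm_triangle_ineq[of 1 "z\<^sup>2"] by (simp add: norm_power)
  also have "\<dots> \<le> x\<^sup>2 + (3 / 2 * x)\<^sup>2"
    using z assms by (intro add_mono power_mono) (auto simp: one_le_power)
  also have "\<dots> \<le> 4 * x\<^sup>2" by (simp add: power_mult_distrib power2_eq_square)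
  finally show "cmod (1 + z\<^sup>2) \<le> 4 * x\<^sup>2" .
qed

text \<open>Since \<open>1 + z\<^sup>2\<close> stays off the negative axis on a disc of radius proportional to its centre \<open>x\<close>, the
  symbol and the bracket power keep there the size that they have at \<open>x\<close>. Cauchy's inequality
  on such discs then gains a full factor \<open>x\<close> with each derivative.\<close>

lemma cmod_exponent_le:
  fixes c :: "nat \<Rightarrow> real"
  assumes a: "a > 0" "2 * a \<le> real m" and z: "cmod (z - of_real x) \<le> x / 2" "x \<ge> 1"
  shows "cmod (bracket_pow a z) \<le> 4 powr a * x powr (2 * a)"
    and "cmod (exponent t c m a z) \<le> (\<bar>t\<bar> * ((\<Sum>k\<le>m. \<bar>c k\<bar>) * 2 ^ m) + 4 powr a) * x ^ m"
proof -
  note dom = ball_subset_bracket_domain[OF z]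
  have "cmod (bracket_pow a z) \<le> (4 * x\<^sup>2) powr a"
    unfolding cmod_bracket_pow[OF dom(1)] using a dom(3) by (intro powr_mono2) auto
  also have "\<dots> = 4 powr a * x powr (2 * a)"
  proof -
    have "x\<^sup>2 = x powr 2" using z(2) by simp
    then show ?thesis by (simp add: powr_mult powr_powr)
  qed
  finally show b: "cmod (bracket_pow a z) \<le> 4 powr a * x powr (2 * a)" .
  have "x powr (2 * a) \<le> x powr (real m)" using a z by (intro powr_mono) auto
  then have "x powr (2 * a) \<le> x ^ m" using z(2) by (simp add: powr_realpow)
  then have b': "cmod (bracket_pow a z) \<le> 4 powr a * x ^ m"
    by (intro order_trans[OF b] mult_left_mono) auto
  have "cmod (one_dim_symbol c m z) \<le> (\<Sum>k\<le>m. \<bar>c k\<bar> * cmod z ^ k)"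
    unfolding one_dim_symbol_def by (intro order_trans[OF norm_sum]) (simp add: norm_mult norm_power)
  also have "\<dots> \<le> (\<Sum>k\<le>m. \<bar>c k\<bar> * (2 * x) ^ m)"
  proof (intro sum_mono mult_left_mono)
    fix k assume "k \<in> {..m}"
    then have "(2 * x) ^ k \<le> (2 * x) ^ m" using z(2) by (intro power_increasing) auto
    moreover have "cmod z ^ k \<le> (2 * x) ^ k" using dom(2) by (intro power_mono) auto
    ultimately show "cmod z ^ k \<le> (2 * x) ^ m" by linarith
  qed auto
  finally have "cmod (one_dim_symbol c m z) \<le> (\<Sum>k\<le>m. \<bar>c k\<bar>) * 2 ^ m * x ^ m"
    by (simp add: sum_distrib_right[symmetric] power_mult_distrib mult.assoc)
  then have "\<bar>t\<bar> * cmod (one_dim_symbol c m z) \<le> \<bar>t\<bar> * ((\<Sum>k\<le>m. \<bar>c k\<bar>) * 2 ^ m * x ^ m)"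
    by (intro mult_left_mono) auto
  moreover have "cmod (exponent t c m a z) \<le> \<bar>t\<bar> * cmod (one_dim_symbol c m z) + cmod (bracket_pow a z)"
    using norm_triangle_ineq[of "\<i> * of_real t * one_dim_symbol c m z" "bracket_pow a z"]
    unfolding exponent_def norm_minus_cancel by (simp add: norm_mult)
  ultimately have "cmod (exponent t c m a z) \<le> \<bar>t\<bar> * ((\<Sum>k\<le>m. \<bar>c k\<bar>) * 2 ^ m * x ^ m) + 4 powr a * x ^ m"
    using b' by linarith
  then show "cmod (exponent t c m a z) \<le> (\<bar>t\<bar> * ((\<Sum>k\<le>m. \<bar>c k\<bar>) * 2 ^ m) + 4 powr a) * x ^ m"
    by (simp add: algebra_simps)
qed

text \<open>On the real axis the derivative of the bracket power is real and that of \<open>i t p\<close> is imaginary, so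
  they cannot cancel.\<close>

lemma cmod_deriv_exponent_ge:
  "\<bar>t\<bar> * \<bar>\<Sum>k\<le>m. real k * c k * x ^ (k - 1)\<bar> \<le> cmod (deriv (exponent t c m a) (of_real x))"
proof -
  let ?z = "of_real x :: complex"
  define R where "R = (1 + x\<^sup>2) powr a * (a * (2 * x / (1 + x\<^sup>2)))"
  have "(one_dim_symbol c m has_field_derivative (\<Sum>k\<le>m. of_real (c k) * (of_nat k * ?z ^ (k - 1)))) (at ?z)"
    unfolding one_dim_symbol_def[abs_def] by (auto intro!: derivative_eq_intros sum.cong)
  moreover have "(bracket_pow a has_field_derivative bracket_pow a ?z * (of_real a * (2 * ?z / (1 + ?z\<^sup>2)))) (at ?z)"
    unfolding bracket_pow_def[abs_def]
    using bracket_domainD[OF of_real_in_bracket_domain[of x]]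
    by (auto intro!: derivative_eq_intros simp: divide_simps)
  ultimately have "(exponent t c m a has_field_derivative
     - (\<i> * of_real t * (\<Sum>k\<le>m. of_real (c k) * (of_nat k * ?z ^ (k - 1)))
        + bracket_pow a ?z * (of_real a * (2 * ?z / (1 + ?z\<^sup>2))))) (at ?z)"
    unfolding exponent_def[abs_def] by (auto intro!: derivative_eq_intros)
  then have "deriv (exponent t c m a) ?z = - (\<i> * of_real t * (\<Sum>k\<le>m. of_real (c k) * (of_nat k * ?z ^ (k - 1)))
        + bracket_pow a ?z * (of_real a * (2 * ?z / (1 + ?z\<^sup>2))))"
    by (rule DERIV_imp_deriv)
  also have "bracket_pow a ?z * (of_real a * (2 * ?z / (1 + ?z\<^sup>2))) = of_real R"
    unfolding bracket_pow_of_real R_def by simp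
  also have "(\<Sum>k\<le>m. of_real (c k) * (of_nat k * ?z ^ (k - 1))) = of_real (\<Sum>k\<le>m. real k * c k * x ^ (k - 1))"
    by (simp add: mult_ac)
  finally have "Im (deriv (exponent t c m a) ?z) = - (t * (\<Sum>k\<le>m. real k * c k * x ^ (k - 1)))"
    by (simp add: Im_sum del: of_real_sum)
  then show ?thesis using abs_Im_le_cmod[of "deriv (exponent t c m a) ?z"] by (simp add: abs_mult)
qed

lemma cmod_second_deriv_exponent_le:
  fixes c :: "nat \<Rightarrow> real"
  assumes a: "a > 0" "2 * a \<le> real m" and x: "x \<ge> 1" and z: "z \<in> ball (of_real x) (x / 4)"
  shows "cmod (deriv (deriv (exponent t c m a)) z)
    \<le> 128 * (\<bar>t\<bar> * ((\<Sum>k\<le>m. \<bar>c k\<bar>) * 2 ^ m) + 4 powr a) * (x ^ m / x\<^sup>2)"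
proof -
  let ?D = "\<bar>t\<bar> * ((\<Sum>k\<le>m. \<bar>c k\<bar>) * 2 ^ m) + 4 powr a"
  have near: "cmod (w - of_real x) \<le> x / 2" if "w \<in> cball z (x / 8)" for w
  proof -
    have "cmod (w - of_real x) \<le> cmod (w - z) + cmod (z - of_real x)"
      using norm_triangle_ineq[of "w - z" "z - of_real x"] by simp
    moreover have "cmod (w - z) \<le> x / 8" "cmod (z - of_real x) < x / 4"
      using that z by (simp_all add: dist_norm norm_minus_commute)
    ultimately show ?thesis using x by linarith
  qed
  have hol: "exponent t c m a holomorphic_on cball z (x / 8)"
    by (rule holomorphic_on_subset[OF exponent_holomorphic]) (use near ball_subset_bracket_domain(1) x in blast)
  have "cmod ((deriv ^^ 2) (exponent t c m a) z) \<le> fact 2 * (?D * x ^ m) / (x / 8) ^ 2"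
  proof (rule Cauchy_inequality)
    show "exponent t c m a holomorphic_on ball z (x / 8)" using hol by (rule holomorphic_on_subset) auto
    show "continuous_on (cball z (x / 8)) (exponent t c m a)" using hol by (rule holomorphic_on_imp_continuous_on)
    fix w assume "cmod (z - w) = x / 8"
    then show "cmod (exponent t c m a w) \<le> ?D * x ^ m"
      using near[of w] x a by (intro cmod_exponent_le(2)) (auto simp: dist_norm)
  qed (use x in auto)
  also have "\<dots> = 128 * ?D * (x ^ m / x\<^sup>2)" by (simp add: power_divide)
  finally show ?thesis by (simp add: numeral_2_eq_2)
qed

lemma le_powr_of_powr_le:
  fixes n Y \<kappa> :: real
  assumes "\<kappa> > 0" "Y > 0" "Y powr (1 / \<kappa>) \<le> n"
  shows "Y \<le> n powr \<kappa>"
proof -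
  have "(Y powr (1 / \<kappa>)) powr \<kappa> \<le> n powr \<kappa>" using assms by (intro powr_mono2) auto
  then show ?thesis using assms by (simp add: powr_powr)
qed

text \<open>The derivative of order \<open>n\<close> is tested at \<open>x = n\<^sup>r\<close>: there the profile is still as large as
  \<open>e\<^bsup>-O(n)\<^esup>\<close>, whereas the symbol oscillates with frequency \<open>x\<^bsup>m-1\<^esup>\<close>. The condition \<open>rm > 2\<close> says that \<open>n\<close>
  is small compared with the number \<open>x\<^bsup>m/2\<^esup>\<close> of oscillations on the scale on which the frequency is
  constant.\<close>

lemma no_uniform_Gevrey_bound:
  fixes c :: "nat \<Rightarrow> real" and t r \<theta> C h :: real
  assumes c: "c m \<noteq> 0" and m: "m \<ge> 2" and t: "t \<noteq> 0" and r: "r > 0" "r * real m > 2"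
    and \<theta>: "\<theta> \<ge> 0" "\<theta> < r * (real m - 1)" and C: "C \<ge> 0" "h > 0"
    and bound: "\<And>n x. cmod ((deriv ^^ n) (\<lambda>z. exp (exponent t c m (1 / (2 * r)) z)) (of_real x)) \<le> C * h ^ n * fact n powr \<theta>"
  shows False
proof -
  define a where "a = 1 / (2 * r)"
  have a: "a > 0" "2 * a \<le> real m" "r * (2 * a) = 1"
  proof -
    show "a > 0" "r * (2 * a) = 1" unfolding a_def using r by auto
    have "2 * a = 1 / r" unfolding a_def by simp
    also have "\<dots> \<le> real m" using r by (simp add: pos_divide_le_eq mult.commute)
    finally show "2 * a \<le> real m" .
  qed
  let ?\<Psi> = "exponent t c m a"
  obtain X b where X: "X \<ge> 1" and b: "b > 0"
    and low: "\<And>x. x \<ge> X \<Longrightarrow> b * x ^ (m - 1) \<le> \<bar>\<Sum>k\<le>m. real k * c k * x ^ (k - 1)\<bar>"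
    using real_poly_deriv_lower_bound[of c m] c m by auto
  define D where "D = 128 * (\<bar>t\<bar> * ((\<Sum>k\<le>m. \<bar>c k\<bar>) * 2 ^ m) + 4 powr a) + 64"
  have D: "D \<ge> 64" "128 * (\<bar>t\<bar> * ((\<Sum>k\<le>m. \<bar>c k\<bar>) * 2 ^ m) + 4 powr a) \<le> D"
    unfolding D_def by (auto intro!: add_nonneg_nonneg mult_nonneg_nonneg sum_nonneg)
  define B where "B = \<bar>t\<bar> * b"
  have B: "B > 0" unfolding B_def using t b by simp
  define E where "E = 4 powr a"
  define K where "K = max 1 (2 * C) * (h * exp E / B)"
  define \<kappa> where "\<kappa> = r * (real m - 1) - \<theta>"
  define \<mu> where "\<mu> = r * real m / 2 - 1"
  have \<kappa>: "\<kappa> > 0" unfolding \<kappa>_def using \<theta> by simp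
  have \<mu>: "\<mu> > 0" unfolding \<mu>_def using r by simp
  have K: "K > 0" unfolding K_def using C B by simp
  \<comment> \<open>The thresholds \<open>K\<close> and \<open>Y\<close> express, respectively, the final contradiction and the condition that \<open>n\<close> be
    small compared with \<open>x\<^bsup>m/2\<^esup>\<close>.\<close>
  define Y where "Y = 10 * sqrt D / B"
  have Y: "Y > 0" unfolding Y_def using D B by simp
  obtain n :: nat where n: "real n \<ge> max 1 (max (X powr (1 / r)) (max ((K + 1) powr (1 / \<kappa>)) (Y powr (1 / \<mu>))))"
    using real_arch_simple by blast
  have n1: "real n \<ge> 1" "X powr (1 / r) \<le> real n" "(K + 1) powr (1 / \<kappa>) \<le> real n" "Y powr (1 / \<mu>) \<le> real n"
    using n by auto
  define x where "x = real n powr r"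
  have xX: "X \<le> x" unfolding x_def using X r n1 by (intro le_powr_of_powr_le) auto
  have x1: "x \<ge> 1" using xX X by linarith
  have xp: "x ^ k = real n powr (r * real k)" for k
    unfolding x_def using n1(1) powr_realpow[of "real n powr r" k] by (simp add: powr_powr)
  \<comment> \<open>The scale on which the second derivative, of size \<open>D x\<^bsup>m-2\<^esup>\<close>, changes the exponent by at most one.\<close>
  define \<rho> where "\<rho> = x / sqrt (D * x ^ m)"
  have xm: "x ^ m \<ge> 1" using x1 by (rule one_le_power)
  have sq: "sqrt (D * x ^ m) \<ge> 8"
  proof -
    have "64 * 1 \<le> D * x ^ m" using D xm by (intro mult_mono) auto
    then have "sqrt 64 \<le> sqrt (D * x ^ m)" by (simp only: real_sqrt_le_iff mult_1_right)
    moreover have "sqrt 64 = (8 :: real)" by (rule real_sqrt_unique) auto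
    ultimately show ?thesis by simp
  qed
  have \<rho>0: "\<rho> > 0" unfolding \<rho>_def using x1 sq by (intro divide_pos_pos) linarith+
  have "\<rho> \<le> x / 8" unfolding \<rho>_def using x1 sq by (intro divide_left_mono mult_pos_pos) linarith+
  then have \<rho>4: "\<rho> < x / 4" using x1 by linarith
  have ball: "ball (of_real x) (x / 4) \<subseteq> bracket_domain"
    using ball_subset_bracket_domain(1)[of _ x] x1 by (auto simp: dist_norm norm_minus_commute)
  have L: "B * x ^ (m - 1) \<le> cmod (deriv ?\<Psi> (of_real x))"
  proof -
    have "B * x ^ (m - 1) = \<bar>t\<bar> * (b * x ^ (m - 1))" unfolding B_def by (rule mult.assoc)
    also have "\<dots> \<le> \<bar>t\<bar> * \<bar>\<Sum>k\<le>m. real k * c k * x ^ (k - 1)\<bar>"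
      by (intro mult_left_mono low xX) auto
    finally show ?thesis using cmod_deriv_exponent_ge by (rule order_trans)
  qed
  have Lpos: "B * x ^ (m - 1) > 0" using B x1 by simp
  have osc: "10 * real n \<le> \<rho> * cmod (deriv ?\<Psi> (of_real x))"
  proof -
    have "Y \<le> real n powr \<mu>" using \<mu> Y n1 by (intro le_powr_of_powr_le) auto
    then have "Y * real n \<le> real n powr \<mu> * real n" by (intro mult_right_mono) auto
    also have "\<dots> = real n powr (r * real m / 2)"
      using n1(1) unfolding \<mu>_def by (simp add: powr_diff)
    also have "\<dots> = sqrt (x ^ m)"
      unfolding xp by (simp add: powr_half_sqrt[symmetric] powr_powr)
    finally have "10 * real n \<le> B / sqrt D * sqrt (x ^ m)"
      using B D unfolding Y_def by (simp add: field_simps)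
    also have "B / sqrt D * sqrt (x ^ m) = \<rho> * (B * x ^ (m - 1))"
    proof -
      define S where "S = sqrt (x ^ m)"
      have S: "S > 0" "S * S = x ^ m" unfolding S_def using x1 by auto
      have "x * x ^ (m - 1) = S * S" unfolding S(2) using m by (cases m) auto
      moreover have "\<rho> * (B * x ^ (m - 1)) = B * (x * x ^ (m - 1)) / (sqrt D * S)"
        unfolding \<rho>_def real_sqrt_mult S_def by (simp add: mult_ac)
      ultimately have "\<rho> * (B * x ^ (m - 1)) = B * (S * S) / (sqrt D * S)" by simp
      also have "\<dots> = B / sqrt D * S" using S(1) by simp
      finally show ?thesis unfolding S_def ..
    qed
    also have "\<dots> \<le> \<rho> * cmod (deriv ?\<Psi> (of_real x))" using L \<rho>0 by (intro mult_left_mono) auto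
    finally show ?thesis .
  qed
  have lower: "cmod (deriv ?\<Psi> (of_real x)) ^ n * cmod (exp (?\<Psi> (of_real x))) / 2
    \<le> cmod ((deriv ^^ n) (\<lambda>z. exp (?\<Psi> z)) (of_real x))"
  proof (rule higher_deriv_exp_lower_bound[OF holomorphic_on_subset[OF exponent_holomorphic ball] \<rho>0 \<rho>4 _ _ osc])
    show "cmod (deriv (deriv ?\<Psi>) z) \<le> D * (x ^ m / x\<^sup>2)" if "z \<in> ball (of_real x) (x / 4)" for z
      by (rule order_trans[OF cmod_second_deriv_exponent_le[OF a(1,2) x1 that] mult_right_mono[OF D(2)]])
        (use x1 in simp)
    show "D * (x ^ m / x\<^sup>2) * \<rho>\<^sup>2 \<le> 1"
      unfolding \<rho>_def using x1 D by (simp add: power_divide)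
    show "deriv ?\<Psi> (of_real x) \<noteq> 0" using L Lpos by auto
  qed
  have expE: "exp (- E * real n) \<le> cmod (exp (?\<Psi> (of_real x)))"
  proof -
    have "cmod (bracket_pow a (of_real x)) \<le> 4 powr a * x powr (2 * a)"
      using x1 by (intro cmod_exponent_le(1)[OF a(1,2)]) auto
    also have "x powr (2 * a) = real n"
      unfolding x_def powr_powr a(3) using n1(1) by simp
    finally have le: "(1 + x\<^sup>2) powr a \<le> E * real n"
      unfolding bracket_pow_of_real E_def by simp
    have "one_dim_symbol c m (of_real x) = of_real (\<Sum>k\<le>m. c k * x ^ k)"
      unfolding one_dim_symbol_def by simp
    then have "Re (?\<Psi> (of_real x)) = - ((1 + x\<^sup>2) powr a)"
      unfolding exponent_def bracket_pow_of_real by (simp del: of_real_sum)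
    then show ?thesis using le by (simp add: norm_exp_eq_Re)
  qed
  have "(B * x ^ (m - 1)) ^ n * exp (- E * real n) / 2 \<le> cmod (deriv ?\<Psi> (of_real x)) ^ n * cmod (exp (?\<Psi> (of_real x))) / 2"
    using L Lpos expE by (intro divide_right_mono mult_mono power_mono) auto
  also note lower
  also have "cmod ((deriv ^^ n) (\<lambda>z. exp (?\<Psi> z)) (of_real x)) \<le> C * h ^ n * fact n powr \<theta>"
    using bound unfolding a_def .
  also have "\<dots> \<le> C * h ^ n * (real n powr \<theta>) ^ n"
  proof -
    have "(fact n :: real) powr \<theta> \<le> (real n ^ n) powr \<theta>"
      using \<theta> fact_le_power[of n, where 'a = real] by (intro powr_mono2) auto
    also have "\<dots> = (real n powr \<theta>) ^ n"
    proof -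
      have "(w ^ k) powr \<theta> = (w powr \<theta>) ^ k" if "w \<ge> 0" for w :: real and k
        using that by (induction k) (auto simp: powr_mult)
      then show ?thesis by simp
    qed
    finally show ?thesis using C by (intro mult_left_mono) auto
  qed
  finally have "(B * x ^ (m - 1)) ^ n * exp (- E * real n) \<le> 2 * C * h ^ n * (real n powr \<theta>) ^ n" by simp
  then have le: "(B * x ^ (m - 1)) ^ n * exp (- E * real n) * exp (E * real n)
      \<le> 2 * C * h ^ n * (real n powr \<theta>) ^ n * exp (E * real n)"
    by (rule mult_right_mono) simp
  have "exp (- E * real n) * exp (E * real n) = 1" by (simp add: exp_minus)
  then have left: "(B * x ^ (m - 1)) ^ n * exp (- E * real n) * exp (E * real n) = (B * x ^ (m - 1)) ^ n"
    by (simp only: mult.assoc mult_1_right)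
  have "exp (E * real n) = exp E ^ n" using exp_of_nat_mult[of n E] by (simp add: mult.commute)
  then have right: "2 * C * h ^ n * (real n powr \<theta>) ^ n * exp (E * real n) = 2 * C * (h * exp E * real n powr \<theta>) ^ n"
    by (simp only: power_mult_distrib mult_ac)
  have ineq: "(B * x ^ (m - 1)) ^ n \<le> 2 * C * (h * exp E * real n powr \<theta>) ^ n"
    using le unfolding left right .
  have "2 * C \<le> max 1 (2 * C) ^ n"
  proof -
    have "max 1 (2 * C) ^ 1 \<le> max 1 (2 * C) ^ n" using n1(1) by (intro power_increasing) auto
    then show ?thesis by simp
  qed
  then have "2 * C * (h * exp E * real n powr \<theta>) ^ n \<le> max 1 (2 * C) ^ n * (h * exp E * real n powr \<theta>) ^ n"
    using C by (intro mult_right_mono) auto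
  with ineq have "(B * x ^ (m - 1)) ^ n \<le> (max 1 (2 * C) * (h * exp E * real n powr \<theta>)) ^ n"
    unfolding power_mult_distrib by linarith
  then have "B * x ^ (m - 1) \<le> max 1 (2 * C) * (h * exp E * real n powr \<theta>)"
    using n1(1) C by (subst (asm) power_mono_iff) (use Lpos in auto)
  moreover have "x ^ (m - 1) = real n powr \<kappa> * real n powr \<theta>"
    unfolding xp \<kappa>_def powr_add[symmetric] using m by (simp add: of_nat_diff)
  ultimately have "B * real n powr \<kappa> * real n powr \<theta> \<le> max 1 (2 * C) * (h * exp E) * real n powr \<theta>"
    by (simp add: mult_ac)
  then have "B * real n powr \<kappa> \<le> max 1 (2 * C) * (h * exp E)" using n1(1) by simp
  then have "real n powr \<kappa> \<le> K" unfolding K_def using B by (simp add: pos_le_divide_eq mult_ac)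
  moreover have "K + 1 \<le> real n powr \<kappa>" using \<kappa> K n1 by (intro le_powr_of_powr_le) auto
  ultimately show False by linarith
qed

lemma cmod_freq_mults:
  "cmod (foldr (freq_mult (-1)) (replicate n j) v x) = \<bar>x $ j\<bar> ^ n * cmod (v x)"
  by (induction n) (auto simp: freq_mult_def norm_mult)

text \<open>Decay of \<open>v\<close> is regularity of its Fourier transform: \<open>n\<close> derivatives of the latter integrate
  \<open>x\<^sup>n v(x)\<close>.\<close>

lemma fourier_Gevrey_bound:
  fixes v :: "real ^ 'd::finite \<Rightarrow> complex"
  assumes j: "(UNIV :: 'd set) = {j}" and pos: "\<theta> > 0" "s > 0" and v: "v \<in> Roumieu \<theta> s"
  obtains C h where "C \<ge> 0" "h > 0"
    "\<And>n \<xi>. cmod (partial_derivs (replicate n j) (fourier v) \<xi>) \<le> C * h ^ n * fact n powr \<theta>"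
proof -
  let ?w = "weight_integral TYPE('d)" and ?c = "fourier_const TYPE('d)"
  obtain h0 where h0: "h0 > 0" "v \<in> GS_step \<theta> s h0" using v unfolding Roumieu_def by auto
  obtain k where k: "k > 0" and gb: "growth_bound \<theta> s (real CARD('d) * GS_norm \<theta> s h0 v) (k * h0) 1 v"
    using GS_step_growth_bound[OF pos, where 'd = 'd] h0 by (metis order_refl)
  define M where "M = real CARD('d) * GS_norm \<theta> s h0 v"
  define l where "l = k * h0"
  have M: "M \<ge> 0" unfolding M_def using GS_norm_nonneg[OF h0(2,1)] by simp
  have l: "l > 0" unfolding l_def using k h0 by simp
  have vn: "norm x ^ n * cmod (v x) \<le> M * l ^ n * growth (1 + \<theta> * real n)" for n x
    using growth_boundD[OF gb, of x n "[]"] unfolding M_def l_def by simp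
  obtain e where e: "e \<ge> 1" "\<And>K. K \<ge> 1 \<Longrightarrow>
    \<exists>C>0. \<forall>a b. growth (K + \<theta> * real a + s * real b) \<le> C * e ^ (a + b) * fact a powr \<theta> * fact b powr s"
    using growth_le_fact[OF pos] by metis
  have "1 + \<theta> * 2 \<ge> 1" using pos by simp
  from e(2)[OF this] obtain F where F: "F > 0"
    "\<And>a b. growth ((1 + \<theta> * 2) + \<theta> * real a + s * real b) \<le> F * e ^ (a + b) * fact a powr \<theta> * fact b powr s" by blast
  have gr: "growth (1 + \<theta> * real n + \<theta> * 2) \<le> F * e ^ n * fact n powr \<theta>" for n
    using F(2)[of n 0] by (simp add: algebra_simps)
  have card: "CARD('d) = 1" unfolding j by simp
  have S: "schwartz v" by (rule Roumieu_schwartz[OF pos v])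
  define C where "C = ?c * (2 * M * (1 + l\<^sup>2) * F * ?w)"
  have w: "?w \<ge> 0" by (rule weight_integral_nonneg)
  have "cmod (partial_derivs (replicate n j) (fourier v) \<xi>) \<le> C * (l * e) ^ n * fact n powr \<theta>" for n \<xi>
  proof -
    let ?v = "foldr (freq_mult (-1)) (replicate n j) v"
    let ?B = "2 * (M * l ^ n * (1 + l\<^sup>2) * (F * e ^ n * fact n powr \<theta>))"
    have "partial_derivs (replicate n j) (fourier v) \<xi> = of_real ?c * osc (-1) ?v \<xi>"
      unfolding fourier_osc
      by (simp only: partial_derivs_cmult[OF smooth_osc[OF schwartz_rapid[OF S]]] partial_derivs_osc[OF schwartz_rapid[OF S]])
    then have eq: "cmod (partial_derivs (replicate n j) (fourier v) \<xi>) = ?c * cmod (osc (-1) ?v \<xi>)"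
      by (simp only: norm_mult norm_of_real) simp
    have "cmod (osc (-1) ?v \<xi>) \<le> ?B * ?w"
    proof (rule order_trans[OF cmod_osc_le weighted_bound_integral(2)])
      show "continuous_on UNIV ?v" by (intro rapid_continuous rapid_freq_mults schwartz_rapid S)
      fix x :: "real ^ 'd"
      have n1: "1 \<le> 1 + \<theta> * real n" "1 + \<theta> * real n \<le> 1 + \<theta> * real n + \<theta> * 2"
        "1 + \<theta> * real (n + 2) = 1 + \<theta> * real n + \<theta> * 2" using pos by (auto simp: algebra_simps)
      have "(1 + norm x) ^ (2 * CARD('d)) * cmod (?v x) = (1 + norm x)\<^sup>2 * (norm x ^ n * cmod (v x))"
        unfolding cmod_freq_mults norm_eq_abs_component[OF j] card by simp
      also have "\<dots> \<le> 2 * (1 + (norm x)\<^sup>2) * (norm x ^ n * cmod (v x))"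
        by (intro mult_right_mono one_plus_square_le) auto
      also have "\<dots> = 2 * (norm x ^ n * cmod (v x) + norm x ^ (n + 2) * cmod (v x))"
        by (simp add: algebra_simps power_add power2_eq_square)
      also have "\<dots> \<le> 2 * (M * l ^ n * growth (1 + \<theta> * real n + \<theta> * 2) + M * l ^ (n + 2) * growth (1 + \<theta> * real n + \<theta> * 2))"
      proof (intro mult_left_mono add_mono)
        show "norm x ^ n * cmod (v x) \<le> M * l ^ n * growth (1 + \<theta> * real n + \<theta> * 2)"
          using M l by (intro order_trans[OF vn] mult_left_mono growth_mono n1) auto
        show "norm x ^ (n + 2) * cmod (v x) \<le> M * l ^ (n + 2) * growth (1 + \<theta> * real n + \<theta> * 2)"
          using vn[of x "n + 2"] unfolding n1(3) .
      qed simp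
      also have "\<dots> = 2 * (M * l ^ n * (1 + l\<^sup>2) * growth (1 + \<theta> * real n + \<theta> * 2))"
        by (simp add: algebra_simps power_add power2_eq_square)
      also have "\<dots> \<le> ?B" using M l by (intro mult_left_mono gr) auto
      finally show "(1 + norm x) ^ (2 * CARD('d)) * cmod (?v x) \<le> ?B" .
    qed
    then have "?c * cmod (osc (-1) ?v \<xi>) \<le> ?c * (?B * ?w)" by (intro mult_left_mono) auto
    then show ?thesis unfolding eq C_def by (simp only: power_mult_distrib mult_ac)
  qed
  moreover have "C \<ge> 0" unfolding C_def using M F w by simp
  moreover have "l * e > 0" using l e(1) by simp
  ultimately show ?thesis using that by blast
qed

text \<open>By Fourier inversion the transform of the image is \<open>e\<^bsup>-itp\<^esup>\<close> times the profile, which is the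
  exponential of \<open>exponent\<close> on the real axis. Decay of the image would contradict
  \<open>no_uniform_Gevrey_bound\<close>.\<close>

theorem propagator_inverse_profile_notin_Roumieu:
  fixes p :: "real ^ 'd::finite \<Rightarrow> real"
  assumes j: "(UNIV :: 'd set) = {j}" and p: "polynomial_of_degree m p" and m: "m \<ge> 2" and t: "t \<noteq> 0"
    and r: "r > 0" "r * real m > 2" and pos: "\<theta> > 0" "s > 0" and \<theta>: "\<theta> < r * (real m - 1)"
    and u: "(inverse_profile j (1 / (2 * r)) :: real ^ 'd \<Rightarrow> complex) \<in> Roumieu \<theta> s"
  shows "propagator p t (inverse_profile j (1 / (2 * r))) \<notin> Roumieu \<theta> s"
proof
  define a where "a = 1 / (2 * r)"
  let ?u = "inverse_profile j a :: real ^ 'd \<Rightarrow> complex"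
  let ?\<phi> = "slice j (profile a) :: real ^ 'd \<Rightarrow> complex"
  let ?c = "fourier_const TYPE('d)"
  assume "propagator p t (inverse_profile j (1 / (2 * r))) \<in> Roumieu \<theta> s"
  then have v: "propagator p t ?u \<in> Roumieu \<theta> s" unfolding a_def .
  have a: "a > 0" unfolding a_def using r by simp
  obtain ps where ps: "p = poly_eval ps" using polynomial_of_degree_poly_eval[OF p] by metis
  obtain c where c: "c m \<noteq> 0" "\<And>x. p x = (\<Sum>k\<le>m. c k * (x $ j) ^ k)"
    using polynomial_of_degree_one_dim[OF p j] by metis
  have c0: "?c \<noteq> 0" by simp
  have cancel: "rapid (osc 1 g)" if "rapid (\<lambda>x. of_real ?c * osc 1 g x)" for g :: "real ^ 'd \<Rightarrow> complex"
    using rapid_cmult[OF that, of "1 / of_real ?c"] c0 by simp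
  have r\<phi>: "rapid ?\<phi>" unfolding slice_profile by (rule rapid_profile_deriv[OF j a])
  have "rapid ?u" using schwartz_rapid[OF Roumieu_schwartz[OF pos u]] unfolding a_def .
  then have "fourier ?u = ?\<phi>"
    unfolding inverse_profile_def[abs_def] by (intro fourier_inverse_osc[OF j r\<phi> cancel])
  define g where "g = (\<lambda>\<xi>. phase t p \<xi> * ?\<phi> \<xi>)"
  have vg: "propagator p t ?u = (\<lambda>x. of_real ?c * osc 1 g x)"
    unfolding propagator_osc \<open>fourier ?u = ?\<phi>\<close> g_def ..
  have rg: "rapid g" unfolding g_def ps by (intro rapid_phase_mult continuous_on_poly_eval r\<phi>)
  have "rapid (propagator p t ?u)" by (intro schwartz_rapid Roumieu_schwartz[OF pos v])
  then have "fourier (propagator p t ?u) = g"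
    unfolding vg by (intro fourier_inverse_osc[OF j rg cancel])
  moreover have "g = slice j (\<lambda>z. exp (exponent t c m a z))"
  proof
    fix \<xi>
    have "one_dim_symbol c m (of_real (\<xi> $ j)) = of_real (p \<xi>)"
      unfolding one_dim_symbol_def c(2) by simp
    then show "g \<xi> = slice j (\<lambda>z. exp (exponent t c m a z)) \<xi>"
      unfolding g_def slice_def phase_def profile_def exponent_def
      by (simp add: exp_add[symmetric] mult.assoc)
  qed
  ultimately have F: "fourier (propagator p t ?u) = slice j (\<lambda>z. exp (exponent t c m a z))" by simp
  obtain C h where Ch: "C \<ge> 0" "h > 0"
    "\<And>n \<xi>. cmod (partial_derivs (replicate n j) (fourier (propagator p t ?u)) \<xi>) \<le> C * h ^ n * fact n powr \<theta>"
    using fourier_Gevrey_bound[OF j pos v] by metis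
  have hol: "(\<lambda>z. exp (exponent t c m a z)) holomorphic_on bracket_domain"
    by (intro holomorphic_intros exponent_holomorphic)
  have "cmod ((deriv ^^ n) (\<lambda>z. exp (exponent t c m (1 / (2 * r)) z)) (of_real x)) \<le> C * h ^ n * fact n powr \<theta>" for n x
    using Ch(3)[of n "\<chi> i. x"]
    unfolding F partial_derivs_slice[OF hol open_bracket_domain of_real_in_bracket_domain]
    by (simp add: slice_def a_def)
  with no_uniform_Gevrey_bound[of c m, OF c(1) m t r less_imp_le[OF pos(1)] \<theta> Ch(1,2)] show False by blast
qed

theorem corollary1p4:
  fixes p :: "real ^ 'd::finite \<Rightarrow> real" and m :: nat and s \<theta> t :: real
  assumes "polynomial_of_degree m p" and "m \<ge> 2" and "s > 0" and "\<theta> > 0"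
  shows
    "(\<theta> \<ge> (real m - 1) * s \<and> (real m - 1) * s \<ge> 1 \<longrightarrow>
        continuous_map (Roumieu_topology \<theta> s) (Roumieu_topology \<theta> s) (propagator p t)) \<and>
     (\<theta> \<ge> (real m - 1) * s \<and> (real m - 1) * s \<ge> 1 \<and> (s, \<theta>) \<noteq> (1 / (real m - 1), 1) \<longrightarrow>
        continuous_map (Beurling_topology \<theta> s) (Beurling_topology \<theta> s) (propagator p t)) \<and>
     (CARD('d) = 1 \<and> 1 \<le> \<theta> \<and> \<theta> < s * real m - max s 1 \<and> (m = 3 \<longrightarrow> s \<ge> 1) \<and> t \<noteq> 0 \<longrightarrow>
        \<not> propagator p t ` Roumieu \<theta> s \<subseteq> Roumieu \<theta> s) \<and>
     (CARD('d) = 1 \<and> 1 < \<theta> \<and> \<theta> < s * real m - max s 1 \<and> (m = 3 \<longrightarrow> s > 1) \<and> t \<noteq> 0 \<longrightarrow>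
        \<not> propagator p t ` Beurling \<theta> s \<subseteq> Beurling \<theta> s)"
proof (intro conjI impI)
  have m1: "m \<ge> 1" using assms(2) by simp
  assume "\<theta> \<ge> (real m - 1) * s \<and> (real m - 1) * s \<ge> 1"
  then show "continuous_map (Roumieu_topology \<theta> s) (Roumieu_topology \<theta> s) (propagator p t)"
    using assms by (intro propagator_continuous_Roumieu[OF assms(1) m1]) linarith+
next
  have m1: "m \<ge> 1" using assms(2) by simp
  assume "\<theta> \<ge> (real m - 1) * s \<and> (real m - 1) * s \<ge> 1 \<and> (s, \<theta>) \<noteq> (1 / (real m - 1), 1)"
  then show "continuous_map (Beurling_topology \<theta> s) (Beurling_topology \<theta> s) (propagator p t)"
    using assms by (intro propagator_continuous_Beurling[OF assms(1) m1]) linarith+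
next
  assume H: "CARD('d) = 1 \<and> 1 \<le> \<theta> \<and> \<theta> < s * real m - max s 1 \<and> (m = 3 \<longrightarrow> s \<ge> 1) \<and> t \<noteq> 0"
  obtain j where j: "(UNIV :: 'd set) = {j}" using H card_1_singletonE by blast
  have "\<theta> < s * real m - s" "2 < s * real m" using H by auto
  then have "\<theta> < s * (real m - 1)" "2 < s * real m" by (simp_all add: right_diff_distrib)
  moreover have u: "(inverse_profile j (1 / (2 * s)) :: real ^ 'd \<Rightarrow> complex) \<in> Roumieu \<theta> s"
    using inverse_profile_Roumieu[OF j assms(3)] H by blast
  ultimately have "propagator p t (inverse_profile j (1 / (2 * s))) \<notin> Roumieu \<theta> s"
    using H assms by (intro propagator_inverse_profile_notin_Roumieu[OF j assms(1,2)]) auto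
  then show "\<not> propagator p t ` Roumieu \<theta> s \<subseteq> Roumieu \<theta> s" using u by blast
next
  assume H: "CARD('d) = 1 \<and> 1 < \<theta> \<and> \<theta> < s * real m - max s 1 \<and> (m = 3 \<longrightarrow> s > 1) \<and> t \<noteq> 0"
  obtain j where j: "(UNIV :: 'd set) = {j}" using H card_1_singletonE by blast
  have "\<theta> < s * real m - s" "2 < s * real m" using H by auto
  then have 1: "\<theta> < s * (real m - 1)" "2 < s * real m" by (simp_all add: right_diff_distrib)
  have m1: "real m > 0" "real m - 1 > 0" using assms(2) by auto
  \<comment> \<open>An index \<open>r\<close> slightly below \<open>s\<close> puts the witness into the Beurling space and keeps both strict
    inequalities.\<close>
  have "max (2 / real m) (\<theta> / (real m - 1)) < s"
    using 1 m1 by (simp add: pos_divide_less_eq)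
  then obtain r where r: "max (2 / real m) (\<theta> / (real m - 1)) < r" "r < s" using dense by blast
  then have r1: "2 < r * real m" "\<theta> < r * (real m - 1)" using m1 by (simp_all add: pos_divide_less_eq)
  have "2 / real m > 0" using m1 by simp
  then have r0: "r > 0" using r(1) by linarith
  have u: "(inverse_profile j (1 / (2 * r)) :: real ^ 'd \<Rightarrow> complex) \<in> Beurling \<theta> s"
    using inverse_profile_Beurling[OF j r0 r(2)] H by blast
  then have "(inverse_profile j (1 / (2 * r)) :: real ^ 'd \<Rightarrow> complex) \<in> Roumieu \<theta> s"
    using Beurling_subset_Roumieu by blast
  then have "propagator p t (inverse_profile j (1 / (2 * r))) \<notin> Roumieu \<theta> s"
    using H r0 r1 assms by (intro propagator_inverse_profile_notin_Roumieu[OF j assms(1,2)]) auto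
  then show "\<not> propagator p t ` Beurling \<theta> s \<subseteq> Beurling \<theta> s" using u Beurling_subset_Roumieu by blast
qed

end
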